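(* Suppose that $n<\omega$ is such that $\mathfrak b<2^{\aleph_n}=\aleph_{n+1}$ and $\square(\aleph_{n+1})$ holds. Then there is an $\aleph_{n+1}$-Souslin tree. If, moreover, every stationary subset of $S^{n+1}_0$ reflects, then there is a uniformly coherent $\aleph_{n+1}$-Souslin tree.
   Context: $\mathfrak b$ is the least size of a family of functions in ${}^\omega\omega$ unbounded with respect to eventual domination. $S^{n+1}_0=\{\alpha<\aleph_{n+1}\mid \mathrm{cf}(\alpha)=\aleph_0\}$. A stationary $T\subseteq\kappa$ reflects if there is $\alpha<\kappa$ of uncountable cofinality with $T\cap\alpha$ stationary in $\alpha$. A $C$-sequence over a regular uncountable $\kappa$ is $\langle C_\alpha\mid\alpha<\kappa\rangle$ with each $C_\alpha$ a closed subset of $\alpha$ with $\sup(C_\alpha)=\sup(\alpha)$; it is coherent if $C_{\bar\alpha}=C_\alpha\cap\bar\alpha$ whenever $\bar\alpha\in\mathrm{acc}(C_\alpha)$ (where $\mathrm{acc}(x)=\{\alpha\in x\mid\sup(x\cap\alpha)=\alpha>0\}$). $\square(\kappa)$ asserts the existence of a coherent $C$-sequence over $\kappa$ with no club $D\subseteq\kappa$ such that $D\cap\alpha=C_\alpha$ for all $\alpha\in\mathrm{acc}(D)$. A $\kappa$-tree $T\subseteq{}^{<\kappa}H_\kappa$ is uniformly coherent if it is downward closed, for all $s,t\in T$ the set $\{\xi\in\mathrm{dom}(s)\cap\mathrm{dom}(t)\mid s(\xi)\neq t(\xi)\}$ is finite, and for all $s,t\in T$ with $\mathrm{dom}(s)\le\mathrm{dom}(t)$,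 $s\cup(t\restriction[\mathrm{dom}(s),\mathrm{dom}(t)))\in T$. *)

theory Defs
  imports Main "HOL-Library.Countable_Set"
begin

text \<open>Ordinals below a cardinal kappa are represented by the elements of a type 'k carrying
a cardinal order r with Field r = UNIV (so r is the initial ordinal kappa = |UNIV::'k|).
For an ordinal alpha, the set of ordinals below alpha is underS r alpha.\<close>

definition olt :: "'k rel \<Rightarrow> 'k \<Rightarrow> 'k \<Rightarrow> bool" where
  "olt r a b \<longleftrightarrow> (a, b) \<in> r \<and> a \<noteq> b"

definition is_sup :: "'k rel \<Rightarrow> 'k set \<Rightarrow> 'k \<Rightarrow> bool" where
  "is_sup r x g \<longleftrightarrow> (\<forall>\<xi>\<in>x. (\<xi>, g) \<in> r) \<and> (\<forall>d. (\<forall>\<xi>\<in>x. (\<xi>, d) \<in> r) \<longrightarrow> (g, d) \<in> r)"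

definition ozero :: "'k rel \<Rightarrow> 'k \<Rightarrow> bool" where
  "ozero r a \<longleftrightarrow> (\<forall>b. (a, b) \<in> r)"

definition lim_pts :: "'k rel \<Rightarrow> 'k set \<Rightarrow> 'k set" where
  "lim_pts r x = {b. \<not> ozero r b \<and> is_sup r (x \<inter> underS r b) b}"

definition acc :: "'k rel \<Rightarrow> 'k set \<Rightarrow> 'k set" where
  "acc r x = x \<inter> lim_pts r x"

definition closed_in_ord :: "'k rel \<Rightarrow> 'k \<Rightarrow> 'k set \<Rightarrow> bool" where
  "closed_in_ord r a C \<longleftrightarrow> C \<subseteq> underS r a \<and> lim_pts r C \<inter> underS r a \<subseteq> C"

definition cofinal_in :: "'k rel \<Rightarrow> 'k \<Rightarrow> 'k set \<Rightarrow> bool" where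
  "cofinal_in r a C \<longleftrightarrow> C \<subseteq> underS r a \<and> (\<forall>\<xi>\<in>underS r a. \<exists>\<eta>\<in>C. (\<xi>, \<eta>) \<in> r)"

definition cf_omega :: "'k rel \<Rightarrow> 'k \<Rightarrow> bool" where
  "cf_omega r a \<longleftrightarrow> (\<exists>C. cofinal_in r a C \<and> (card_of C, card_of (UNIV :: nat set)) \<in> ordIso)
                    \<and> (\<forall>C. cofinal_in r a C \<longrightarrow> infinite C)"

definition cf_uncountable :: "'k rel \<Rightarrow> 'k \<Rightarrow> bool" where
  "cf_uncountable r a \<longleftrightarrow> (\<forall>C. cofinal_in r a C \<longrightarrow> uncountable C)"

definition club_in :: "'k rel \<Rightarrow> 'k \<Rightarrow> 'k set \<Rightarrow> bool" where
  "club_in r a D \<longleftrightarrow> closed_in_ord r a D \<and> cofinal_in r a D"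

definition club :: "'k rel \<Rightarrow> 'k set \<Rightarrow> bool" where
  "club r D \<longleftrightarrow> lim_pts r D \<subseteq> D \<and> (\<forall>\<xi>. \<exists>\<eta>\<in>D. (\<xi>, \<eta>) \<in> r)"

definition stationary_in :: "'k rel \<Rightarrow> 'k \<Rightarrow> 'k set \<Rightarrow> bool" where
  "stationary_in r a T \<longleftrightarrow> T \<subseteq> underS r a \<and> (\<forall>D. club_in r a D \<longrightarrow> T \<inter> D \<noteq> {})"

definition stationary :: "'k rel \<Rightarrow> 'k set \<Rightarrow> bool" where
  "stationary r T \<longleftrightarrow> (\<forall>D. club r D \<longrightarrow> T \<inter> D \<noteq> {})"

definition reflects :: "'k rel \<Rightarrow> 'k set \<Rightarrow> bool" where
  "reflects r T \<longleftrightarrow> (\<exists>a. cf_uncountable r a \<and> stationary_in r a (T \<inter> underS r a))"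

definition S_omega :: "'k rel \<Rightarrow> 'k set" where
  "S_omega r = {a. cf_omega r a}"

definition stat_refl :: "'k rel \<Rightarrow> bool" where
  "stat_refl r \<longleftrightarrow> (\<forall>T. T \<subseteq> S_omega r \<and> stationary r T \<longrightarrow> reflects r T)"

definition C_sequence :: "'k rel \<Rightarrow> ('k \<Rightarrow> 'k set) \<Rightarrow> bool" where
  "C_sequence r C \<longleftrightarrow> (\<forall>a. closed_in_ord r a (C a)
      \<and> (\<forall>g. is_sup r (C a) g \<longleftrightarrow> is_sup r (underS r a) g))"

definition coherent :: "'k rel \<Rightarrow> ('k \<Rightarrow> 'k set) \<Rightarrow> bool" where
  "coherent r C \<longleftrightarrow> (\<forall>a b. b \<in> acc r (C a) \<longrightarrow> C b = C a \<inter> underS r b)"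

definition square :: "'k rel \<Rightarrow> bool" where
  "square r \<longleftrightarrow> (\<exists>C. C_sequence r C \<and> coherent r C \<and>
      \<not> (\<exists>D. club r D \<and> (\<forall>a\<in>acc r D. D \<inter> underS r a = C a)))"

definition inf_cards :: "'k rel \<Rightarrow> 'k set" where
  "inf_cards r = {a. infinite (underS r a) \<and>
      (\<forall>b\<in>underS r a. (card_of (underS r b), card_of (underS r a)) \<in> ordLess)}"

text \<open>kappa = aleph_(n+1): exactly the n+1 infinite cardinals aleph_0, ..., aleph_n lie below kappa\<close>
definition is_aleph_Suc :: "'k rel \<Rightarrow> nat \<Rightarrow> bool" where
  "is_aleph_Suc r n \<longleftrightarrow> finite (inf_cards r) \<and> card (inf_cards r) = Suc n"

definition aleph_set :: "'k rel \<Rightarrow> nat \<Rightarrow> 'k set" where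
  "aleph_set r n = underS r (THE a. a \<in> inf_cards r \<and> card (inf_cards r \<inter> underS r a) = n)"

text \<open>bounding number: b < |X| iff some unbounded family of size < |X| exists\<close>
definition dominated_by :: "(nat \<Rightarrow> nat) \<Rightarrow> (nat \<Rightarrow> nat) \<Rightarrow> bool" where
  "dominated_by f g \<longleftrightarrow> (\<exists>N. \<forall>m\<ge>N. f m \<le> g m)"

definition unbounded_family :: "(nat \<Rightarrow> nat) set \<Rightarrow> bool" where
  "unbounded_family F \<longleftrightarrow> \<not> (\<exists>g. \<forall>f\<in>F. dominated_by f g)"

definition bnum_less :: "'a set \<Rightarrow> bool" where
  "bnum_less X \<longleftrightarrow> (\<exists>F. unbounded_family F \<and> (card_of F, card_of X) \<in> ordLess)"

definition is_tree :: "'n set \<Rightarrow> ('n \<Rightarrow> 'n \<Rightarrow> bool) \<Rightarrow> bool" where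
  "is_tree A lt \<longleftrightarrow> (\<forall>x\<in>A. \<not> lt x x)
     \<and> (\<forall>x\<in>A. \<forall>y\<in>A. \<forall>z\<in>A. lt x y \<and> lt y z \<longrightarrow> lt x z)
     \<and> (\<forall>x\<in>A. (\<forall>y\<in>A. \<forall>z\<in>A. lt y x \<and> lt z x \<longrightarrow> lt y z \<or> y = z \<or> lt z y)
         \<and> wf {(y, z). y \<in> A \<and> z \<in> A \<and> lt y x \<and> lt z x \<and> lt y z})"

definition node_height :: "'k rel \<Rightarrow> 'n set \<Rightarrow> ('n \<Rightarrow> 'n \<Rightarrow> bool) \<Rightarrow> 'n \<Rightarrow> 'k \<Rightarrow> bool" where
  "node_height r A lt x a \<longleftrightarrow> (\<exists>f. bij_betw f {y\<in>A. lt y x} (underS r a) \<and>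
      (\<forall>y\<in>{y\<in>A. lt y x}. \<forall>z\<in>{y\<in>A. lt y x}. lt y z \<longleftrightarrow> olt r (f y) (f z)))"

definition tree_level :: "'k rel \<Rightarrow> 'n set \<Rightarrow> ('n \<Rightarrow> 'n \<Rightarrow> bool) \<Rightarrow> 'k \<Rightarrow> 'n set" where
  "tree_level r A lt a = {x\<in>A. node_height r A lt x a}"

definition kappa_tree :: "'k rel \<Rightarrow> 'n set \<Rightarrow> ('n \<Rightarrow> 'n \<Rightarrow> bool) \<Rightarrow> bool" where
  "kappa_tree r A lt \<longleftrightarrow> is_tree A lt
     \<and> (\<forall>x\<in>A. \<exists>a. node_height r A lt x a)
     \<and> (\<forall>a. tree_level r A lt a \<noteq> {})
     \<and> (\<forall>a. (card_of (tree_level r A lt a), card_of (Field r)) \<in> ordLess)"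

definition is_chain :: "'n set \<Rightarrow> ('n \<Rightarrow> 'n \<Rightarrow> bool) \<Rightarrow> 'n set \<Rightarrow> bool" where
  "is_chain A lt B \<longleftrightarrow> B \<subseteq> A \<and> (\<forall>x\<in>B. \<forall>y\<in>B. lt x y \<or> x = y \<or> lt y x)"

definition is_antichain :: "'n set \<Rightarrow> ('n \<Rightarrow> 'n \<Rightarrow> bool) \<Rightarrow> 'n set \<Rightarrow> bool" where
  "is_antichain A lt B \<longleftrightarrow> B \<subseteq> A \<and> (\<forall>x\<in>B. \<forall>y\<in>B. x \<noteq> y \<longrightarrow> \<not> lt x y \<and> \<not> lt y x)"

definition souslin_tree :: "'k rel \<Rightarrow> 'n set \<Rightarrow> ('n \<Rightarrow> 'n \<Rightarrow> bool) \<Rightarrow> bool" where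
  "souslin_tree r A lt \<longleftrightarrow> kappa_tree r A lt
     \<and> (\<forall>B. is_chain A lt B \<longrightarrow> (card_of B, card_of (Field r)) \<in> ordLess)
     \<and> (\<forall>B. is_antichain A lt B \<longrightarrow> (card_of B, card_of (Field r)) \<in> ordLess)"

text \<open>Uniformly coherent trees of partial functions s : alpha \<rightharpoonup> values, alpha < kappa,
ordered by end-extension (proper map inclusion).\<close>
definition unif_coherent :: "'k rel \<Rightarrow> ('k \<rightharpoonup> 'v) set \<Rightarrow> bool" where
  "unif_coherent r T \<longleftrightarrow>
     (\<forall>s\<in>T. \<exists>a. dom s = underS r a)
     \<and> (\<forall>s\<in>T. \<forall>b. underS r b \<subseteq> dom s \<longrightarrow> s |` underS r b \<in> T)
     \<and> (\<forall>s\<in>T. \<forall>t\<in>T. finite {\<xi> \<in> dom s \<inter> dom t. s \<xi> \<noteq> t \<xi>})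
     \<and> (\<forall>s\<in>T. \<forall>t\<in>T. dom s \<subseteq> dom t \<longrightarrow> (t |` (dom t - dom s)) ++ s \<in> T)"

definition map_lt :: "('k \<rightharpoonup> 'v) \<Rightarrow> ('k \<rightharpoonup> 'v) \<Rightarrow> bool" where
  "map_lt s t \<longleftrightarrow> s \<subseteq>\<^sub>m t \<and> s \<noteq> t"

end

theory Submission
  imports Defs
begin

text \<open>Write kappa = lambda+ with lambda = aleph_n. Since b is uncountable, n > 0, so lambda has uncountable
cofinality and Shelah's theorem turns 2^lambda = lambda+ into diamond on the points of cofinality omega.
A square sequence yields a coherent sequence C such that every club meets the successor points of some
C_a cofinally, where cf a = omega. Inserting finitely many new points below each successor point of C
gives one of lambda many coherent candidates. Were each candidate p to miss some unbounded A_p, code all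
the A_p into one sequence: its initial segments are enumerated in type kappa, hence at each point of C_a
the right one has an index below lambda. Along an omega-sequence of such points, the indices are captured
by a finite search whose length is governed by a function that is not dominated by them; this uses
b < kappa and the fact that [lambda]^omega has cofinality lambda. So some candidate hits every unbounded
set. With diamond, the canonical branches climbing along C seal all antichains.

If every stationary set of points of cofinality omega reflects, then by Fodor's lemma and coherence the
set of successor points of C_a in a given unbounded set has order type a for some a of cofinality omega. There is thus room
to treat every node of the tree below a along the single branch climbing through C_a, and the tree of all
finite modifications of these branches is Souslin.\<close>

unbundle cardinal_syntax

text \<open>Coherence constrains every construction: what is added to \<open>C a\<close> below a
  point \<open>b\<close>, and which node is chosen at level \<open>b\<close>, may depend on
  \<open>b\<close>, on \<open>C a \<inter> {..<b}\<close> and on lower levels, never on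
  \<open>a\<close> or on the set to be met. It also allows only finitely many new points per gap,
  since infinitely many would create a new limit point. So a refinement cannot be aimed at a target.
  The way out is to assume failure for each of the lam many parameters, to code all counterexamples
  together, and only then to read off the parameter that should have succeeded. Diamond need not
  guess at the level \<open>a\<close> where a predense set is sealed. It guesses at successor points
  \<open>b\<close> of \<open>C a\<close>, and the tree constructions use only that the levels with a
  correct guess are unbounded; hitting unbounded sets brings cofinally many of them into one
  \<open>C a\<close>. In the uniformly coherent tree one branch must seal on behalf of all its
  modifications. The order type of the correct guesses met so far is a clock that says whose turn it
  is, because it can be computed at \<open>b\<close> without knowing \<open>a\<close>.\<close>

text \<open>The order type is the cardinal successor kappa of lam, and 2^lam = kappa. The last assumption says that the
countable subsets of lam have a cofinal family of size lam; like lam_cof, it fails for some lam, but it holds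
for aleph_n with n > 0.\<close>

class succ_cardinal = wellorder +
  fixes lam :: 'a
  assumes inf_lam: "infinite {..<lam}"
    and seg_le: "|{..<a}| \<le>o |{..<lam}|"
    and lam_less: "|{..<lam}| <o |UNIV :: 'a set|"
    and lam_initial: "b < lam \<Longrightarrow> |{..<b}| <o |{..<lam}|"
    and lam_cof: "(\<forall>i. f (i::nat) < lam) \<Longrightarrow> \<exists>b<lam. \<forall>i. f i < b"
    and Pow_lam: "|Pow {..<lam}| \<le>o |UNIV :: 'a set|"
    and UNIV_le_Pow: "|UNIV :: 'a set| \<le>o |Pow {..<lam}|"
    and cover_lam: "\<exists>X :: 'a set set. |X| \<le>o |{..<lam}| \<and> (\<forall>x\<in>X. countable x) \<and>
        (\<forall>c. c \<subseteq> {..<lam} \<and> countable c \<longrightarrow> (\<exists>x\<in>X. c \<subseteq> x))"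

section \<open>Clubs and stationary sets\<close>

context wellorder
begin

text \<open>The first conjunct excludes the least element, where the second is vacuous.\<close>

definition limpt :: "'a set \<Rightarrow> 'a \<Rightarrow> bool" where
  "limpt X b \<longleftrightarrow> (\<exists>x. x < b) \<and> (\<forall>x<b. \<exists>y\<in>X. x < y \<and> y < b)"

definition unb :: "'a set \<Rightarrow> bool" where
  "unb X \<longleftrightarrow> (\<forall>x. \<exists>y\<in>X. x < y)"

definition clubset :: "'a set \<Rightarrow> bool" where
  "clubset X \<longleftrightarrow> unb X \<and> (\<forall>b. limpt X b \<longrightarrow> b \<in> X)"

definition stat :: "'a set \<Rightarrow> bool" where
  "stat S \<longleftrightarrow> (\<forall>D. clubset D \<longrightarrow> S \<inter> D \<noteq> {})"

text \<open>The strict inequality \<open>x < f i\<close> excludes successor points, and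
  \<open>f i < b\<close> excludes the least element, so \<open>b\<close> is a limit of cofinality
  exactly omega.\<close>

definition cofw :: "'a \<Rightarrow> bool" where
  "cofw b \<longleftrightarrow> (\<exists>f::nat \<Rightarrow> 'a. (\<forall>i. f i < b) \<and> (\<forall>x<b. \<exists>i. x < f i))"

abbreviation bt :: 'a where "bt \<equiv> (LEAST x. True)"

lemma bt_le [simp]: "bt \<le> x"
  by (simp add: Least_le)

lemma not_less_bt [simp]: "\<not> x < bt"
  by (simp add: not_less)

lemma limpt_mono: "limpt X b \<Longrightarrow> X \<subseteq> Y \<Longrightarrow> limpt Y b"
  unfolding limpt_def by blast

lemma limptD: "limpt X b \<Longrightarrow> x < b \<Longrightarrow> \<exists>y\<in>X. x < y \<and> y < b"
  unfolding limpt_def by blast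

lemma limptI: "x < b \<Longrightarrow> (\<And>x. x < b \<Longrightarrow> \<exists>y\<in>X. x < y \<and> y < b) \<Longrightarrow> limpt X b"
  unfolding limpt_def by blast

lemma limpt_cong: "(\<And>x. x < b \<Longrightarrow> x \<in> X \<longleftrightarrow> x \<in> Y) \<Longrightarrow> limpt X b \<longleftrightarrow> limpt Y b"
  unfolding limpt_def by (metis (no_types))

lemma cofw_limpt: "cofw b \<Longrightarrow> limpt UNIV b"
  unfolding cofw_def limpt_def by (metis UNIV_I)

lemma wf_less: "wf {(x::'a, y). x < y}"
  by (rule wf)

text \<open>Infinitely many points accumulate at a limit point; this is why inserting finitely many
  points into a gap creates no new one.\<close>

lemma limpt_infinite: assumes "limpt X b" "d < b" shows "infinite {y\<in>X. d < y \<and> y < b}"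
proof
  assume fin: "finite {y\<in>X. d < y \<and> y < b}"
  let ?F = "{y\<in>X. d < y \<and> y < b}"
  have "?F \<noteq> {}" using limptD[OF assms] by blast
  then have "Max ?F \<in> ?F" using fin by (rule Max_in[rotated])
  then obtain y where "y \<in> X" "Max ?F < y" "y < b" "d < Max ?F" using limptD[OF assms(1)] by blast
  then have "y \<in> ?F" by (auto intro: less_trans)
  then have "y \<le> Max ?F" using fin by (rule Max_ge[rotated])
  then show False using \<open>Max ?F < y\<close> by simp
qed

lemma clubD_lim: "clubset D \<Longrightarrow> limpt D b \<Longrightarrow> b \<in> D"
  unfolding clubset_def by blast

lemma clubD_unb: "clubset D \<Longrightarrow> \<exists>y\<in>D. x < y"
  unfolding clubset_def unb_def by blast

lemma cofw_seq:
  assumes "cofw b" and ex0: "\<forall>x<b. \<exists>y. x < y \<and> y < b \<and> P y"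
  shows "\<exists>g::nat \<Rightarrow> 'a. (\<forall>i. g i < b \<and> P (g i)) \<and> (\<forall>i j. i < j \<longrightarrow> g i < g j) \<and> (\<forall>x<b. \<exists>i. x < g i)"
proof -
  have ex: "\<exists>y. x < y \<and> y < b \<and> P y" if "x < b" for x using ex0 that by simp
  obtain f :: "nat \<Rightarrow> 'a" where f: "\<And>i. f i < b" "\<And>x. x < b \<Longrightarrow> \<exists>i. x < f i" using assms(1) unfolding cofw_def by blast
  define nx where "nx x = (SOME y. x < y \<and> y < b \<and> P y)" for x
  have nx: "x < nx x \<and> nx x < b \<and> P (nx x)" if "x < b" for x
    unfolding nx_def using someI_ex[OF ex[OF that]] .
  \<comment> \<open>Taking the maximum with \<open>f (Suc n)\<close> before moving up makes the
    sequence increasing and cofinal at once.\<close>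
  define g where "g = rec_nat (nx (f 0)) (\<lambda>n x. nx (max x (f (Suc n))))"
  have g0: "g 0 = nx (f 0)" and gS: "g (Suc n) = nx (max (g n) (f (Suc n)))" for n unfolding g_def by auto
  have gb: "g n < b \<and> P (g n) \<and> f n < g n" for n
  proof (induct n)
    case 0 then show ?case using nx[OF f(1)[of 0]] g0 by simp
  next
    case (Suc n)
    have "max (g n) (f (Suc n)) < b" using Suc f(1) by simp
    from nx[OF this] show ?case using gS[of n] by simp
  qed
  have step: "g n < g (Suc n)" for n
  proof -
    have "max (g n) (f (Suc n)) < b" using gb f(1) by simp
    from nx[OF this] show ?thesis using gS[of n] by simp
  qed
  have mono: "g i < g j" if "i < j" for i j :: nat
    using that
  proof (induct j)
    case (Suc j) then show ?case using step[of j] by (metis less_Suc_eq less_trans)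
  qed simp
  show ?thesis
    using gb mono f(2) by (intro exI[of _ g]) (meson less_trans)
qed

end

section \<open>Cardinal arithmetic for sets of size at most lam\<close>

abbreviation small :: "'b set \<Rightarrow> 'c set \<Rightarrow> bool" where "small L A \<equiv> |A| \<le>o |L|"

context succ_cardinal
begin

abbreviation Lm :: "'a set" where "Lm \<equiv> {..<lam}"

lemma small_seg [simp]: "small Lm {..<a}"
  by (rule seg_le)

lemma small_subset: "small Lm A \<Longrightarrow> B \<subseteq> A \<Longrightarrow> small Lm B"
  by (meson card_of_mono1 ordLeq_transitive)

lemma small_image: "small Lm A \<Longrightarrow> small Lm (f ` A)"
  by (meson card_of_image ordLeq_transitive)

lemma small_UN: "small Lm I \<Longrightarrow> (\<And>i. i \<in> I \<Longrightarrow> small Lm (A i)) \<Longrightarrow> small Lm (\<Union>i\<in>I. A i)"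
  using card_of_UNION_ordLeq_infinite[OF inf_lam] by blast

lemma small_countable: "countable A \<Longrightarrow> small Lm A"
proof -
  assume "countable A"
  then have "|A| \<le>o |UNIV :: nat set|"
    unfolding countable_def by (auto intro: card_of_ordLeqI)
  then show ?thesis using inf_lam infinite_iff_card_of_nat ordLeq_transitive by blast
qed

lemma small_finite: "finite A \<Longrightarrow> small Lm A"
  by (rule small_countable[OF countable_finite])

lemma small_Un: "small Lm A \<Longrightarrow> small Lm B \<Longrightarrow> small Lm (A \<union> B)"
proof -
  assume a: "small Lm A" "small Lm B"
  have "A \<union> B = (\<Union>b\<in>{True, False}. if b then A else B)" by auto
  moreover have "small Lm (\<Union>b\<in>{True, False}. if b then A else B)"
    by (rule small_UN) (use a small_finite[of "{True, False}"] in auto)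
  ultimately show ?thesis by simp
qed

lemma small_Times: "small Lm A \<Longrightarrow> small Lm B \<Longrightarrow> small Lm (A \<times> B)"
proof -
  assume a: "small Lm A" "small Lm B"
  have "A \<times> B = (\<Union>a\<in>A. Pair a ` B)" by auto
  moreover have "small Lm (\<Union>a\<in>A. Pair a ` B)" by (rule small_UN) (intro a small_image)+
  ultimately show ?thesis by simp
qed

lemma small_atMost: "small Lm {..a}"
proof -
  have "{..a} = {..<a} \<union> {a}" by force
  then show ?thesis using small_Un[of "{..<a}" "{a}"] small_finite[of "{a}"] by simp
qed

lemma not_small_UNIV: "\<not> small Lm (UNIV :: 'a set)"
  using lam_less not_ordLess_ordLeq by blast

text \<open>Regularity of kappa: otherwise kappa would be a union of lam many segments, each of size
  at most lam.\<close>

lemma small_bdd: assumes "small Lm (X :: 'a set)" shows "\<exists>b. \<forall>x\<in>X. x < b"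
proof (rule ccontr)
  assume "\<not> ?thesis"
  then have "\<forall>b. \<exists>x\<in>X. b \<le> x" using not_less by blast
  then have "UNIV = (\<Union>x\<in>X. {..x})" by auto
  then show False using small_UN[OF assms, of "\<lambda>x. {..x}"] small_atMost not_small_UNIV by simp
qed

lemma no_max: "\<exists>y. (x::'a) < y"
  using small_bdd[OF small_finite[of "{x}"]] by auto

lemma not_small_unb: "\<not> small Lm X \<Longrightarrow> unb (X :: 'a set)"
proof (rule ccontr)
  assume "\<not> small Lm X" "\<not> unb X"
  then obtain x where "\<forall>y\<in>X. y \<le> x" unfolding unb_def using not_less by blast
  then have "X \<subseteq> {..x}" by auto
  then show False using small_subset[OF small_atMost] \<open>\<not> small Lm X\<close> by blast
qed

lemma bnd_fun:
  assumes "\<And>x. small Lm (A x :: 'a set)"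
  shows "\<exists>h. \<forall>x. \<forall>y\<in>A x. y < h x"
  using small_bdd[OF assms] by metis

text \<open>\<open>H\<close> dominates \<open>h\<close> on whole initial segments, so the supremum
  of the iterates of \<open>H\<close> at \<open>x\<close> is closed under \<open>h\<close>.
  Unboundedness of all the clubs below, and stationarity of the points of cofinality omega, come
  from this construction.\<close>

lemma closure_point:
  fixes h :: "'a \<Rightarrow> 'a"
  shows "\<exists>b. x < b \<and> cofw b \<and> (\<forall>y<b. h y < b)"
proof -
  have "\<exists>H. \<forall>z. \<forall>y\<in>h ` {..z} \<union> {..z}. y < H z"
    by (rule bnd_fun) (intro small_Un small_image small_atMost)
  then obtain H where H: "\<And>z y. y \<le> z \<Longrightarrow> h y < H z" "\<And>z y. y \<le> z \<Longrightarrow> y < H z" by auto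
  define g where "g n = (H ^^ n) x" for n :: nat
  have gS: "g (Suc n) = H (g n)" for n unfolding g_def by simp
  have "\<exists>b. \<forall>y\<in>range g. y < b" by (rule small_bdd) (simp add: small_countable)
  then have ex: "\<exists>b. \<forall>n. g n < b" by auto
  define b where "b = (LEAST b. \<forall>n. g n < b)"
  have gb: "g n < b" for n unfolding b_def using LeastI_ex[OF ex] by blast
  have cof: "\<exists>n. y \<le> g n" if "y < b" for y
    using not_less_Least[OF that[unfolded b_def]] not_less by blast
  have cof2: "\<exists>n. y < g n \<and> h y < g n" if "y < b" for y
    using cof[OF that] H gS by metis
  have "x < b" using gb[of 0] unfolding g_def by simp
  moreover have "cofw b" unfolding cofw_def using gb cof2 by blast
  moreover have "\<forall>y<b. h y < b" using cof2 gb less_trans by blast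
  ultimately show ?thesis by blast
qed

lemma club_closure: "clubset {b. limpt UNIV b \<and> (\<forall>x<b. h x < b)}"
  unfolding clubset_def
proof (intro conjI allI impI)
  show "unb {b. limpt UNIV b \<and> (\<forall>x<b. h x < b)}" unfolding unb_def using closure_point cofw_limpt by blast
  fix b assume l: "limpt {b. limpt UNIV b \<and> (\<forall>x<b. h x < b)} b"
  have "h x < b" if "x < b" for x using limptD[OF l that] by (auto intro: less_trans)
  then show "b \<in> {b. limpt UNIV b \<and> (\<forall>x<b. h x < b)}" using limpt_mono[OF l] by auto
qed

text \<open>Let \<open>h z\<close> bound the next elements above \<open>z\<close> of all
  \<open>D y\<close> with \<open>y \<le> z\<close>. A limit \<open>b\<close> closed under
  \<open>h\<close> is then a limit of every \<open>D x\<close> with \<open>x < b\<close>.\<close>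

lemma club_diag: assumes "\<And>x. clubset (D x)" shows "clubset {b. limpt UNIV b \<and> (\<forall>x<b. b \<in> D x)}"
  unfolding clubset_def
proof (intro conjI allI impI)
  obtain nx where nx: "\<And>y x. nx y x \<in> D y \<and> x < nx y x" using clubD_unb[OF assms] by metis
  have "\<exists>h. \<forall>z. \<forall>y\<in>(\<lambda>y. nx y z) ` {..z}. y < h z"
    by (rule bnd_fun) (intro small_image small_atMost)
  then obtain h where h: "\<And>z y. y \<le> z \<Longrightarrow> nx y z < h z" by auto
  have key: "\<forall>x<b. b \<in> D x" if b: "cofw b" "\<forall>y<b. h y < b" for b
  proof (intro allI impI)
    fix x assume "x < b"
    have "limpt (D x) b"
    proof (rule limptI[OF \<open>x < b\<close>])
      fix z assume "z < b"
      then have "max x z < b" using \<open>x < b\<close> by simp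
      then have "nx x (max x z) < b" using h[of x "max x z"] b(2) by (meson less_trans max.cobounded1)
      then show "\<exists>y\<in>D x. z < y \<and> y < b" using nx[of x "max x z"] by (metis max_less_iff_conj)
    qed
    then show "b \<in> D x" using clubD_lim[OF assms] by blast
  qed
  show "unb {b. limpt UNIV b \<and> (\<forall>x<b. b \<in> D x)}" unfolding unb_def
  proof
    fix x
    obtain b where b: "x < b" "cofw b" "\<forall>y<b. h y < b" using closure_point[of x h] by blast
    then have "b \<in> {b. limpt UNIV b \<and> (\<forall>x<b. b \<in> D x)}" using key[OF b(2,3)] cofw_limpt by simp
    then show "\<exists>y\<in>{b. limpt UNIV b \<and> (\<forall>x<b. b \<in> D x)}. x < y" using b(1) by (rule rev_bexI)
  qed
  fix b assume l: "limpt {b. limpt UNIV b \<and> (\<forall>x<b. b \<in> D x)} b"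
  have "b \<in> D x" if "x < b" for x
  proof -
    have "limpt (D x) b"
    proof (rule limptI[OF that])
      fix z assume "z < b"
      then have "max x z < b" using that by simp
      from limptD[OF l this] show "\<exists>y\<in>D x. z < y \<and> y < b" by auto
    qed
    then show ?thesis using clubD_lim[OF assms] by blast
  qed
  then show "b \<in> {b. limpt UNIV b \<and> (\<forall>x<b. b \<in> D x)}" using limpt_mono[OF l] by auto
qed

lemma club_UNIV: "clubset UNIV"
  unfolding clubset_def unb_def using no_max by auto

lemma club_INT: assumes "small Lm I" "\<And>i. i \<in> I \<Longrightarrow> clubset (D i)" shows "clubset (\<Inter>i\<in>I. D i)"
  unfolding clubset_def
proof (intro conjI allI impI)
  have "\<forall>i x. \<exists>y. i \<in> I \<longrightarrow> y \<in> D i \<and> x < y" using clubD_unb[OF assms(2)] by blast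
  then obtain nx where nx: "\<And>i x. i \<in> I \<Longrightarrow> nx i x \<in> D i \<and> x < nx i x" by metis
  have "\<exists>h. \<forall>z. \<forall>y\<in>(\<lambda>i. nx i z) ` I. y < h z"
    by (rule bnd_fun) (intro small_image assms)
  then obtain h where h: "\<And>z i. i \<in> I \<Longrightarrow> nx i z < h z" by auto
  show "unb (\<Inter>i\<in>I. D i)" unfolding unb_def
  proof
    fix x
    obtain b where b: "x < b" "cofw b" "\<forall>y<b. h y < b" using closure_point by blast
    have "b \<in> D i" if i: "i \<in> I" for i
    proof -
      have "limpt (D i) b"
        by (rule limptI[OF b(1)]) (meson b(3) h i less_trans nx)
      then show ?thesis using clubD_lim[OF assms(2)[OF i]] by blast
    qed
    then show "\<exists>y\<in>\<Inter>i\<in>I. D i. x < y" using b by blast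
  qed
  fix b assume l: "limpt (\<Inter>i\<in>I. D i) b"
  then show "b \<in> (\<Inter>i\<in>I. D i)" using limpt_mono[OF l] clubD_lim[OF assms(2)] by blast
qed

lemma club_Int: assumes "clubset D" "clubset E" shows "clubset (D \<inter> E)"
proof -
  have "small Lm (UNIV :: bool set)" by (rule small_finite) simp
  then have "clubset (\<Inter>i\<in>UNIV. if i then D else E)" by (rule club_INT) (use assms in auto)
  moreover have "(\<Inter>i\<in>UNIV. if i then D else E) = D \<inter> E" by (auto split: if_splits)
  ultimately show ?thesis by simp
qed

lemma club_tail: "clubset {x<..}"
  unfolding clubset_def unb_def
proof (intro conjI allI impI)
  fix y
  obtain z where "max x y < z" using no_max by blast
  then show "\<exists>z\<in>{x<..}. y < z" by auto
next
  fix b assume "limpt {x<..} b"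
  then obtain u where "u < b" unfolding limpt_def by blast
  from limptD[OF \<open>limpt {x<..} b\<close> this] show "b \<in> {x<..}" by (auto intro: less_trans)
qed

lemma club_acc: assumes "clubset D" shows "clubset {b. limpt D b}"
proof -
  obtain nx where nx: "\<And>x. nx x \<in> D \<and> x < nx x" using clubD_unb[OF assms] by metis
  have "limpt D b" if "limpt UNIV b" "\<forall>x<b. nx x < b" for b
    using that nx unfolding limpt_def by blast
  then have "{b. limpt UNIV b \<and> (\<forall>x<b. nx x < b)} \<subseteq> {b. limpt D b}" by blast
  then have "unb {b. limpt D b}" using club_closure[of nx] unfolding clubset_def unb_def by blast
  moreover have "limpt D b" if "limpt {b. limpt D b} b" for b
  proof -
    have "{b. limpt D b} \<subseteq> D" using clubD_lim[OF assms] by blast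
    then show ?thesis using limpt_mono that by blast
  qed
  ultimately show ?thesis unfolding clubset_def by blast
qed

lemma stat_cofw: "stat {b. cofw b}"
  unfolding stat_def
proof (intro allI impI)
  fix D assume D: "clubset D"
  then obtain nx where nx: "\<And>x. nx x \<in> D \<and> x < nx x" using clubD_unb by metis
  obtain b where b: "bt < b" "cofw b" "\<forall>y<b. nx y < b" using closure_point by blast
  have "limpt D b" by (rule limptI[OF b(1)]) (use nx b in blast)
  then show "{b. cofw b} \<inter> D \<noteq> {}" using b clubD_lim[OF D] by blast
qed

lemma stat_Int_club: "stat S \<Longrightarrow> clubset D \<Longrightarrow> stat (S \<inter> D)"
  unfolding stat_def using club_Int by (metis Int_assoc)

lemma stat_gt: "stat S \<Longrightarrow> \<exists>b\<in>S. x < b"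
  using club_tail[of x] unfolding stat_def by blast

lemma fodor: assumes "stat S" "\<And>b. b \<in> S \<Longrightarrow> f b < b" shows "\<exists>e. stat {b\<in>S. f b = e}"
proof (rule ccontr)
  assume "\<not> ?thesis"
  then have "\<forall>e. \<exists>D. clubset D \<and> {b\<in>S. f b = e} \<inter> D = {}" unfolding stat_def by blast
  then obtain D where D: "\<And>e. clubset (D e)" "\<And>e. {b\<in>S. f b = e} \<inter> D e = {}" by metis
  have "S \<inter> {b. limpt UNIV b \<and> (\<forall>x<b. b \<in> D x)} \<noteq> {}"
    using assms(1)[unfolded stat_def, rule_format, OF club_diag[of D, OF D(1)]] .
  then obtain b where b: "b \<in> S" "\<forall>x<b. b \<in> D x" by blast
  then have "b \<in> {b\<in>S. f b = f b} \<inter> D (f b)" using assms(2) by simp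
  then show False using D(2)[of "f b"] b by blast
qed

text \<open>A nonempty small set is the range of a function on lam into Pow lam, and hence a subset of lam x lam.\<close>

lemma enum_small_nonempty:
  fixes M :: "'c set"
  assumes "|M| \<le>o |UNIV :: 'a set|"
  shows "\<exists>w :: 'a \<Rightarrow> 'c set. \<forall>W\<subseteq>M. W \<noteq> {} \<and> small Lm W \<longrightarrow> (\<exists>i. w i = W)"
proof -
  let ?L = "{..<lam}"
  have "|M| \<le>o |Pow ?L|" using assms UNIV_le_Pow ordLeq_transitive by blast
  then obtain c where c: "inj_on c M" "c ` M \<subseteq> Pow ?L" by (meson card_of_ordLeq)
  have "|?L \<times> ?L| \<le>o |?L|" by (rule small_Times) simp_all
  then obtain p where p: "inj_on p (?L \<times> ?L)" "p ` (?L \<times> ?L) \<subseteq> ?L" by (meson card_of_ordLeq)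
  obtain q where q: "inj_on q (Pow ?L)" "q ` Pow ?L \<subseteq> (UNIV :: 'a set)" using Pow_lam by (meson card_of_ordLeq)
  \<comment> \<open>\<open>A\<close> is read as the sequence of its sections under the pairing
    \<open>p\<close>, and \<open>dec A\<close> collects the elements of \<open>M\<close> whose code
    occurs as a section.\<close>
  define dec where "dec A = {m\<in>M. \<exists>x\<in>?L. c m = {y\<in>?L. p (x, y) \<in> A}}" for A
  define w where "w i = dec (inv_into (Pow ?L) q i)" for i
  have "\<exists>i. w i = W" if W: "W \<subseteq> M" "W \<noteq> {}" "small Lm W" for W
  proof -
    obtain s where s: "s ` ?L = W" using W(2,3) by (meson card_of_ordLeq2)
    define A where "A = p ` {(x, y). x \<in> ?L \<and> y \<in> c (s x)}"
    have cs: "c (s x) \<subseteq> ?L" if "x \<in> ?L" for x using c(2) s W(1) that by blast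
    have "A \<subseteq> ?L" unfolding A_def using p(2) cs by fastforce
    have mem: "p (x, y) \<in> A \<longleftrightarrow> y \<in> c (s x)" if "x \<in> ?L" "y \<in> ?L" for x y
    proof
      assume "p (x, y) \<in> A"
      then obtain u where u: "p (x, y) = p u" "fst u \<in> ?L" "snd u \<in> c (s (fst u))" unfolding A_def by fastforce
      then have "u \<in> ?L \<times> ?L" using cs[of "fst u"] by (metis mem_Times_iff subsetD)
      moreover have "(x, y) \<in> ?L \<times> ?L" using that by blast
      ultimately have "(x, y) = u" using inj_onD[OF p(1) u(1)] by blast
      then show "y \<in> c (s x)" using u(3) by auto
    next
      assume "y \<in> c (s x)"
      then show "p (x, y) \<in> A" unfolding A_def using that(1) by (intro imageI) simp
    qed
    have sec: "{y\<in>?L. p (x, y) \<in> A} = c (s x)" if "x \<in> ?L" for x using mem that cs by blast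
    have "dec A = W"
    proof
      show "dec A \<subseteq> W" unfolding dec_def
      proof
        fix m assume "m \<in> {m\<in>M. \<exists>x\<in>?L. c m = {y\<in>?L. p (x, y) \<in> A}}"
        then obtain x where a: "m \<in> M" "x \<in> ?L" "c m = {y\<in>?L. p (x, y) \<in> A}" by blast
        then have "c m = c (s x)" using sec by simp
        then have "m = s x" using inj_onD[OF c(1)] a s W(1) by blast
        then show "m \<in> W" using s a by blast
      qed
      show "W \<subseteq> dec A" unfolding dec_def using sec s W(1) by blast
    qed
    moreover have "w (q A) = dec A" unfolding w_def using q(1) \<open>A \<subseteq> ?L\<close> by (auto simp: inv_into_f_f)
    ultimately show ?thesis by blast
  qed
  then show ?thesis by blast
qed

text \<open>The empty set is brought in by adjoining the dummy element \<open>None\<close>, which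
  makes every set to be enumerated nonempty.\<close>

lemma enum_small:
  fixes M :: "'c set"
  assumes "|M| \<le>o |UNIV :: 'a set|"
  shows "\<exists>w :: 'a \<Rightarrow> 'c set. \<forall>W\<subseteq>M. small Lm W \<longrightarrow> (\<exists>i. w i = W)"
proof -
  have inf: "infinite (UNIV :: 'a set)" using small_finite[of "UNIV :: 'a set"] not_small_UNIV by blast
  have "|Some ` M| \<le>o |UNIV :: 'a set|" using assms card_of_image ordLeq_transitive by blast
  moreover have "|{None :: 'c option}| \<le>o |UNIV :: 'a set|"
    by (rule card_of_singl_ordLeq) simp
  ultimately have "|Some ` M \<union> {None}| \<le>o |UNIV :: 'a set|"
    using inf by (intro card_of_Un_ordLeq_infinite_Field card_of_Card_order) (simp_all add: Field_card_of)
  from enum_small_nonempty[OF this] obtain w0 :: "'a \<Rightarrow> 'c option set"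
    where w0: "\<forall>W\<subseteq>Some ` M \<union> {None}. W \<noteq> {} \<and> small Lm W \<longrightarrow> (\<exists>i. w0 i = W)" ..
  define w where "w i = {m. Some m \<in> w0 i}" for i
  have "\<exists>i. w i = W" if W: "W \<subseteq> M" "small Lm W" for W
  proof -
    have "small Lm (Some ` W \<union> {None})" by (intro small_Un small_image W small_finite) simp
    moreover have "Some ` W \<union> {None} \<subseteq> Some ` M \<union> {None}" using W(1) by auto
    ultimately obtain i where "w0 i = Some ` W \<union> {None}" using w0[rule_format, of "Some ` W \<union> {None}"] by auto
    then have "w i = W" unfolding w_def by auto
    then show ?thesis ..
  qed
  then show ?thesis by (intro exI[of _ w]) simp
qed

section \<open>Diamond on the points of countable cofinality\<close>

lemma infinite_UNIV_kappa: "infinite (UNIV :: 'a set)"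
  using small_finite[of "UNIV :: 'a set"] not_small_UNIV by blast

lemma UNIV_Times: 
  assumes "|A| \<le>o |UNIV :: 'a set|" "|B| \<le>o |UNIV :: 'a set|"
  shows "|A \<times> B| \<le>o |UNIV :: 'a set|"
  using infinite_UNIV_kappa assms by (intro card_of_Times_ordLeq_infinite_Field card_of_Card_order) (simp_all add: Field_card_of)

lemma UNIV_le_UNIV: "|A :: 'a set| \<le>o |UNIV :: 'a set|"
  by (rule card_of_mono1) simp

lemma seg_inj: "\<exists>j. \<forall>a::'a. inj_on (j a) {..<a} \<and> j a ` {..<a} \<subseteq> Lm"
proof -
  have "\<forall>a. \<exists>f. inj_on f {..<a} \<and> f ` {..<a} \<subseteq> Lm"
    using seg_le by (simp add: card_of_ordLeq)
  then show ?thesis by (rule choice)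
qed

lemma lam_cof_fun: assumes "\<And>k::nat. f k < lam" obtains i where "i < lam" "\<And>k. f k < i"
  using lam_cof[of f] assms by blast

text \<open>Shelah's argument. For i < lam, the guesses at a for the t-th set are computed from the pairs (b, g) of points
coded below i that predict the earlier sets s < t correctly up to b. If every such guessing sequence failed, the sets of pairs would
shrink properly lam many times inside a set of size less than lam.\<close>

lemma diamond:
  "\<exists>Z :: 'a \<Rightarrow> 'a set. \<forall>W D. clubset D \<longrightarrow> (\<exists>a\<in>D. cofw a \<and> Z a = W \<inter> {..<a})"
proof (rule ccontr)
  assume neg: "\<not> ?thesis"
  \<comment> \<open>Failure becomes a function: each sequence \<open>Z\<close> is assigned a set
    that it does not guess and a club that witnesses this.\<close>
  have "\<forall>Z :: 'a \<Rightarrow> 'a set. \<exists>p. clubset (snd p) \<and> (\<forall>a\<in>snd p. cofw a \<longrightarrow> Z a \<noteq> fst p \<inter> {..<a})"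
    using neg by force
  from choice[OF this] obtain VE where VE: "\<And>Z :: 'a \<Rightarrow> 'a set. clubset (snd (VE Z))"
    "\<And>(Z :: 'a \<Rightarrow> 'a set) a. a \<in> snd (VE Z) \<Longrightarrow> cofw a \<Longrightarrow> Z a \<noteq> fst (VE Z) \<inter> {..<a}" by blast
  define V where "V Z = fst (VE Z)" for Z
  define E where "E Z = snd (VE Z)" for Z
  obtain j :: "'a \<Rightarrow> 'a \<Rightarrow> 'a" where j: "\<And>a. inj_on (j a) {..<a}" "\<And>a. j a ` {..<a} \<subseteq> Lm" using seg_inj by blast
  have "|UNIV \<times> UNIV \<times> UNIV :: ('a \<times> 'a \<times> 'a) set| \<le>o |UNIV :: 'a set|"
    by (intro UNIV_Times UNIV_le_UNIV)
  from enum_small[OF this] obtain w :: "'a \<Rightarrow> ('a \<times> 'a \<times> 'a) set"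
    where w: "\<And>W. small Lm W \<Longrightarrow> \<exists>i. w i = W" by auto
  \<comment> \<open>A code \<open>g\<close> stands for a two-dimensional array of sets; its entry at
    \<open>(i, t)\<close> is read as a prediction of an initial part of
    \<open>Zf i t\<close>.\<close>
  define sec where "sec i t g = {x. (i, t, x) \<in> w g}" for i t g
  define Pr where "Pr i P t a = {(b, g). b < a \<and> g < a \<and> j a b < i \<and> j a g < i \<and> (\<forall>s<t. sec i s g = P s \<inter> {..<b})}"
    for i and P :: "'a \<Rightarrow> 'a set" and t a
  define G where "G i P t a = (\<Union>p\<in>Pr i P t a. sec i t (snd p))" for i P t a
  \<comment> \<open>The t-th set is one that is missed by the guesses computed from the earlier
    sets. The recursion is sound because \<open>Pr i P t\<close> looks at \<open>P s\<close> only
    for \<open>s < t\<close>.\<close>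
  define Zf where "Zf i = wfrec {(x, y). x < y} (\<lambda>P t. V (G i P t))" for i
  have Zeq: "Zf i t = V (G i (Zf i) t)" for i t
  proof -
    have "Zf i t = V (G i (cut (Zf i) {(x, y). x < y} t) t)"
      unfolding Zf_def by (subst wfrec[OF wf_less]) simp
    moreover have "G i (cut (Zf i) {(x, y). x < y} t) t = G i (Zf i) t"
      unfolding G_def Pr_def by (simp add: cut_apply)
    ultimately show ?thesis by simp
  qed
  define Ef where "Ef i t = E (G i (Zf i) t)" for i t
  define A where "A = {(i, t, x). i \<in> Lm \<and> t \<in> Lm \<and> x \<in> Zf i t}"
  have "\<exists>i. w i = A \<inter> UNIV \<times> UNIV \<times> {..<b}" for b
  proof (rule w, rule small_subset)
    show "small Lm (Lm \<times> Lm \<times> {..<b})" by (intro small_Times small_seg)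
    show "A \<inter> UNIV \<times> UNIV \<times> {..<b} \<subseteq> Lm \<times> Lm \<times> {..<b}" unfolding A_def by blast
  qed
  then obtain io where io: "\<And>b. w (io b) = A \<inter> UNIV \<times> UNIV \<times> {..<b}" by metis
  have sec_io: "sec i t (io b) = Zf i t \<inter> {..<b}" if "i < lam" "t < lam" for i t b
    unfolding sec_def io A_def using that by auto
  \<comment> \<open>At a point of \<open>?D\<close> of cofinality omega all lam times lam guessing
    sequences fail, and the codes \<open>io x\<close> of the true sets up to smaller points
    \<open>x\<close> stay below it.\<close>
  let ?D = "(\<Inter>i\<in>Lm. \<Inter>t\<in>Lm. Ef i t) \<inter> {b. limpt UNIV b \<and> (\<forall>x<b. io x < b)}"
  have "clubset ?D"
    by (intro club_Int club_INT club_closure small_seg) (simp add: Ef_def E_def VE(1))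
  then have "{b. cofw b} \<inter> ?D \<noteq> {}" using stat_cofw unfolding stat_def by blast
  then obtain a where a: "cofw a" "\<And>i t. i < lam \<Longrightarrow> t < lam \<Longrightarrow> a \<in> Ef i t" "\<And>x. x < a \<Longrightarrow> io x < a"
    by auto
  obtain f :: "nat \<Rightarrow> 'a" where f: "\<And>k. f k < a" "\<And>x. x < a \<Longrightarrow> \<exists>k. x < f k" using a(1) unfolding cofw_def by blast
  have jl: "j a x < lam" if "x < a" for x using j(2)[of a] that by blast
  obtain i1 where i1: "i1 < lam" "\<And>k. j a (f k) < i1" by (rule lam_cof_fun[of "\<lambda>k. j a (f k)"]) (use jl f in auto)
  obtain i2 where i2: "i2 < lam" "\<And>k. j a (io (f k)) < i2" by (rule lam_cof_fun[of "\<lambda>k. j a (io (f k))"]) (use jl f a in auto)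
  \<comment> \<open>Uncountable cofinality of lam gives one \<open>i\<close> above the codes of the
    countably many correct pairs \<open>(f k, io (f k))\<close>, which therefore lie in
    \<open>Pr\<close> for every \<open>t < lam\<close>.\<close>
  define i where "i = max i1 i2"
  have i: "i < lam" "\<And>k. j a (f k) < i" "\<And>k. j a (io (f k)) < i" unfolding i_def using i1 i2 by (auto simp: less_max_iff_disj)
  have inPr: "(f k, io (f k)) \<in> Pr i (Zf i) t a" if "t < lam" for t k
    unfolding Pr_def using f a(3) i sec_io[OF i(1)] less_trans[OF _ that] by simp
  \<comment> \<open>If all pairs were right about the t-th set, the guess would equal
    \<open>Zf i t \<inter> {..<a}\<close>, because the correct pairs have cofinal first components.
    But \<open>Zf i t\<close> was chosen to defeat this guess.\<close>
  have ex: "\<exists>p. p \<in> Pr i (Zf i) t a \<and> sec i t (snd p) \<noteq> Zf i t \<inter> {..<fst p}" if t: "t < lam" for t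
  proof (rule ccontr)
    assume "\<not> ?thesis"
    then have eq: "\<And>p. p \<in> Pr i (Zf i) t a \<Longrightarrow> sec i t (snd p) = Zf i t \<inter> {..<fst p}" by blast
    have "G i (Zf i) t a = Zf i t \<inter> {..<a}"
    proof
      show "G i (Zf i) t a \<subseteq> Zf i t \<inter> {..<a}"
      proof
        fix x assume "x \<in> G i (Zf i) t a"
        then obtain p where p: "p \<in> Pr i (Zf i) t a" "x \<in> sec i t (snd p)" unfolding G_def by blast
        then have "x \<in> Zf i t" "x < fst p" using eq by auto
        moreover have "fst p < a" using p(1) unfolding Pr_def by auto
        ultimately show "x \<in> Zf i t \<inter> {..<a}" by (simp add: less_trans[of x "fst p" a])
      qed
      show "Zf i t \<inter> {..<a} \<subseteq> G i (Zf i) t a"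
      proof
        fix x assume x: "x \<in> Zf i t \<inter> {..<a}"
        then obtain k where "x < f k" using f(2) by auto
        then have "x \<in> sec i t (io (f k))" using sec_io[OF i(1) t] x by auto
        then show "x \<in> G i (Zf i) t a" unfolding G_def using inPr[OF t, of k] by force
      qed
    qed
    moreover have "Zf i t = fst (VE (G i (Zf i) t))" using Zeq[of i t] unfolding V_def .
    moreover have "a \<in> snd (VE (G i (Zf i) t))" using a(2)[OF i(1) t] unfolding Ef_def E_def .
    ultimately show False using VE(2)[of a "G i (Zf i) t"] a(1) by simp
  qed
  then obtain q where q: "\<And>t. t < lam \<Longrightarrow> q t \<in> Pr i (Zf i) t a \<and> sec i t (snd (q t)) \<noteq> Zf i t \<inter> {..<fst (q t)}" by metis
  \<comment> \<open>The pair \<open>q t\<close> is right about every \<open>s < t\<close>, whereas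
    \<open>q s\<close> is wrong about \<open>s\<close>.\<close>
  have ne: "q s \<noteq> q t" if "s < t" "t < lam" for s t
  proof
    assume "q s = q t"
    moreover have "sec i s (snd (q t)) = Zf i s \<inter> {..<fst (q t)}" using q[OF that(2)] that(1) unfolding Pr_def by auto
    ultimately show False using q[of s] less_trans[OF that] by simp
  qed
  have "inj_on q Lm"
  proof (rule inj_onI)
    fix s t assume "s \<in> Lm" "t \<in> Lm" "q s = q t"
    then show "s = t" using ne[of s t] ne[of t s] by (cases s t rule: linorder_cases) auto
  qed
  moreover define Q where "Q = {b. b < a \<and> j a b < i}"
  have "q ` Lm \<subseteq> Q \<times> Q" unfolding Q_def using q unfolding Pr_def by fastforce
  ultimately have "|Lm| \<le>o |Q \<times> Q|" by (meson card_of_ordLeq)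
  moreover have "|Q| <o |Lm|"
  proof -
    have "inj_on (j a) Q" by (rule inj_on_subset[OF j(1)[of a]]) (auto simp: Q_def)
    moreover have "j a ` Q \<subseteq> {..<i}" unfolding Q_def by auto
    ultimately have "|Q| \<le>o |{..<i}|" by (meson card_of_ordLeq)
    then show ?thesis using lam_initial[OF i(1)] ordLeq_ordLess_trans by blast
  qed
  then have "|Q \<times> Q| <o |Lm|"
    using inf_lam card_of_Times_same_infinite[of Q]
      finite_ordLess_infinite[OF card_of_Well_order card_of_Well_order, of "Q \<times> Q" Lm]
    by (cases "finite Q") (auto intro: ordIso_ordLess_trans simp: Field_card_of)
  ultimately show False using not_ordLess_ordLeq by blast
qed

end

section \<open>Club guessing along a coherent sequence\<close>

context wellorder
begin

text \<open>A coherent C-sequence seen at limit points only; the values at other points are left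
  arbitrary.\<close>

definition coh_seq :: "('a \<Rightarrow> 'a set) \<Rightarrow> bool" where
  "coh_seq C \<longleftrightarrow> (\<forall>a. limpt UNIV a \<longrightarrow> C a \<subseteq> {..<a} \<and> limpt (C a) a \<and>
     (\<forall>b<a. limpt (C a) b \<longrightarrow> b \<in> C a \<and> C b = C a \<inter> {..<b}))"

lemma coh_seqD:
  assumes "coh_seq C" "limpt UNIV a"
  shows "\<And>x. x \<in> C a \<Longrightarrow> x < a" "limpt (C a) a"
    "\<And>b. b < a \<Longrightarrow> limpt (C a) b \<Longrightarrow> b \<in> C a" "\<And>b. b < a \<Longrightarrow> limpt (C a) b \<Longrightarrow> C b = C a \<inter> {..<b}"
  using assms unfolding coh_seq_def by auto

text \<open>For a club \<open>D\<close> containing the least element this is the largest member of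
  \<open>D\<close> not exceeding \<open>b\<close>. The condition \<open>bt \<in> D\<close> ensures
  that there is one for every \<open>b\<close>.\<close>

definition lower :: "'a set \<Rightarrow> 'a \<Rightarrow> 'a" where
  "lower D b = (LEAST u. \<forall>d\<in>D. d \<le> b \<longrightarrow> d \<le> u)"

lemma lower_props:
  assumes D: "clubset D" "bt \<in> D"
  shows lower_in: "lower D b \<in> D" and lower_le: "lower D b \<le> b"
    and lower_ge: "\<And>d. d \<in> D \<Longrightarrow> d \<le> b \<Longrightarrow> d \<le> lower D b"
proof -
  have ub: "\<forall>d\<in>D. d \<le> b \<longrightarrow> d \<le> lower D b"
    unfolding lower_def by (rule LeastI[of _ b]) simp
  then show "\<And>d. d \<in> D \<Longrightarrow> d \<le> b \<Longrightarrow> d \<le> lower D b" by simp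
  show le: "lower D b \<le> b" unfolding lower_def by (rule Least_le) simp
  show "lower D b \<in> D"
  proof (rule ccontr)
    assume n: "lower D b \<notin> D"
    have "limpt D (lower D b)"
    proof (rule limptI[of bt])
      have "bt \<noteq> lower D b" using n D(2) by metis
      then show "bt < lower D b" by (simp add: less_le)
      fix x assume "x < lower D b"
      from not_less_Least[OF this[unfolded lower_def]]
      obtain d where d: "d \<in> D" "d \<le> b" "x < d" by (auto simp: not_le)
      then have "d \<le> lower D b" "d \<noteq> lower D b" using ub n by auto
      then show "\<exists>y\<in>D. x < y \<and> y < lower D b" using d by (intro bexI[of _ d]) auto
    qed
    then show False using clubD_lim[OF D(1)] n by simp
  qed
qed

text \<open>Pulling down never crosses a point of \<open>D\<close>, so it commutes with cutting off
  at such a point.\<close>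

lemma lower_less_iff:
  assumes "clubset D" "bt \<in> D" "g \<in> D"
  shows "lower D b < g \<longleftrightarrow> b < g"
  using lower_le[OF assms(1,2), of b] lower_ge[OF assms(1,2,3), of b]
  by (metis le_less_trans not_less)

text \<open>Pulling the points of C_a down to the largest points of a club D that do not exceed them. Shrinking D repeatedly makes
these points stabilise, which is the usual proof of club guessing.\<close>

definition pull :: "('a \<Rightarrow> 'a set) \<Rightarrow> 'a set \<Rightarrow> 'a \<Rightarrow> 'a set" where
  "pull C D a = (if limpt D a then lower D ` C a else {b\<in>C a. \<forall>d\<in>D. d < a \<longrightarrow> d < b})"

text \<open>A limit of pulled points is a limit of \<open>D\<close> and hence in \<open>D\<close>.
  As pulling does not cross it, it is also a limit of the original points, and coherence of
  \<open>C\<close> can be applied there.\<close>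

lemma limpt_pull:
  assumes C: "coh_seq C" and D: "clubset D" "bt \<in> D" and a: "limpt D a" and g: "limpt (lower D ` C a) g" "g < a"
  shows "limpt D g" "limpt (C a) g" "g \<in> C a" "lower D ` C a \<inter> {..<g} = lower D ` (C a \<inter> {..<g})" "lower D g = g"
proof -
  note ca = coh_seqD[OF C limpt_mono[OF a subset_UNIV]]
  show lD: "limpt D g" by (rule limpt_mono[OF g(1)]) (use lower_in[OF D] in auto)
  then have gD: "g \<in> D" by (rule clubD_lim[OF D(1)])
  note iff = lower_less_iff[OF D gD]
  have "\<exists>x. x < g" using lD unfolding limpt_def by simp
  then obtain x0 where x0: "x0 < g" ..
  show lC: "limpt (C a) g"
  proof (rule limptI[OF x0])
    fix x assume "x < g"
    from limptD[OF g(1) this] obtain b where b: "b \<in> C a" "x < lower D b" "lower D b < g" by auto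
    then show "\<exists>y\<in>C a. x < y \<and> y < g" using iff lower_le[OF D, of b] by (intro bexI[of _ b]) auto
  qed
  show "g \<in> C a" by (rule ca(3)[OF g(2) lC])
  show "lower D ` C a \<inter> {..<g} = lower D ` (C a \<inter> {..<g})" using iff by auto
  show "lower D g = g" using lower_le[OF D, of g] lower_ge[OF D gD, of g] by simp
qed

text \<open>If \<open>a\<close> is not a limit of \<open>D\<close>, the set
  \<open>D \<inter> {..<a}\<close> is bounded below \<open>a\<close>. The limit points of the part
  of \<open>C a\<close> beyond it are not limits of \<open>D\<close> either, so the same case of the
  definition governs them.\<close>

lemma coh_seq_pull:
  assumes C: "coh_seq C" and D: "clubset D" "bt \<in> D"
  shows "coh_seq (pull C D)"
  unfolding coh_seq_def
proof (intro allI impI)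
  fix a assume l: "limpt UNIV a"
  note ca = coh_seqD[OF C l]
  show "pull C D a \<subseteq> {..<a} \<and> limpt (pull C D a) a \<and>
     (\<forall>b<a. limpt (pull C D a) b \<longrightarrow> b \<in> pull C D a \<and> pull C D b = pull C D a \<inter> {..<b})"
  proof (cases "limpt D a")
    case True
    then have e: "pull C D a = lower D ` C a" unfolding pull_def by simp
    have "lower D ` C a \<subseteq> {..<a}" using ca(1) lower_le[OF D] by (auto intro: le_less_trans)
    moreover have "limpt (lower D ` C a) a"
    proof -
      have "\<exists>x. x < a" using l unfolding limpt_def by simp
      then obtain x0 where x0: "x0 < a" ..
      show ?thesis
      proof (rule limptI[OF x0])
        fix x assume "x < a"
        from limptD[OF True this] obtain d where d: "d \<in> D" "x < d" "d < a" by auto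
        from limptD[OF ca(2) d(3)] obtain b where b: "b \<in> C a" "d < b" "b < a" by auto
        have "d \<le> lower D b" using lower_ge[OF D d(1)] b by simp
        then show "\<exists>y\<in>lower D ` C a. x < y \<and> y < a"
          using d b lower_le[OF D, of b] by (intro bexI[of _ "lower D b"]) auto
      qed
    qed
    moreover have "g \<in> lower D ` C a \<and> pull C D g = lower D ` C a \<inter> {..<g}" if g: "g < a" "limpt (lower D ` C a) g" for g
    proof -
      note p = limpt_pull[OF C D True g(2,1)]
      have "pull C D g = lower D ` (C a \<inter> {..<g})" unfolding pull_def using p(1) ca(4)[OF g(1) p(2)] by simp
      then show ?thesis using p(3,4,5) by (metis imageI)
    qed
    ultimately show ?thesis unfolding e by simp
  next
    case False
    let ?c = "{b\<in>C a. \<forall>d\<in>D. d < a \<longrightarrow> d < b}"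
    have e: "pull C D a = ?c" unfolding pull_def using False by simp
    have "\<exists>x<a. \<forall>d\<in>D. d < a \<longrightarrow> d \<le> x" using False l unfolding limpt_def by (metis not_less)
    then obtain x where x: "x < a" "\<And>d. d \<in> D \<Longrightarrow> d < a \<Longrightarrow> d \<le> x" by auto
    have "?c \<subseteq> {..<a}" using ca(1) by auto
    moreover have "limpt ?c a"
    proof (rule limptI[OF x(1)])
      fix z assume "z < a"
      then have "max x z < a" using x(1) by simp
      from limptD[OF ca(2) this] obtain b where b: "b \<in> C a" "max x z < b" "b < a" by auto
      then have "b \<in> ?c" using x(2) by (auto intro: le_less_trans)
      then show "\<exists>y\<in>?c. z < y \<and> y < a" using b by (intro bexI[of _ b]) auto
    qed
    moreover have "g \<in> ?c \<and> pull C D g = ?c \<inter> {..<g}" if g: "g < a" "limpt ?c g" for g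
    proof -
      have lC: "limpt (C a) g" by (rule limpt_mono[OF g(2)]) auto
      obtain b where b: "b \<in> ?c" "b < g" using g(2) unfolding limpt_def by auto
      have dg: "d < b" if "d \<in> D" "d < a" for d using b that by auto
      have "\<not> limpt D g"
      proof
        assume "limpt D g"
        from limptD[OF this b(2)] obtain d where "d \<in> D" "b < d" "d < g" by auto
        then show False using dg[of d] g(1) less_trans[of d g a] by auto
      qed
      then have "pull C D g = {b\<in>C g. \<forall>d\<in>D. d < g \<longrightarrow> d < b}" unfolding pull_def by simp
      also have "\<dots> = {b\<in>C a \<inter> {..<g}. \<forall>d\<in>D. d < g \<longrightarrow> d < b}" using ca(4)[OF g(1) lC] by simp
      also have "\<dots> = ?c \<inter> {..<g}" using dg b(2) g(1) by (auto intro: less_trans)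
      finally have "pull C D g = ?c \<inter> {..<g}" .
      moreover have "g \<in> ?c" using ca(3)[OF g(1) lC] dg b(2) by (auto intro: less_trans)
      ultimately show ?thesis by simp
    qed
    ultimately show ?thesis unfolding e by simp
  qed
qed

lemma club_insert_bt: "clubset D \<Longrightarrow> clubset (insert bt D)"
proof -
  assume D: "clubset D"
  have "limpt D b" if "limpt (insert bt D) b" for b
    using that unfolding limpt_def by (metis insert_iff not_less_bt)
  then show ?thesis using D unfolding clubset_def unb_def by auto
qed

end

context succ_cardinal
begin

lemma lam_no_max: assumes "i < lam" shows "\<exists>k<lam. i < k"
  using lam_cof[of "\<lambda>_. i"] assms by auto

lemma lam_ne: "\<exists>i. i < lam"
  using inf_lam by (metis finite.emptyI lessThan_iff equals0I)

lemma club_hitting: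
  assumes C: "coh_seq C"
    and nothread: "\<And>D. clubset D \<Longrightarrow> \<exists>a. limpt D a \<and> D \<inter> {..<a} \<noteq> C a"
  shows "\<exists>C'. coh_seq C' \<and> (\<forall>E. clubset E \<longrightarrow> (\<exists>a. cofw a \<and> (\<forall>x<a. \<exists>b\<in>C' a \<inter> E. x < b \<and> \<not> limpt (C' a) b)))"
proof (rule ccontr)
  assume neg: "\<not> ?thesis"
  have "\<forall>D. \<exists>E. clubset D \<and> bt \<in> D \<longrightarrow> clubset E \<and> (\<forall>a. cofw a \<longrightarrow> (\<exists>x<a. \<forall>b\<in>pull C D a \<inter> E. x < b \<longrightarrow> limpt (pull C D a) b))"
    using neg coh_seq_pull[OF C] by metis
  from choice[OF this] obtain E where E0: "\<forall>D. clubset D \<and> bt \<in> D \<longrightarrow> clubset (E D) \<and> (\<forall>a. cofw a \<longrightarrow> (\<exists>x<a. \<forall>b\<in>pull C D a \<inter> E D. x < b \<longrightarrow> limpt (pull C D a) b))" ..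
  then have E: "clubset (E D)" "\<And>a. cofw a \<Longrightarrow> \<exists>x<a. \<forall>b\<in>pull C D a \<inter> E D. x < b \<longrightarrow> limpt (pull C D a) b"
    if "clubset D" "bt \<in> D" for D using that by auto
  \<comment> \<open>The clubs decrease, and from stage \<open>Suc\<close>-like successors of
    \<open>k\<close> on they lie inside the club that defeats \<open>pull C (Di k)\<close>, apart
    from the least element, which is put back because \<open>lower\<close> relies on it.\<close>
  define Di where "Di = wfrec {(x, y). x < y} (\<lambda>P i. insert bt (\<Inter>k\<in>{..<i}. E (P k)))"
  have Di: "Di i = insert bt (\<Inter>k\<in>{..<i}. E (Di k))" for i
    unfolding Di_def by (subst wfrec[OF wf_less]) (simp add: cut_apply)
  have bD: "bt \<in> Di i" for i by (subst Di) simp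
  have cD: "clubset (Di i)" for i
  proof (induct i rule: less_induct)
    case (less i)
    have "clubset (\<Inter>k\<in>{..<i}. E (Di k))" by (rule club_INT[OF small_seg]) (use less E(1) bD in auto)
    then show ?case by (subst Di) (rule club_insert_bt)
  qed
  have sub: "Di k \<subseteq> Di i" if "i \<le> k" for i k
    using that Di[of i] Di[of k] by (auto intro: less_le_trans)
  have subE: "Di k \<subseteq> insert bt (E (Di i))" if "i < k" for i k
    using that Di[of k] by auto
  define D where "D = (\<Inter>i\<in>Lm. Di i)"
  have D: "clubset D" unfolding D_def by (rule club_INT[OF small_seg cD])
  have low_mono: "lower (Di k) b \<le> lower (Di i) b" if "i \<le> k" for i k b
    using lower_ge[OF cD bD, of _ i b] lower_in[OF cD bD, of k b] lower_le[OF cD bD, of k b] sub[OF that] by auto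
  \<comment> \<open>\<open>lower (Di i) b\<close> does not increase with \<open>i\<close>, so it is
    constant from the index of its minimum on.\<close>
  have stab: "\<exists>i<lam. \<forall>k. i \<le> k \<and> k < lam \<longrightarrow> lower (Di k) b = lower (Di i) b" for b
  proof -
    let ?P = "\<lambda>v. \<exists>i<lam. v = lower (Di i) b"
    have "?P (LEAST v. ?P v)" by (rule LeastI_ex) (use lam_ne in auto)
    then obtain i where i: "i < lam" "(LEAST v. ?P v) = lower (Di i) b" by auto
    have "lower (Di i) b \<le> lower (Di k) b" if "k < lam" for k
      unfolding i(2)[symmetric] by (rule Least_le) (use that in auto)
    then have "\<forall>k. i \<le> k \<and> k < lam \<longrightarrow> lower (Di k) b = lower (Di i) b"
      by (intro allI impI order.antisym) (simp_all add: low_mono)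
    then show ?thesis using i(1) by auto
  qed
  \<comment> \<open>Otherwise points \<open>d k\<close> of \<open>D\<close> outside
    \<open>C a\<close> are cofinal in \<open>a\<close>. The least points \<open>b k\<close> of
    \<open>C a\<close> above them are successor points of \<open>C a\<close>, and their stable
    pulled-down values contradict the choice of the club \<open>E (Di i)\<close>.\<close>
  have claim: "\<exists>e<a. D \<inter> {e<..<a} \<subseteq> C a" if a: "limpt D a" "cofw a" for a
  proof (rule ccontr)
    assume "\<not> ?thesis"
    then have "\<forall>e<a. \<exists>d. e < d \<and> d < a \<and> (d \<in> D \<and> d \<notin> C a)" by auto
    from cofw_seq[OF a(2) this] obtain d :: "nat \<Rightarrow> 'a"
      where "(\<forall>i. d i < a \<and> (d i \<in> D \<and> d i \<notin> C a)) \<and> (\<forall>i j. i < j \<longrightarrow> d i < d j) \<and> (\<forall>x<a. \<exists>i. x < d i)" ..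
    then have d: "\<And>k. d k < a" "\<And>k. d k \<in> D \<and> d k \<notin> C a" "\<And>x. x < a \<Longrightarrow> \<exists>k. x < d k" by auto
    note ca = coh_seqD[OF C cofw_limpt[OF a(2)]]
    define b where "b k = (LEAST y. y \<in> C a \<and> d k \<le> y)" for k
    have bb: "b k \<in> C a \<and> d k \<le> b k" for k
      unfolding b_def by (rule LeastI_ex) (use limptD[OF ca(2) d(1)[of k]] in \<open>auto intro: less_imp_le\<close>)
    have bmin: "b k \<le> y" if "y \<in> C a" "d k \<le> y" for k y
      unfolding b_def by (rule Least_le) (use that in simp)
    have db: "d k < b k" for k using bb[of k] d(2)[of k] by (metis le_less)
    have bn: "\<not> limpt (C a) (b k)" for k
    proof
      assume "limpt (C a) (b k)"
      from limptD[OF this db] obtain y where y: "y \<in> C a" "d k < y" "y < b k" by auto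
      then show False using bmin[OF y(1) less_imp_le[OF y(2)]] by simp
    qed
    have "\<forall>k. \<exists>i. i < lam \<and> (\<forall>l. i \<le> l \<and> l < lam \<longrightarrow> lower (Di l) (b k) = lower (Di i) (b k))"
      by (rule allI) (rule stab)
    from choice[OF this] obtain ik where
      ik0: "\<forall>k. ik k < lam \<and> (\<forall>l. ik k \<le> l \<and> l < lam \<longrightarrow> lower (Di l) (b k) = lower (Di (ik k)) (b k))" ..
    note ik = ik0[THEN spec, THEN conjunct1] ik0[THEN spec, THEN conjunct2, rule_format, OF conjI]
    obtain i where i: "i < lam" "\<And>k. ik k < i" using lam_cof[of ik] ik(1) by auto
    \<comment> \<open>A second index is needed: the stable value is in \<open>Di i'\<close>, and
      only for \<open>i < i'\<close> does this put it into \<open>E (Di i)\<close>.\<close>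
    obtain i' where i': "i' < lam" "i < i'" using lam_no_max[OF i(1)] by auto
    define g where "g k = lower (Di i) (b k)" for k
    have g': "g k = lower (Di i') (b k)" for k
    proof -
      have "ik k \<le> i" "ik k \<le> i'" using i(2)[of k] i'(2) by auto
      then show ?thesis unfolding g_def using ik(2)[of k i] ik(2)[of k i'] i(1) i'(1) by simp
    qed
    have gE: "g k \<in> insert bt (E (Di i))" for k unfolding g' using lower_in[OF cD bD] subE[OF i'(2)] by auto
    have dg: "d k \<le> g k" for k unfolding g_def
      by (rule lower_ge[OF cD bD]) (use d(2) i(1) bb in \<open>auto simp: D_def\<close>)
    have gb: "g k \<le> b k" for k unfolding g_def by (rule lower_le[OF cD bD])
    have la: "limpt (Di i) a" by (rule limpt_mono[OF a(1)]) (use i(1) in \<open>auto simp: D_def\<close>)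
    then have pe: "pull C (Di i) a = lower (Di i) ` C a" unfolding pull_def by simp
    from E(2)[OF cD bD a(2), of i] obtain x where x: "x < a"
      "\<And>y. y \<in> lower (Di i) ` C a \<Longrightarrow> y \<in> E (Di i) \<Longrightarrow> x < y \<Longrightarrow> limpt (lower (Di i) ` C a) y" unfolding pe by auto
    obtain k where k: "x < d k" using d(3)[OF x(1)] by auto
    have xg: "x < g k" using k dg[of k] by simp
    moreover have "g k \<noteq> bt" using xg by (metis not_less_bt)
    then have "g k \<in> E (Di i)" using gE[of k] by simp
    moreover have "g k \<in> lower (Di i) ` C a" unfolding g_def using bb by simp
    ultimately have lg: "limpt (lower (Di i) ` C a) (g k)" using x(2) by simp
    have ga: "g k < a" using gb[of k] ca(1)[of "b k"] bb[of k] by auto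
    \<comment> \<open>A limit of pulled points belongs to \<open>C a\<close>, so minimality of
      \<open>b k\<close> forces \<open>g k = b k\<close>, which would then be a limit point of
      \<open>C a\<close>.\<close>
    note p = limpt_pull[OF C cD bD la lg ga]
    have "b k \<le> g k" by (rule bmin[OF p(3) dg])
    then have "g k = b k" using gb[of k] by simp
    then show False using p(2) bn[of k] by simp
  qed
  \<comment> \<open>With one bound \<open>e\<close> on a stationary set \<open>S\<close>, any
    \<open>a < a'\<close> in \<open>S\<close> satisfy \<open>limpt (C a') a\<close>. So the sets
    \<open>C a\<close> with \<open>a\<close> in \<open>S\<close> extend one another, and their union
    is a forbidden thread.\<close>
  define f where "f a = (SOME e. e < a \<and> D \<inter> {e<..<a} \<subseteq> C a)" for a
  have f: "f a < a \<and> D \<inter> {f a<..<a} \<subseteq> C a" if "limpt D a" "cofw a" for a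
    unfolding f_def by (rule someI_ex) (use claim[OF that] in auto)
  have "stat ({a. cofw a} \<inter> {a. limpt D a})" by (rule stat_Int_club[OF stat_cofw club_acc[OF D]])
  from fodor[OF this, of f] obtain e where "stat {a \<in> {a. cofw a} \<inter> {a. limpt D a}. f a = e}" using f by auto
  define S where "S = {a \<in> {a. cofw a} \<inter> {a. limpt D a}. f a = e}"
  have S: "stat S" unfolding S_def by fact
  have Sa: "limpt D a" "limpt UNIV a" "e < a" "D \<inter> {e<..<a} \<subseteq> C a" if "a \<in> S" for a
    using that f[of a] cofw_limpt[of a] unfolding S_def by auto
  have lim: "limpt (C a') a" if "a \<in> S" "a' \<in> S" "a < a'" for a a'
  proof (rule limptI[OF Sa(3)[OF that(1)]])
    fix x assume "x < a"
    then have "max e x < a" using Sa(3)[OF that(1)] by simp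
    from limptD[OF Sa(1)[OF that(1)] this] obtain y where y: "y \<in> D" "max e x < y" "y < a" by auto
    then have "y \<in> D \<inter> {e<..<a'}" using that(3) by auto
    then show "\<exists>y\<in>C a'. x < y \<and> y < a" using Sa(4)[OF that(2)] y by (intro bexI[of _ y]) auto
  qed
  have co: "C a = C a' \<inter> {..<a}" if "a \<in> S" "a' \<in> S" "a < a'" for a a'
    by (rule coh_seqD(4)[OF C Sa(2)[OF that(2)] that(3) lim[OF that]])
  define T where "T = (\<Union>a\<in>S. C a)"
  have T: "T \<inter> {..<a} = C a" if a: "a \<in> S" for a
  proof
    show "C a \<subseteq> T \<inter> {..<a}" using a coh_seqD(1)[OF C Sa(2)[OF a]] unfolding T_def by auto
    show "T \<inter> {..<a} \<subseteq> C a"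
    proof
      fix x assume "x \<in> T \<inter> {..<a}"
      then obtain a' where x: "a' \<in> S" "x \<in> C a'" "x < a" unfolding T_def by auto
      show "x \<in> C a"
      proof (cases a a' rule: linorder_cases)
        case less then show ?thesis using co[OF a x(1)] x by simp
      next
        case equal then show ?thesis using x by simp
      next
        case greater then show ?thesis using co[OF x(1) a] x by auto
      qed
    qed
  qed
  have Tlim: "b \<in> T \<and> T \<inter> {..<b} = C b" if "limpt T b" for b
  proof -
    obtain a where a: "a \<in> S" "b < a" using stat_gt[OF S] by auto
    have "limpt (C a) b" using that unfolding T[OF a(1), symmetric]
      by (subst limpt_cong[of b _ T]) (use a(2) in auto)
    note c = coh_seqD(3,4)[OF C Sa(2)[OF a(1)] a(2) this]
    have "T \<inter> {..<b} = (T \<inter> {..<a}) \<inter> {..<b}" using a(2) by auto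
    then show ?thesis using c T[OF a(1)] by auto
  qed
  have "clubset T" unfolding clubset_def unb_def
  proof (intro conjI allI impI)
    fix x
    obtain a where a: "a \<in> S" "x < a" using stat_gt[OF S] by auto
    from limptD[OF coh_seqD(2)[OF C Sa(2)[OF a(1)]] a(2)] show "\<exists>y\<in>T. x < y" unfolding T_def using a(1) by auto
  qed (use Tlim in auto)
  then show False using nothread[of T] Tlim by auto
qed

end

section \<open>Hitting all unbounded sets\<close>

text \<open>Running maxima are monotone: a bound that holds at almost all points of \<open>M\<close>
  passes to every large \<open>n\<close> through the next point of \<open>M\<close>. If the claim
  failed, \<open>h (nx n)\<close> would dominate all of \<open>F\<close>.\<close>

lemma unbounded_family_infinite_set:
  assumes F: "unbounded_family F" and M: "infinite M"
  shows "\<exists>f\<in>F. infinite {m\<in>M. h m < Max (f ` {..m})}"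
proof (rule ccontr)
  assume neg: "\<not> ?thesis"
  define nx where "nx n = (LEAST m. m \<in> M \<and> n \<le> m)" for n
  have nx: "nx n \<in> M \<and> n \<le> nx n" for n
    unfolding nx_def by (rule LeastI_ex) (metis M infinite_nat_iff_unbounded_le)
  have "dominated_by f (\<lambda>n. h (nx n))" if f: "f \<in> F" for f
  proof -
    have "finite {m\<in>M. h m < Max (f ` {..m})}" using neg f by blast
    then obtain N where N: "\<And>m. m \<in> M \<Longrightarrow> h m < Max (f ` {..m}) \<Longrightarrow> m < N"
      using finite_nat_set_iff_bounded by (metis (mono_tags, lifting) mem_Collect_eq)
    have "f n \<le> h (nx n)" if "N \<le> n" for n
    proof -
      have "\<not> nx n < N" using that nx[of n] by linarith
      then have "Max (f ` {..nx n}) \<le> h (nx n)" using N[of "nx n"] nx[of n] by (meson not_le)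
      moreover have "f n \<le> Max (f ` {..nx n})" using nx[of n] by (intro Max_ge) auto
      ultimately show ?thesis by linarith
    qed
    then show ?thesis unfolding dominated_by_def by blast
  qed
  then show False using F unfolding unbounded_family_def by blast
qed

context wellorder
begin

text \<open>Inserts J (C_a Int b) b into the interval below each b in C_a. Limit points of C_a stay untouched
because J has its values above C_a Int b.\<close>

definition fill :: "('a \<Rightarrow> 'a set) \<Rightarrow> ('a set \<Rightarrow> 'a \<Rightarrow> 'a set) \<Rightarrow> 'a \<Rightarrow> 'a set" where
  "fill C J a = C a \<union> (\<Union>b\<in>C a. J (C a \<inter> {..<b}) b)"

context
  fixes C :: "'a \<Rightarrow> 'a set" and J :: "'a set \<Rightarrow> 'a \<Rightarrow> 'a set"
  assumes C: "coh_seq C"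
    and fin: "\<And>c b. finite (J c b)"
    and J: "\<And>c b y. y \<in> J c b \<Longrightarrow> y < b" "\<And>c b y x. y \<in> J c b \<Longrightarrow> x \<in> c \<Longrightarrow> x < y"
begin

text \<open>If \<open>C a\<close> is bounded below \<open>g\<close>, all inserted points just below
  \<open>g\<close> belong to the least \<open>b\<close> in \<open>C a\<close> with
  \<open>g \<le> b\<close>. They are finite in number, too few to accumulate at
  \<open>g\<close>.\<close>

lemma limpt_fill:
  assumes a: "limpt UNIV a" and g: "g < a" "limpt (fill C J a) g"
  shows "limpt (C a) g"
proof (rule ccontr)
  note ca = coh_seqD[OF C a]
  assume "\<not> limpt (C a) g"
  moreover have "\<exists>x. x < g" using g(2) unfolding limpt_def by simp
  ultimately obtain d where d: "d < g" "\<And>y. y \<in> C a \<Longrightarrow> d < y \<Longrightarrow> g \<le> y" unfolding limpt_def by (metis not_less)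
  define b where "b = (LEAST y. y \<in> C a \<and> g \<le> y)"
  have b: "b \<in> C a \<and> g \<le> b" unfolding b_def
    by (rule LeastI_ex) (use limptD[OF ca(2) g(1)] in \<open>auto intro: less_imp_le\<close>)
  have bmin: "b \<le> y" if "y \<in> C a" "g \<le> y" for y
    unfolding b_def by (rule Least_le) (use that in simp)
  have "{y \<in> fill C J a. d < y \<and> y < g} \<subseteq> J (C a \<inter> {..<b}) b"
  proof
    fix y assume "y \<in> {y \<in> fill C J a. d < y \<and> y < g}"
    then have y: "y \<in> fill C J a" "d < y" "y < g" by auto
    have "y \<notin> C a" using d(2)[of y] y by auto
    then obtain b' where b': "b' \<in> C a" "y \<in> J (C a \<inter> {..<b'}) b'" using y(1) unfolding fill_def by auto
    have "y < b'" by (rule J(1)[OF b'(2)])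
    then have "g \<le> b'" using d(2)[OF b'(1)] y(2) less_trans by simp
    then have le: "b \<le> b'" by (rule bmin[OF b'(1)])
    have "\<not> b < b'"
    proof
      assume "b < b'"
      then have "b < y" using J(2)[OF b'(2), of b] b by simp
      then show False using y(3) b by auto
    qed
    then have "b' = b" using le by auto
    then show "y \<in> J (C a \<inter> {..<b}) b" using b'(2) by simp
  qed
  then show False using limpt_infinite[OF g(2) d(1)] fin finite_subset by blast
qed

text \<open>A limit point of the filled set belongs to \<open>C a\<close>, but an inserted point
  lies above all of \<open>C a \<inter> {..<b}\<close> and below \<open>b\<close>.\<close>

lemma fill_new:
  assumes a: "limpt UNIV a" and b: "b \<in> C a" "y \<in> J (C a \<inter> {..<b}) b"
  shows "y \<in> fill C J a" "\<not> limpt (fill C J a) y"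
proof -
  note ca = coh_seqD[OF C a]
  show "y \<in> fill C J a" unfolding fill_def using b by auto
  have yb: "y < b" by (rule J(1)[OF b(2)])
  have ya: "y < a" using yb ca(1)[OF b(1)] by auto
  show "\<not> limpt (fill C J a) y"
  proof
    assume "limpt (fill C J a) y"
    then have "y \<in> C a" using limpt_fill[OF a ya] ca(3)[OF ya] by simp
    then show False using J(2)[OF b(2), of y] yb by simp
  qed
qed

lemma coh_seq_fill: "coh_seq (fill C J)"
  unfolding coh_seq_def
proof (intro allI impI)
  fix a assume a: "limpt UNIV a"
  note ca = coh_seqD[OF C a]
  have "fill C J a \<subseteq> {..<a}"
    unfolding fill_def using ca(1) by (auto intro: less_trans[OF J(1) ca(1)])
  moreover have "limpt (fill C J a) a" by (rule limpt_mono[OF ca(2)]) (auto simp: fill_def)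
  moreover have "g \<in> fill C J a \<and> fill C J g = fill C J a \<inter> {..<g}" if g: "g < a" "limpt (fill C J a) g" for g
  proof
    have l: "limpt (C a) g" by (rule limpt_fill[OF a g])
    have gC: "g \<in> C a" by (rule ca(3)[OF g(1) l])
    then show "g \<in> fill C J a" unfolding fill_def by simp
    have e: "C g = C a \<inter> {..<g}" by (rule ca(4)[OF g(1) l])
    have seg: "C g \<inter> {..<b} = C a \<inter> {..<b}" if "b < g" for b unfolding e using that by auto
    show "fill C J g = fill C J a \<inter> {..<g}"
    proof
      show "fill C J g \<subseteq> fill C J a \<inter> {..<g}"
      proof
        fix y assume "y \<in> fill C J g"
        then consider "y \<in> C g" | b where "b \<in> C g" "y \<in> J (C g \<inter> {..<b}) b" unfolding fill_def by auto
        then show "y \<in> fill C J a \<inter> {..<g}"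
        proof cases
          case 1 then show ?thesis unfolding e fill_def by auto
        next
          case 2
          then have "b < g" "b \<in> C a" unfolding e by auto
          then have "y < g" "y \<in> fill C J a" using 2 seg[of b] J(1)[OF 2(2)] unfolding fill_def by auto
          then show ?thesis by simp
        qed
      qed
      show "fill C J a \<inter> {..<g} \<subseteq> fill C J g"
      proof
        fix y assume y: "y \<in> fill C J a \<inter> {..<g}"
        then consider "y \<in> C a" | b where "b \<in> C a" "y \<in> J (C a \<inter> {..<b}) b" unfolding fill_def by auto
        then show "y \<in> fill C J g"
        proof cases
          case 1 then show ?thesis using y unfolding fill_def e by auto
        next
          case 2
          \<comment> \<open>Points inserted for some \<open>b \<ge> g\<close> lie above
            \<open>C a \<inter> {..<g}\<close>, which is cofinal in \<open>g\<close>; none of them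
            is below \<open>g\<close>.\<close>
          have "b < g"
          proof (rule ccontr)
            assume "\<not> b < g"
            then have "g \<le> b" by simp
            obtain x where x: "x \<in> C a" "y < x" "x < g" using limptD[OF l, of y] y by auto
            then have "x \<in> C a \<inter> {..<b}" using \<open>g \<le> b\<close> by auto
            then show False using J(2)[OF 2(2)] x(2) by (meson less_asym)
          qed
          then have "b \<in> C g" using 2 unfolding e by simp
          moreover have "y \<in> J (C g \<inter> {..<b}) b" using 2(2) unfolding seg[OF \<open>b < g\<close>] .
          ultimately show ?thesis unfolding fill_def by auto
        qed
      qed
    qed
  qed
  ultimately show "fill C J a \<subseteq> {..<a} \<and> limpt (fill C J a) a \<and>
     (\<forall>b<a. limpt (fill C J a) b \<longrightarrow> b \<in> fill C J a \<and> fill C J b = fill C J a \<inter> {..<b})" by simp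
qed

end

end

context succ_cardinal
begin

lemma small_Collect_inj: 
  assumes "inj_on f A" "f ` A \<subseteq> {..<p}" "p < lam" shows "|A| <o |Lm|"
  using assms lam_initial ordLeq_ordLess_trans by (meson card_of_ordLeq)

text \<open>Countably many of the functions G b are pairwise different at some common argument below lam, which is how
omega many points of C_a get distinct natural numbers although there are only lam many parameters.\<close>

lemma eventually_different:
  "\<exists>G :: 'a \<Rightarrow> 'a \<Rightarrow> 'a. (\<forall>b. \<forall>p<lam. G b p < lam) \<and>
     (\<forall>b b'. b' < b \<longrightarrow> (\<exists>p0<lam. \<forall>p. p0 \<le> p \<and> p < lam \<longrightarrow> G b p \<noteq> G b' p))"
proof -
  obtain j :: "'a \<Rightarrow> 'a \<Rightarrow> 'a" where j: "\<And>a. inj_on (j a) {..<a}" "\<And>a. j a ` {..<a} \<subseteq> Lm" using seg_inj by blast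
  \<comment> \<open>At the argument \<open>p\<close> fewer than lam values are forbidden, as
    \<open>j b\<close> maps the relevant \<open>b'\<close> injectively below \<open>p\<close>. For
    \<open>p\<close> beyond \<open>j b b'\<close> the values at \<open>b\<close> and
    \<open>b'\<close> differ.\<close>
  define G where "G = wfrec {(x, y). x < y} (\<lambda>P b p. SOME v. v < lam \<and> v \<notin> (\<lambda>b'. P b' p) ` {b'. b' < b \<and> j b b' < p})"
  have cc: "(\<lambda>b'. cut G {(x, y). x < y} b b' p) ` {b'. b' < b \<and> j b b' < p} = (\<lambda>b'. G b' p) ` {b'. b' < b \<and> j b b' < p}" for b p
    by (rule image_cong) (simp_all add: cut_apply)
  have G: "G b p = (SOME v. v < lam \<and> v \<notin> (\<lambda>b'. G b' p) ` {b'. b' < b \<and> j b b' < p})" for b p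
    unfolding cc[symmetric] unfolding G_def by (subst wfrec[OF wf_less]) simp
  have ex: "\<exists>v. v < lam \<and> v \<notin> (\<lambda>b'. G b' p) ` {b'. b' < b \<and> j b b' < p}" if "p < lam" for b p
  proof (rule ccontr)
    let ?Q = "{b'. b' < b \<and> j b b' < p}"
    assume "\<not> ?thesis"
    then have "Lm \<subseteq> (\<lambda>b'. G b' p) ` ?Q" by auto
    then have "|Lm| \<le>o |(\<lambda>b'. G b' p) ` ?Q|" by (rule card_of_mono1)
    then have le: "|Lm| \<le>o |?Q|" using card_of_image ordLeq_transitive by blast
    have "inj_on (j b) ?Q" by (rule inj_on_subset[OF j(1)[of b]]) auto
    moreover have "j b ` ?Q \<subseteq> {..<p}" by auto
    ultimately have "|?Q| <o |Lm|" by (rule small_Collect_inj[OF _ _ that])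
    then show False using le not_ordLess_ordLeq by blast
  qed
  have Gp: "G b p < lam \<and> G b p \<notin> (\<lambda>b'. G b' p) ` {b'. b' < b \<and> j b b' < p}" if "p < lam" for b p
    by (subst (1 2) G) (rule someI_ex[OF ex[OF that]])
  have "\<exists>p0<lam. \<forall>p. p0 \<le> p \<and> p < lam \<longrightarrow> G b p \<noteq> G b' p" if "b' < b" for b b'
  proof -
    have "j b b' < lam" using j(2)[of b] that by auto
    then obtain p0 where p0: "p0 < lam" "j b b' < p0" using lam_no_max by auto
    have "G b p \<noteq> G b' p" if p: "p0 \<le> p" "p < lam" for p
    proof -
      have "b' \<in> {b'. b' < b \<and> j b b' < p}" using \<open>b' < b\<close> p0(2) p(1) by auto
      then have "G b' p \<in> (\<lambda>b'. G b' p) ` {b'. b' < b \<and> j b b' < p}" by (rule imageI)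
      then show ?thesis using Gp[OF p(2), of b] by metis
    qed
    then show ?thesis using p0 by auto
  qed
  then show ?thesis using Gp by (intro exI[of _ G]) simp
qed

lemma hitting:
  fixes F :: "(nat \<Rightarrow> nat) set"
  assumes C: "coh_seq C"
    and ch: "\<And>E. clubset E \<Longrightarrow> \<exists>a. cofw a \<and> (\<forall>x<a. \<exists>b\<in>C a \<inter> E. x < b \<and> \<not> limpt (C a) b)"
    and F: "unbounded_family F" "small Lm F"
  shows "\<exists>C'. coh_seq C' \<and> (\<forall>A D. unb A \<longrightarrow> clubset D \<longrightarrow>
      (\<exists>a\<in>D. cofw a \<and> (\<forall>x<a. \<exists>b\<in>C' a \<inter> A. x < b \<and> \<not> limpt (C' a) b)))"
proof (rule ccontr)
  assume neg: "\<not> ?thesis"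
  obtain X :: "'a set set" where X: "small Lm X" "\<And>x. x \<in> X \<Longrightarrow> countable x"
    "\<And>c. c \<subseteq> Lm \<Longrightarrow> countable c \<Longrightarrow> \<exists>x\<in>X. c \<subseteq> x" using cover_lam by auto
  obtain j :: "'a \<Rightarrow> 'a \<Rightarrow> 'a" where j: "\<And>a. inj_on (j a) {..<a}" "\<And>a. j a ` {..<a} \<subseteq> Lm" using seg_inj by blast
  obtain G :: "'a \<Rightarrow> 'a \<Rightarrow> 'a" where G: "\<And>b p. p < lam \<Longrightarrow> G b p < lam"
    "\<And>b b'. b' < b \<Longrightarrow> \<exists>p0<lam. \<forall>p. p0 \<le> p \<and> p < lam \<longrightarrow> G b p \<noteq> G b' p"
    using eventually_different by auto
  \<comment> \<open>A parameter consists of an argument \<open>p\<close> for the functions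
    \<open>G b\<close>, two countable sets that number elements of lam, and a function that bounds
    the search.\<close>
  define Q where "Q = Lm \<times> X \<times> X \<times> F"
  have Q: "small Lm Q" unfolding Q_def by (intro small_Times small_seg X(1) F(2))
  have "|Q \<times> (UNIV :: 'a set)| \<le>o |UNIV :: 'a set|"
    by (rule UNIV_Times[OF ordLeq_transitive[OF Q UNIV_le_UNIV] UNIV_le_UNIV])
  from enum_small[OF this] obtain w :: "'a \<Rightarrow> (('a \<times> 'a set \<times> 'a set \<times> (nat \<Rightarrow> nat)) \<times> 'a) set"
    where w: "\<forall>W\<subseteq>Q \<times> UNIV. small Lm W \<longrightarrow> (\<exists>i. w i = W)" ..
  define gd where "gd q i c b z \<longleftrightarrow> (q, z) \<in> w i \<and> (\<forall>x\<in>c. x < z) \<and> z < b" for q i c b z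
  \<comment> \<open>The number attached to \<open>b\<close> is that of \<open>G b p\<close> in
    \<open>Y\<close>. The search covers the indices whose number in \<open>Y'\<close> is at most the
    running maximum of \<open>f\<close> there, so it is finite and depends on \<open>q\<close> and
    \<open>b\<close> alone.\<close>
  define I where "I q b = (case q of (p, Y, Y', f) \<Rightarrow>
     {i. i < b \<and> j b i \<in> Y' \<and> to_nat_on Y' (j b i) \<le> Max (f ` {..to_nat_on Y (G b p)})})" for q b
  define J where "J q c b = {LEAST z. gd q i c b z | i. q \<in> Q \<and> i \<in> I q b \<and> (\<exists>z. gd q i c b z)}" for q c b
  have J_gd: "\<exists>i\<in>I q b. gd q i c b y" if "y \<in> J q c b" for q c b y
    using that LeastI_ex[of "gd q _ c b"] unfolding J_def by auto
  have J1: "y < b" if "y \<in> J q c b" for q c b y using J_gd[OF that] unfolding gd_def by auto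
  have J2: "x < y" if "y \<in> J q c b" "x \<in> c" for q c b y x using J_gd[OF that(1)] that(2) unfolding gd_def by auto
  have finI: "finite (I q b)" if "q \<in> Q" for q b
  proof -
    obtain p Y Y' f where q: "q = (p, Y, Y', f)" by (cases q) auto
    then have "countable Y'" using that X(2) unfolding Q_def by auto
    let ?h = "\<lambda>i. to_nat_on Y' (j b i)"
    have "inj_on ?h (I q b)"
    proof (rule inj_onI)
      fix i i' assume a: "i \<in> I q b" "i' \<in> I q b" "?h i = ?h i'"
      then have "j b i = j b i'" using inj_onD[OF inj_on_to_nat_on[OF \<open>countable Y'\<close>] a(3)] unfolding q I_def by auto
      then show "i = i'" using inj_onD[OF j(1)[of b]] a unfolding q I_def by auto
    qed
    moreover have "?h ` I q b \<subseteq> {..Max (f ` {..to_nat_on Y (G b p)})}" unfolding q I_def by auto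
    ultimately show ?thesis using finite_imageD finite_subset by (metis finite_atMost)
  qed
  have finJ: "finite (J q c b)" for q c b
  proof (cases "q \<in> Q")
    case True
    have "J q c b \<subseteq> (\<lambda>i. LEAST z. gd q i c b z) ` I q b" unfolding J_def by auto
    then show ?thesis using finI[OF True] finite_subset by (metis finite_imageI)
  qed (simp add: J_def)
  have coh: "coh_seq (fill C (J q))" for q
    by (rule coh_seq_fill[OF C]) (rule finJ, rule J1, assumption, rule J2)
  have new: "y \<in> fill C (J q) a \<and> \<not> limpt (fill C (J q) a) y" if "limpt UNIV a" "b \<in> C a" "y \<in> J q (C a \<inter> {..<b}) b" for q a b y
    using fill_new[where J = "J q", OF C finJ J1 J2 that] by simp
  have "\<forall>q. \<exists>P. unb (fst P) \<and> clubset (snd P) \<and> \<not> (\<exists>a\<in>snd P. cofw a \<and> (\<forall>x<a. \<exists>b\<in>fill C (J q) a \<inter> fst P. x < b \<and> \<not> limpt (fill C (J q) a) b))"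
    using neg coh by simp
  from choice[OF this] obtain P where P0: "\<forall>q. unb (fst (P q)) \<and> clubset (snd (P q)) \<and> \<not> (\<exists>a\<in>snd (P q). cofw a \<and> (\<forall>x<a. \<exists>b\<in>fill C (J q) a \<inter> fst (P q). x < b \<and> \<not> limpt (fill C (J q) a) b))" ..
  have P: "unb (fst (P q))" "clubset (snd (P q))"
    "\<And>a. a \<in> snd (P q) \<Longrightarrow> cofw a \<Longrightarrow> \<exists>x<a. \<forall>b\<in>fill C (J q) a \<inter> fst (P q). x < b \<longrightarrow> limpt (fill C (J q) a) b" for q using P0[THEN spec, of q] by auto
  \<comment> \<open>One code covers the counterexamples of all parameters. This matters because the
    parameter is fixed only after the indices of these codes along \<open>C a\<close> are
    known.\<close>
  define W where "W b = {(q, z). q \<in> Q \<and> z \<in> fst (P q) \<and> z < b}" for b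
  have "\<exists>i. w i = W b" for b
  proof -
    have "small Lm (W b)"
      by (rule small_subset[OF small_Times[OF Q small_seg[of b]]]) (auto simp: W_def)
    moreover have "W b \<subseteq> Q \<times> UNIV" unfolding W_def by auto
    ultimately show ?thesis using w by simp
  qed
  then have "\<forall>b. \<exists>i. w i = W b" by simp
  from choice[OF this] obtain io where io: "\<And>b. w (io b) = W b" by auto
  have "\<forall>q. \<exists>nq. \<forall>x. nq x \<in> fst (P q) \<and> x < nq x"
  proof
    fix q
    have "\<forall>x. \<exists>z. z \<in> fst (P q) \<and> x < z" using P(1)[of q] unfolding unb_def by auto
    then show "\<exists>nq. \<forall>x. nq x \<in> fst (P q) \<and> x < nq x" by (rule choice)
  qed
  from choice[OF this] obtain nx where nx0: "\<forall>q. \<forall>x. nx q x \<in> fst (P q) \<and> x < nx q x" ..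
  note nx = nx0[THEN spec, THEN spec]
  have "\<exists>h. \<forall>x. \<forall>y\<in>(\<lambda>q. nx q x) ` Q. y < h x"
    by (rule bnd_fun) (rule small_image[OF Q])
  then obtain h where h0: "\<forall>x. \<forall>y\<in>(\<lambda>q. nx q x) ` Q. y < h x" ..
  have h: "nx q x < h x" if "q \<in> Q" for q x using h0[THEN spec, THEN bspec, OF imageI[OF that]] .
  \<comment> \<open>Closure of \<open>b\<close> under \<open>k\<close> puts below \<open>b\<close>,
    for each \<open>x < b\<close>, a next element of every counterexample above \<open>x\<close> and
    the index of an initial segment that contains it.\<close>
  define k where "k x = max (h x) (io (h x))" for x
  define DD where "DD = (\<Inter>q\<in>Q. snd (P q)) \<inter> {b. limpt UNIV b \<and> (\<forall>x<b. k x < b)}"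
  have DD: "x \<in> snd (P q)" if "x \<in> DD" "q \<in> Q" for x q using that unfolding DD_def by simp
  have DD': "limpt UNIV x" "\<And>y. y < x \<Longrightarrow> k y < x" if "x \<in> DD" for x using that unfolding DD_def by simp_all
  have D: "clubset DD" unfolding DD_def by (intro club_Int club_INT club_closure Q P(2))
  from ch[OF D] obtain a where a0: "cofw a \<and> (\<forall>x<a. \<exists>b\<in>C a \<inter> DD. x < b \<and> \<not> limpt (C a) b)" ..
  have a: "cofw a" "\<And>x. x < a \<Longrightarrow> \<exists>b. x < b \<and> b \<in> C a \<and> b \<in> DD \<and> \<not> limpt (C a) b"
    using a0 by (simp, metis IntD1 IntD2)
  note ca = coh_seqD[OF C cofw_limpt[OF a(1)]]
  have aa: "a \<in> DD"
  proof (rule clubD_lim[OF D])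
    obtain x0 where "x0 < a" using cofw_limpt[OF a(1)] unfolding limpt_def by auto
    then show "limpt DD a" by (rule limptI) (use a(2) ca(1) in auto)
  qed
  have "\<forall>x<a. \<exists>b. x < b \<and> b < a \<and> (b \<in> C a \<and> b \<in> DD \<and> \<not> limpt (C a) b)" using a(2) ca(1) by metis
  from cofw_seq[OF a(1) this] obtain b :: "nat \<Rightarrow> 'a" where
    "(\<forall>i. b i < a \<and> b i \<in> C a \<and> b i \<in> DD \<and> \<not> limpt (C a) (b i)) \<and> (\<forall>i j. i < j \<longrightarrow> b i < b j) \<and> (\<forall>x<a. \<exists>i. x < b i)" ..
  then have b: "b i < a" "b i \<in> C a" "b i \<in> DD" "\<not> limpt (C a) (b i)" "\<And>i j. i < j \<Longrightarrow> b i < b j" "\<And>x. x < a \<Longrightarrow> \<exists>i. x < b i" for i by auto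
  have "\<exists>d. d < b i \<and> (\<forall>y\<in>C a. y < b i \<longrightarrow> y \<le> d)" for i
  proof -
    have "\<exists>x. x < b i" using DD'(1)[OF b(3), of i] unfolding limpt_def by auto
    then show ?thesis using b(4)[of i] unfolding limpt_def by (metis not_less)
  qed
  then have "\<forall>i. \<exists>d. d < b i \<and> (\<forall>y\<in>C a. y < b i \<longrightarrow> y \<le> d)" by simp
  from choice[OF this] obtain d where d: "\<And>i. d i < b i" "\<And>i y. y \<in> C a \<Longrightarrow> y < b i \<Longrightarrow> y \<le> d i" by auto
  \<comment> \<open>\<open>d i\<close> bounds the part of \<open>C a\<close> below the successor
    point \<open>b i\<close>, and \<open>s i\<close> is the correct index for an initial segment
    reaching into this gap.\<close>
  define s where "s i = io (h (d i))" for i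
  have kb: "h (d i) < b i \<and> s i < b i" for i using DD'(2)[OF b(3) d(1), of i] unfolding k_def s_def by auto
  have ex_gd: "gd q (s i) (C a \<inter> {..<b i}) (b i) (nx q (d i))" if "q \<in> Q" for q i
    unfolding gd_def s_def io W_def using that nx[of q "d i"] h[OF that, of "d i"] kb[of i] d(2)[of _ i]
    by (auto intro: less_trans le_less_trans)
  have jl: "j (b i) (s i) < lam" for i using j(2)[of "b i"] kb[of i] by auto
  have "range (\<lambda>i. j (b i) (s i)) \<subseteq> Lm" using jl by (simp add: image_subset_iff)
  from X(3)[OF this] obtain Y' where "Y' \<in> X" "range (\<lambda>i. j (b i) (s i)) \<subseteq> Y'" by auto
  then have Y': "Y' \<in> X" "\<And>i. j (b i) (s i) \<in> Y'" by (simp_all add: image_subset_iff)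
  have "\<exists>p0<lam. \<forall>p. p0 \<le> p \<and> p < lam \<longrightarrow> G (b i) p \<noteq> G (b i') p" if "i < i'" for i i'
    using G(2)[OF b(5)[OF that]] by metis
  \<comment> \<open>\<open>prod_decode\<close> lists all pairs, so the thresholds beyond which the
    functions differ form one sequence, bounded below lam by uncountable cofinality.\<close>
  then have "\<forall>n. \<exists>p0. p0 < lam \<and> (fst (prod_decode n) < snd (prod_decode n) \<longrightarrow>
      (\<forall>p. p0 \<le> p \<and> p < lam \<longrightarrow> G (b (fst (prod_decode n))) p \<noteq> G (b (snd (prod_decode n))) p))"
    using lam_ne by metis
  from choice[OF this] obtain p0 where p0: "\<And>n. p0 n < lam" "\<And>n p. fst (prod_decode n) < snd (prod_decode n) \<Longrightarrow> p0 n \<le> p \<Longrightarrow> p < lam \<Longrightarrow>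
      G (b (fst (prod_decode n))) p \<noteq> G (b (snd (prod_decode n))) p" by auto
  obtain p where p: "p < lam" "\<And>n. p0 n < p" using lam_cof[of p0] p0(1) by auto
  have Gne: "G (b i) p \<noteq> G (b i') p" if "i < i'" for i i'
    using p0(2)[of "prod_encode (i, i')" p] p(2)[of "prod_encode (i, i')"] p(1) that by simp
  have Ginj: "G (b i) p = G (b i') p \<Longrightarrow> i = i'" for i i'
    using Gne[of i i'] Gne[of i' i] nat_neq_iff[of i i'] by auto
  have "range (\<lambda>i. G (b i) p) \<subseteq> Lm" using G(1)[OF p(1)] by (simp add: image_subset_iff)
  from X(3)[OF this] obtain Y where "Y \<in> X" "range (\<lambda>i. G (b i) p) \<subseteq> Y" by auto
  then have Y: "Y \<in> X" "\<And>i. G (b i) p \<in> Y" by (simp_all add: image_subset_iff)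
  define m where "m i = to_nat_on Y (G (b i) p)" for i
  have minj: "inj m"
    using Ginj inj_onD[OF inj_on_to_nat_on[OF X(2)[OF Y(1)]]] Y(2) unfolding m_def inj_def by metis
  \<comment> \<open>At the number attached to \<open>b i\<close>, \<open>hh\<close> says how far a
    search has to go to reach the right index.\<close>
  define hh where "hh n = to_nat_on Y' (j (b (inv m n)) (s (inv m n)))" for n
  have "infinite (range m)" using minj finite_imageD by blast
  from unbounded_family_infinite_set[OF F(1) this, of hh]
  obtain f where f: "f \<in> F" "infinite {n \<in> range m. hh n < Max (f ` {..n})}" by auto
  define q where "q = (p, Y, Y', f)"
  have qQ: "q \<in> Q" unfolding q_def Q_def using p Y Y' f by simp
  from P(3)[OF DD[OF aa qQ] a(1)] obtain x where x: "x < a" "\<And>y. y \<in> fill C (J q) a \<Longrightarrow> y \<in> fst (P q) \<Longrightarrow> x < y \<Longrightarrow> limpt (fill C (J q) a) y" by auto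
  obtain c where c: "c \<in> C a" "x < c" "c < a" using limptD[OF ca(2) x(1)] by auto
  obtain i0 where i0: "c < b i0" using b(6)[OF c(3)] by auto
  have "finite (m ` {..i0})" by simp
  \<comment> \<open>Some success occurs beyond \<open>i0\<close>, so the point inserted there is
    above \<open>c\<close> and hence above \<open>x\<close>.\<close>
  then have "\<not> {n \<in> range m. hh n < Max (f ` {..n})} \<subseteq> m ` {..i0}" using f(2) finite_subset by metis
  then obtain i where i: "hh (m i) < Max (f ` {..m i})" "\<not> i \<le> i0" by auto
  have cb: "c < b i" using i0 b(5)[of i0 i] i(2) by (auto intro: less_trans)
  have "hh (m i) = to_nat_on Y' (j (b i) (s i))" unfolding hh_def using minj by simp
  then have "s i \<in> I q (b i)" unfolding I_def q_def using kb[of i] Y'(2)[of i] i(1) by (simp add: m_def)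
  then have yJ: "(LEAST z. gd q (s i) (C a \<inter> {..<b i}) (b i) z) \<in> J q (C a \<inter> {..<b i}) (b i)"
    unfolding J_def using qQ ex_gd[OF qQ, of i] by auto
  define y where "y = (LEAST z. gd q (s i) (C a \<inter> {..<b i}) (b i) z)"
  have gy: "gd q (s i) (C a \<inter> {..<b i}) (b i) y" unfolding y_def by (rule LeastI[where P = "gd q (s i) (C a \<inter> {..<b i}) (b i)"]) (rule ex_gd[OF qQ])
  then have "y \<in> fst (P q)" unfolding gd_def s_def io W_def by simp
  moreover have "c < y" using gy c(1) cb unfolding gd_def by simp
  ultimately show False
    using x(2)[of y] new[OF cofw_limpt[OF a(1)] b(2)[of i] yJ] c(2) unfolding y_def[symmetric] by (auto dest: less_trans)
qed

end

section \<open>Souslin trees given by their levels\<close>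

text \<open>The trees are made of partial functions, while the first claim of the theorem wants
  nodes of the type of the ordinals; an injective coding carries the tree over.\<close>

lemma souslin_tree_rename:
  assumes S: "souslin_tree r A lt" and g: "inj_on g A"
  shows "souslin_tree r (g ` A) (\<lambda>x y. lt (inv_into A g x) (inv_into A g y))"
proof -
  define h where "h = inv_into A g"
  let ?A = "g ` A" and ?lt = "\<lambda>x y. lt (h x) (h y)"
  have hg: "h (g x) = x" if "x \<in> A" for x unfolding h_def using g that by (rule inv_into_f_f)
  have gh: "g (h y) = y" "h y \<in> A" if "y \<in> ?A" for y
    using that hg by auto
  have hinj: "inj_on h ?A" using gh(1) by (rule inj_on_inverseI)
  have K: "kappa_tree r A lt" and ch: "\<And>B. is_chain A lt B \<Longrightarrow> |B| <o |Field r|"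
    and an: "\<And>B. is_antichain A lt B \<Longrightarrow> |B| <o |Field r|"
    using S unfolding souslin_tree_def by auto
  have T: "is_tree A lt" and nh: "\<And>x. x \<in> A \<Longrightarrow> \<exists>a. node_height r A lt x a"
    and lne: "\<And>a. tree_level r A lt a \<noteq> {}" and lsm: "\<And>a. |tree_level r A lt a| <o |Field r|"
    using K unfolding kappa_tree_def by auto
  have nh_iff: "node_height r ?A ?lt y a \<longleftrightarrow> node_height r A lt (h y) a" if y: "y \<in> ?A" for y a
  proof
    have e: "{z \<in> ?A. ?lt z y} = g ` {z \<in> A. lt z (h y)}" using hg by auto
    have e': "{z \<in> A. lt z (h y)} = h ` {z \<in> ?A. ?lt z y}" unfolding e image_image using hg by auto
    {
      assume "node_height r ?A ?lt y a"
      from this[unfolded node_height_def] obtain f where f0: "bij_betw f {z \<in> ?A. ?lt z y} (underS r a) \<and>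
        (\<forall>u\<in>{z \<in> ?A. ?lt z y}. \<forall>v\<in>{z \<in> ?A. ?lt z y}. ?lt u v \<longleftrightarrow> olt r (f u) (f v))" ..
      note f = f0[THEN conjunct1] f0[THEN conjunct2, THEN bspec, THEN bspec]
      have "bij_betw g {z \<in> A. lt z (h y)} {z \<in> ?A. ?lt z y}" unfolding e
        by (rule inj_on_imp_bij_betw[OF inj_on_subset[OF g]]) auto
      from bij_betw_trans[OF this f(1)] have "bij_betw (f \<circ> g) {z \<in> A. lt z (h y)} (underS r a)" .
      moreover have "lt u v \<longleftrightarrow> olt r ((f \<circ> g) u) ((f \<circ> g) v)" if "u \<in> {z \<in> A. lt z (h y)}" "v \<in> {z \<in> A. lt z (h y)}" for u v
        using f(2)[of "g u" "g v"] that hg by auto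
      ultimately show "node_height r A lt (h y) a" unfolding node_height_def by blast
    next
      assume "node_height r A lt (h y) a"
      from this[unfolded node_height_def] obtain f where f0: "bij_betw f {z \<in> A. lt z (h y)} (underS r a) \<and>
        (\<forall>u\<in>{z \<in> A. lt z (h y)}. \<forall>v\<in>{z \<in> A. lt z (h y)}. lt u v \<longleftrightarrow> olt r (f u) (f v))" ..
      note f = f0[THEN conjunct1] f0[THEN conjunct2, THEN bspec, THEN bspec]
      have "bij_betw h {z \<in> ?A. ?lt z y} {z \<in> A. lt z (h y)}" unfolding e'
        by (rule inj_on_imp_bij_betw[OF inj_on_subset[OF hinj]]) auto
      from bij_betw_trans[OF this f(1)] have "bij_betw (f \<circ> h) {z \<in> ?A. ?lt z y} (underS r a)" .
      moreover have "?lt u v \<longleftrightarrow> olt r ((f \<circ> h) u) ((f \<circ> h) v)" if "u \<in> {z \<in> ?A. ?lt z y}" "v \<in> {z \<in> ?A. ?lt z y}" for u v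
        using f(2)[of "h u" "h v"] that gh by auto
      ultimately show "node_height r ?A ?lt y a" unfolding node_height_def by blast
    }
  qed
  have lev: "tree_level r ?A ?lt a = g ` tree_level r A lt a" for a
    unfolding tree_level_def using nh_iff hg by auto
  have "is_tree ?A ?lt"
    unfolding is_tree_def
  proof (intro conjI ballI)
    show "\<not> ?lt x x" if "x \<in> ?A" for x using T gh(2)[OF that] unfolding is_tree_def by blast
    show "?lt x y \<and> ?lt y z \<longrightarrow> ?lt x z" if "x \<in> ?A" "y \<in> ?A" "z \<in> ?A" for x y z
      using T gh(2)[OF that(1)] gh(2)[OF that(2)] gh(2)[OF that(3)] unfolding is_tree_def by blast
    show "?lt y x \<and> ?lt z x \<longrightarrow> ?lt y z \<or> y = z \<or> ?lt z y" if "x \<in> ?A" "y \<in> ?A" "z \<in> ?A" for x y z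
      using T gh(2)[OF that(1)] gh(2)[OF that(2)] gh(2)[OF that(3)] inj_onD[OF hinj _ that(2,3)] unfolding is_tree_def by blast
    fix x assume x: "x \<in> ?A"
    have "wf {(y, z). y \<in> A \<and> z \<in> A \<and> lt y (h x) \<and> lt z (h x) \<and> lt y z}" using T gh(2)[OF x] unfolding is_tree_def by blast
    then have "wf (inv_image {(y, z). y \<in> A \<and> z \<in> A \<and> lt y (h x) \<and> lt z (h x) \<and> lt y z} h)" by (rule wf_inv_image)
    then show "wf {(y, z). y \<in> ?A \<and> z \<in> ?A \<and> ?lt y x \<and> ?lt z x \<and> ?lt y z}"
      by (rule wf_subset) (use gh in \<open>auto simp: in_inv_image\<close>)
  qed
  moreover have "\<exists>a. node_height r ?A ?lt y a" if "y \<in> ?A" for y using nh_iff[OF that] nh[OF gh(2)[OF that]] by blast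
  moreover have "|g ` tree_level r A lt a| <o |Field r|" for a using card_of_image lsm ordLeq_ordLess_trans by blast
  ultimately have "kappa_tree r ?A ?lt" unfolding kappa_tree_def lev using lne by blast
  moreover have card: "|B| <o |Field r|" if "B \<subseteq> ?A" "|h ` B| <o |Field r|" for B
  proof -
    have "|B| \<le>o |h ` B|" using inj_on_subset[OF hinj that(1)] by (meson card_of_ordLeq order_refl)
    then show ?thesis using that(2) ordLeq_ordLess_trans by blast
  qed
  moreover have "|B| <o |Field r|" if B: "is_chain ?A ?lt B" for B
  proof (rule card)
    show BA: "B \<subseteq> ?A" using B unfolding is_chain_def by blast
    have "is_chain A lt (h ` B)" unfolding is_chain_def
    proof (intro conjI ballI)
      show "h ` B \<subseteq> A" using BA gh by blast
      fix u v assume "u \<in> h ` B" "v \<in> h ` B"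
      then show "lt u v \<or> u = v \<or> lt v u" using B unfolding is_chain_def by blast
    qed
    then show "|h ` B| <o |Field r|" by (rule ch)
  qed
  moreover have "|B| <o |Field r|" if B: "is_antichain ?A ?lt B" for B
  proof (rule card)
    show BA: "B \<subseteq> ?A" using B unfolding is_antichain_def by blast
    have "is_antichain A lt (h ` B)" unfolding is_antichain_def
    proof (intro conjI ballI impI)
      show "h ` B \<subseteq> A" using BA gh by blast
      fix u v assume "u \<in> h ` B" "v \<in> h ` B" "u \<noteq> v"
      then obtain y z where "y \<in> B" "z \<in> B" "y \<noteq> z" "u = h y" "v = h z" by auto
      then show "\<not> lt u v" "\<not> lt v u" using B unfolding is_antichain_def by simp_all
    qed
    then show "|h ` B| <o |Field r|" by (rule an)
  qed
  ultimately show ?thesis unfolding souslin_tree_def h_def by blast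
qed

context wellorder
begin

abbreviation ord_rel :: "'a rel" where "ord_rel \<equiv> {(x, y). x \<le> y}"

lemma underS_ord_rel: "underS ord_rel a = {..<a}"
  unfolding underS_def by (auto simp: less_le)

lemma olt_ord_rel: "olt ord_rel a b \<longleftrightarrow> a < b"
  unfolding olt_def by (auto simp: less_le)

lemma Field_ord_rel: "Field ord_rel = UNIV"
  unfolding Field_def by auto

lemma lessThan_inj: "{..<a} = {..<b} \<Longrightarrow> a = b"
  by (metis lessThan_iff less_irrefl linorder_cases)

lemma strict_mono_ge:
  assumes "\<And>x y. x < a \<Longrightarrow> y < a \<Longrightarrow> x < y \<Longrightarrow> f x < f y" "c < a"
  shows "c \<le> f c"
  using assms(2)
proof (induct c rule: less_induct)
  case (less c)
  show ?case
  proof (rule ccontr)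
    assume "\<not> c \<le> f c"
    then have l: "f c < c" by simp
    then have "f (f c) < f c" using assms(1) less(2) less_trans by blast
    moreover have "f c \<le> f (f c)" using less(1)[OF l] l less(2) by simp
    ultimately show False by simp
  qed
qed

text \<open>\<open>node_height\<close> is a relation; this rigidity makes the height of a node
  unique.\<close>

lemma segment_rigid:
  assumes f: "bij_betw f {..<a} {..<b}" "\<And>x y. x < a \<Longrightarrow> y < a \<Longrightarrow> f x < f y \<longleftrightarrow> x < y"
  shows "a = b"
proof (cases a b rule: linorder_cases)
  case less
  define g where "g = inv_into {..<a} f"
  have g: "g y < a" "f (g y) = y" if "y < b" for y
    unfolding g_def using bij_betw_inv_into_right[OF f(1), of y] bij_betwE[OF bij_betw_inv_into[OF f(1)]] that by auto
  have "a \<le> g a"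
    by (rule strict_mono_ge[of b]) (use g f(2) less in metis)+
  then show ?thesis using g(1)[OF less] by simp
next
  case greater
  have "b \<le> f b" by (rule strict_mono_ge[of a]) (use f(2) greater in auto)
  moreover have "f b < b" using bij_betwE[OF f(1)] greater by auto
  ultimately show ?thesis by simp
qed simp

end

context succ_cardinal
begin

text \<open>Sealing predense sets instead of maximal antichains avoids Zorn's lemma: an antichain together with all nodes
incomparable with it is predense.\<close>

lemma souslin_levels:
  fixes L :: "'a \<Rightarrow> ('a \<rightharpoonup> 'b) set"
  assumes dom: "\<And>a s. s \<in> L a \<Longrightarrow> dom s = {..<a}"
    and ne: "\<And>a. L a \<noteq> {}"
    and down: "\<And>a b s. s \<in> L a \<Longrightarrow> b < a \<Longrightarrow> s |` {..<b} \<in> L b"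
    and small: "\<And>a. small Lm (L a)"
    and split: "\<And>a s. s \<in> L a \<Longrightarrow> \<exists>b t t'. t \<in> L b \<and> t' \<in> L b \<and> t \<noteq> t' \<and> s \<subseteq>\<^sub>m t \<and> s \<subseteq>\<^sub>m t'"
    and seal: "\<And>P. P \<subseteq> (\<Union>a. L a) \<Longrightarrow> (\<forall>s\<in>\<Union>a. L a. \<exists>z\<in>P. s \<subseteq>\<^sub>m z \<or> z \<subseteq>\<^sub>m s) \<Longrightarrow>
        \<exists>a. \<forall>s\<in>L a. \<exists>b<a. \<exists>z\<in>P \<inter> L b. z \<subseteq>\<^sub>m s"
  shows "souslin_tree ord_rel (\<Union>a. L a) map_lt"
proof -
  define T where "T = (\<Union>a. L a)"
  define ht where "ht s = (THE a. dom s = {..<a})" for s :: "'a \<rightharpoonup> 'b"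
  have ht: "ht s = a" if "s \<in> L a" for s a
    unfolding ht_def by (rule the_equality[where a = a]) (use dom[OF that] lessThan_inj in auto)
  have htL: "s \<in> L (ht s)" if "s \<in> T" for s using that ht unfolding T_def by auto
  have LT: "s \<in> T" if "s \<in> L a" for s a using that unfolding T_def by auto
  have le_restr: "s = t |` {..<a}" if "s \<in> L a" "s \<subseteq>\<^sub>m t" for s t a
    using that dom[OF that(1)] unfolding map_le_def restrict_map_def
    by (intro ext) (metis domIff)
  have le_ht: "a \<le> b" if "s \<in> L a" "t \<in> L b" "s \<subseteq>\<^sub>m t" for s t a b
  proof -
    have "dom s \<subseteq> dom t" using that(3) by (rule map_le_implies_dom_le)
    then have "{..<a} \<subseteq> {..<b}" using dom that by metis
    then show ?thesis by (metis lessThan_iff less_irrefl not_le subsetD)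
  qed
  have restr_le: "t |` X \<subseteq>\<^sub>m t" for t :: "'a \<rightharpoonup> 'b" and X unfolding map_le_def by simp
  have same: "s = t" if "s \<in> L a" "t \<in> L a" "s \<subseteq>\<^sub>m t" for s t a
    using that by (intro map_le_antisym) (auto simp: map_le_def dom)
  have lt_iff: "map_lt s t \<longleftrightarrow> a < b \<and> s \<subseteq>\<^sub>m t" if "s \<in> L a" "t \<in> L b" for s t a b
    unfolding map_lt_def using le_ht[OF that] same[OF that(1)] that ht by (metis le_less less_irrefl)
  have comparable: "s \<subseteq>\<^sub>m t" if "s \<in> L a" "t \<in> L b" "a \<le> b" "s \<subseteq>\<^sub>m u" "t \<subseteq>\<^sub>m u" for s t u a b
  proof -
    have "dom s \<subseteq> dom t" using dom[OF that(1)] dom[OF that(2)] that(3) by auto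
    then show ?thesis using that(4,5) unfolding map_le_def by (metis subsetD)
  qed
  have pred: "{y \<in> T. map_lt y x} = (\<lambda>b. x |` {..<b}) ` {..<a}" if x: "x \<in> L a" for x a
  proof
    show "{y \<in> T. map_lt y x} \<subseteq> (\<lambda>b. x |` {..<b}) ` {..<a}"
    proof
      fix y assume "y \<in> {y \<in> T. map_lt y x}"
      then have "y \<in> T" "map_lt y x" by auto
      then have "ht y < a" "y \<subseteq>\<^sub>m x" using lt_iff[OF htL x, of y] by auto
      then show "y \<in> (\<lambda>b. x |` {..<b}) ` {..<a}" using le_restr[OF htL] \<open>y \<in> T\<close> by auto
    qed
    show "(\<lambda>b. x |` {..<b}) ` {..<a} \<subseteq> {y \<in> T. map_lt y x}"
      using lt_iff[OF down[OF x] x] LT[OF down[OF x]] restr_le by auto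
  qed
  have nh: "node_height ord_rel T map_lt x a" if x: "x \<in> L a" for x a
    unfolding node_height_def underS_ord_rel olt_ord_rel
  proof (intro exI[of _ ht] conjI ballI)
    have h: "ht (x |` {..<b}) = b" if "b < a" for b using ht[OF down[OF x that]] .
    show "bij_betw ht {y \<in> T. map_lt y x} {..<a}" unfolding pred[OF x] bij_betw_def
    proof
      show "inj_on ht ((\<lambda>b. x |` {..<b}) ` {..<a})" using h by (auto intro!: inj_onI)
      show "ht ` (\<lambda>b. x |` {..<b}) ` {..<a} = {..<a}" unfolding image_image using h by auto
    qed
    fix y z assume "y \<in> {y \<in> T. map_lt y x}" "z \<in> {y \<in> T. map_lt y x}"
    then have y: "y \<in> L (ht y)" "y \<subseteq>\<^sub>m x" and z: "z \<in> L (ht z)" "z \<subseteq>\<^sub>m x" using htL by (auto simp: map_lt_def)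
    show "map_lt y z = (ht y < ht z)" using lt_iff[OF y(1) z(1)] comparable[OF y(1) z(1) less_imp_le y(2) z(2)] by auto
  qed
  have nh_unique: "a = b" if x: "x \<in> L a" and n: "node_height ord_rel T map_lt x b" for x a b
  proof -
    from n[unfolded node_height_def underS_ord_rel olt_ord_rel] obtain f where
      f0: "bij_betw f {y \<in> T. map_lt y x} {..<b} \<and> (\<forall>y\<in>{y \<in> T. map_lt y x}. \<forall>z\<in>{y \<in> T. map_lt y x}. map_lt y z = (f y < f z))" ..
    note f = f0[THEN conjunct1] f0[THEN conjunct2, THEN bspec, THEN bspec]
    have h: "ht (x |` {..<c}) = c" if "c < a" for c using ht[OF down[OF x that]] .
    have "bij_betw (\<lambda>c. x |` {..<c}) {..<a} {y \<in> T. map_lt y x}" unfolding pred[OF x]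
      by (rule inj_on_imp_bij_betw) (use h in \<open>auto intro!: inj_onI dest: arg_cong[where f = ht]\<close>)
    from bij_betw_trans[OF this f(1)] have "bij_betw (\<lambda>c. f (x |` {..<c})) {..<a} {..<b}" by (simp add: comp_def)
    then show ?thesis
    proof (rule segment_rigid)
      fix c d assume c: "c < a" and d: "d < a"
      have "f (x |` {..<c}) < f (x |` {..<d}) \<longleftrightarrow> map_lt (x |` {..<c}) (x |` {..<d})"
        by (rule f(2)[symmetric]) (use c d in \<open>auto simp: pred[OF x]\<close>)
      also have "\<dots> \<longleftrightarrow> c < d"
        using lt_iff[OF down[OF x c] down[OF x d]] comparable[OF down[OF x c] down[OF x d] less_imp_le restr_le restr_le] by auto
      finally show "f (x |` {..<c}) < f (x |` {..<d}) \<longleftrightarrow> c < d" .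
    qed
  qed
  have level: "tree_level ord_rel T map_lt a = L a" for a
    unfolding tree_level_def using nh nh_unique htL LT by blast
  have small_less: "|B| <o |Field ord_rel|" if "small Lm B" for B :: "('a \<rightharpoonup> 'b) set"
    unfolding Field_ord_rel using that lam_less ordLeq_ordLess_trans by blast
  have bounded_small: "small Lm B" if "B \<subseteq> T" "\<And>s. s \<in> B \<Longrightarrow> ht s < a" for B a
  proof (rule small_subset)
    show "small Lm (\<Union>b\<in>{..<a}. L b)" by (rule small_UN[OF small_seg small])
    show "B \<subseteq> (\<Union>b\<in>{..<a}. L b)" using that htL by auto
  qed
  have "is_tree T map_lt" unfolding is_tree_def
  proof (intro conjI ballI)
    fix x assume "x \<in> T"
    show "\<not> map_lt x x" unfolding map_lt_def by simp
    show "wf {(y, z). y \<in> T \<and> z \<in> T \<and> map_lt y x \<and> map_lt z x \<and> map_lt y z}"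
      by (rule wf_subset[OF wf_inv_image[OF wf_less, of ht]]) (use lt_iff[OF htL htL] in \<open>auto simp: in_inv_image\<close>)
  next
    fix x y z assume T: "x \<in> T" "y \<in> T" "z \<in> T"
    show "map_lt x y \<and> map_lt y z \<longrightarrow> map_lt x z"
      unfolding map_lt_def using map_le_trans map_le_antisym by blast
    show "map_lt y x \<and> map_lt z x \<longrightarrow> map_lt y z \<or> y = z \<or> map_lt z y"
      unfolding map_lt_def using comparable[OF htL[OF T(2)] htL[OF T(3)]] comparable[OF htL[OF T(3)] htL[OF T(2)]] by (metis linear)
  qed
  then have kt: "kappa_tree ord_rel T map_lt"
    unfolding kappa_tree_def level using nh htL ne small_less[OF small] by blast
  have anti: "small Lm B" if B: "is_antichain T map_lt B" for B
  proof -
    have BT: "B \<subseteq> T" and Bin: "\<And>x y. x \<in> B \<Longrightarrow> y \<in> B \<Longrightarrow> x \<subseteq>\<^sub>m y \<Longrightarrow> x = y"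
      using B unfolding is_antichain_def map_lt_def by auto
    define P where "P = B \<union> {s \<in> T. \<forall>b\<in>B. \<not> s \<subseteq>\<^sub>m b \<and> \<not> b \<subseteq>\<^sub>m s}"
    have "\<exists>a. \<forall>s\<in>L a. \<exists>b<a. \<exists>z\<in>P \<inter> L b. z \<subseteq>\<^sub>m s"
    proof (rule seal)
      show "P \<subseteq> (\<Union>a. L a)" using BT unfolding P_def T_def by auto
      show "\<forall>s\<in>\<Union>a. L a. \<exists>z\<in>P. s \<subseteq>\<^sub>m z \<or> z \<subseteq>\<^sub>m s"
        unfolding T_def[symmetric] P_def using map_le_refl by blast
    qed
    then obtain a where a: "\<And>s. s \<in> L a \<Longrightarrow> \<exists>b<a. \<exists>z\<in>P \<inter> L b. z \<subseteq>\<^sub>m s" by auto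
    have "ht s < a" if s: "s \<in> B" for s
    proof (rule ccontr)
      assume "\<not> ht s < a"
      then have le: "a \<le> ht s" by simp
      have sL: "s \<in> L (ht s)" using htL BT s by auto
      have "\<exists>t\<in>L a. t \<subseteq>\<^sub>m s"
      proof (cases "a = ht s")
        case True then show ?thesis using sL map_le_refl by blast
      next
        case False
        then have "a < ht s" using le by simp
        then show ?thesis using down[OF sL] restr_le by blast
      qed
      then obtain t where t: "t \<in> L a" "t \<subseteq>\<^sub>m s" by auto
      obtain b z where z: "b < a" "z \<in> P" "z \<in> L b" "z \<subseteq>\<^sub>m t" using a[OF t(1)] by auto
      have zs: "z \<subseteq>\<^sub>m s" using z(4) t(2) by (rule map_le_trans)
      \<comment> \<open>\<open>z\<close> is comparable with the member \<open>s\<close> of the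
        antichain, which rules out the second part of \<open>P\<close>.\<close>
      have "z \<in> B" using z(2) zs s unfolding P_def by auto
      then have "z = s" using Bin[OF _ s zs] by simp
      then show False using ht[OF z(3)] z(1) le by simp
    qed
    then show ?thesis using bounded_small[OF BT] by blast
  qed
  have chain: "small Lm B" if B: "is_chain T map_lt B" for B
  proof -
    have BT: "B \<subseteq> T" and Bc: "\<And>x y. x \<in> B \<Longrightarrow> y \<in> B \<Longrightarrow> x \<subseteq>\<^sub>m y \<or> y \<subseteq>\<^sub>m x"
      using B unfolding is_chain_def map_lt_def by (auto, metis map_le_refl)
    define onb where "onb s \<longleftrightarrow> (\<exists>s'\<in>B. s \<subseteq>\<^sub>m s')" for s
    \<comment> \<open>These are the minimal nodes off the branch generated by \<open>B\<close>. They
      form an antichain, so their heights are bounded; since every node splits, some member of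
      \<open>A\<close> is higher than any given member of \<open>B\<close>.\<close>
    define A where "A = {t \<in> T. \<not> onb t \<and> (\<forall>c<ht t. onb (t |` {..<c}))}"
    have "is_antichain T map_lt A" unfolding is_antichain_def
    proof (intro conjI ballI impI)
      show "A \<subseteq> T" unfolding A_def by auto
      have *: "\<not> map_lt x y" if "x \<in> A" "y \<in> A" for x y
      proof
        assume "map_lt x y"
        then have "ht x < ht y" "x \<subseteq>\<^sub>m y" using lt_iff[OF htL htL] that unfolding A_def by auto
        moreover have "x \<in> T" using that unfolding A_def by auto
        ultimately have "onb x" using that(2) le_restr[OF htL] unfolding A_def by auto
        then show False using that(1) unfolding A_def by auto
      qed
      fix x y assume "x \<in> A" "y \<in> A"
      then show "\<not> map_lt x y" "\<not> map_lt y x" using * by auto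
    qed
    then have "small Lm (ht ` A)" using anti small_image by blast
    then obtain e where e: "\<And>t. t \<in> A \<Longrightarrow> ht t < e" using small_bdd[of "ht ` A"] by auto
    have "ht s < e" if s: "s \<in> B" for s
    proof -
      have sL: "s \<in> L (ht s)" using htL BT s by auto
      obtain b t t' where t: "t \<in> L b" "t' \<in> L b" "t \<noteq> t'" "s \<subseteq>\<^sub>m t" "s \<subseteq>\<^sub>m t'" using split[OF sL] by blast
      have "\<exists>t\<in>L b. \<not> onb t \<and> s \<subseteq>\<^sub>m t"
      proof (rule ccontr)
        assume "\<not> ?thesis"
        then have "onb t" "onb t'" using t by auto
        then obtain u u' where u: "u \<in> B" "t \<subseteq>\<^sub>m u" "u' \<in> B" "t' \<subseteq>\<^sub>m u'" unfolding onb_def by auto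
        from Bc[OF u(1,3)] obtain v where "t \<subseteq>\<^sub>m v" "t' \<subseteq>\<^sub>m v" using u(2,4) map_le_trans by blast
        then have "t \<subseteq>\<^sub>m t'" using comparable[OF t(1,2)] by simp
        then show False using same[OF t(1,2)] t(3) by simp
      qed
      then obtain t where t: "t \<in> L b" "\<not> onb t" "s \<subseteq>\<^sub>m t" by auto
      define rs where "rs c = (if c < b then t |` {..<c} else t)" for c
      have rsb: "rs b = t" unfolding rs_def by simp
      define c where "c = (LEAST c. \<not> onb (rs c))"
      have c1: "\<not> onb (rs c)" unfolding c_def by (rule LeastI[of _ b]) (use t(2) rsb in simp)
      have cb: "c \<le> b" unfolding c_def by (rule Least_le) (use t(2) rsb in simp)
      have c2: "onb (rs d)" if "d < c" for d using not_less_Least[OF that[unfolded c_def]] by simp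
      have rL: "rs c \<in> L c"
      proof (cases "c < b")
        case False
        then have "c = b" using cb by simp
        then show ?thesis using t(1) rsb by simp
      qed (simp add: rs_def down[OF t(1)])
      have rst: "rs c \<subseteq>\<^sub>m t" unfolding rs_def using restr_le by auto
      have "onb (rs c |` {..<d})" if "d < c" for d
      proof -
        have "rs c |` {..<d} = rs d"
        proof -
          have "d < b" using that cb by simp
          moreover have "{..<c} \<inter> {..<d} = {..<d}" using that by auto
          ultimately show ?thesis unfolding rs_def by (simp add: restrict_restrict)
        qed
        then show ?thesis using c2[OF that] by simp
      qed
      then have "rs c \<in> A" unfolding A_def using c1 LT[OF rL] ht[OF rL] by simp
      then have "ht (rs c) < e" by (rule e)
      then have "c < e" unfolding ht[OF rL] .
      moreover have "ht s < c"
      proof (rule ccontr)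
        assume "\<not> ht s < c"
        then have "c \<le> ht s" by simp
        then have "rs c \<subseteq>\<^sub>m s" by (rule comparable[OF rL sL _ rst t(3)])
        then show False using c1 s unfolding onb_def by auto
      qed
      ultimately show ?thesis by simp
    qed
    then show ?thesis using bounded_small[OF BT] by blast
  qed
  show ?thesis unfolding T_def[symmetric] souslin_tree_def
    using kt small_less[OF anti] small_less[OF chain] by blast
qed

end

section \<open>Branches climbing along a set of levels\<close>

context wellorder
begin

text \<open>The branch through c starting from x: at each successor point b of c the last node is extended to level b,
preferably within the set q. Its nodes depend on c only through initial segments, which is what coherence needs.\<close>

definition join :: "'a set \<Rightarrow> ('a \<Rightarrow> ('a \<rightharpoonup> 'b)) \<Rightarrow> ('a \<rightharpoonup> 'b) \<Rightarrow> ('a \<rightharpoonup> 'b)" where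
  "join c nd x = (\<lambda>y. if y \<in> dom x then x y
     else if \<exists>g\<in>c. y < g then nd (LEAST g. g \<in> c \<and> y < g) y else None)"

text \<open>The first case is that of limit points, or of a start at level \<open>b\<close>, where
  there is nothing to extend; the last one applies when the preference cannot be met.\<close>

definition pick :: "('a \<Rightarrow> ('a \<rightharpoonup> 'b) set) \<Rightarrow> (('a \<rightharpoonup> 'b) \<Rightarrow> bool) \<Rightarrow> 'a \<Rightarrow> ('a \<rightharpoonup> 'b) \<Rightarrow> ('a \<rightharpoonup> 'b)" where
  "pick L q b u = (if dom u = {..<b} then u
     else if \<exists>y\<in>L b. u \<subseteq>\<^sub>m y \<and> q y then SOME y. y \<in> L b \<and> u \<subseteq>\<^sub>m y \<and> q y
     else SOME y. y \<in> L b \<and> u \<subseteq>\<^sub>m y)"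

definition node :: "(('a \<Rightarrow> ('a \<rightharpoonup> 'b) set) \<Rightarrow> 'a set \<Rightarrow> 'a \<Rightarrow> ('a \<rightharpoonup> 'b) \<Rightarrow> bool) \<Rightarrow> ('a \<Rightarrow> ('a \<rightharpoonup> 'b) set) \<Rightarrow>
    'a set \<Rightarrow> ('a \<rightharpoonup> 'b) \<Rightarrow> 'a \<Rightarrow> ('a \<rightharpoonup> 'b)" where
  "node Q L c x = wfrec {(x, y). x < y} (\<lambda>nd b. pick L (Q L (c \<inter> {..<b}) b) b (join (c \<inter> {..<b}) nd x))"

definition branch :: "(('a \<Rightarrow> ('a \<rightharpoonup> 'b) set) \<Rightarrow> 'a set \<Rightarrow> 'a \<Rightarrow> ('a \<rightharpoonup> 'b) \<Rightarrow> bool) \<Rightarrow> ('a \<Rightarrow> ('a \<rightharpoonup> 'b) set) \<Rightarrow>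
    'a set \<Rightarrow> ('a \<rightharpoonup> 'b) \<Rightarrow> ('a \<rightharpoonup> 'b)" where
  "branch Q L c x = join c (node Q L c x) x"

lemma join_cong:
  assumes "\<And>g. g \<in> c \<Longrightarrow> nd g = nd' g"
  shows "join c nd x = join c nd' x"
proof
  fix y
  show "join c nd x y = join c nd' x y"
  proof (cases "\<exists>g\<in>c. y < g")
    case True
    then have "\<exists>g. g \<in> c \<and> y < g" by blast
    from LeastI_ex[OF this] have "(LEAST g. g \<in> c \<and> y < g) \<in> c" by simp
    from assms[OF this] show ?thesis unfolding join_def by simp
  qed (simp add: join_def)
qed

lemma node_eq0: "node Q L c x b = pick L (Q L (c \<inter> {..<b}) b) b (join (c \<inter> {..<b}) (node Q L c x) x)"
proof -
  have "node Q L c x b = pick L (Q L (c \<inter> {..<b}) b) b (join (c \<inter> {..<b}) (cut (node Q L c x) {(x, y). x < y} b) x)"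
    unfolding node_def by (subst wfrec[OF wf_less]) simp
  also have "join (c \<inter> {..<b}) (cut (node Q L c x) {(x, y). x < y} b) x = join (c \<inter> {..<b}) (node Q L c x) x"
    by (rule join_cong) (simp add: cut_apply)
  finally show ?thesis .
qed

text \<open>A preference at \<open>b\<close> may inspect only levels below \<open>b\<close>, so it
  is available while the tree is still being built.\<close>

definition local_pref :: "(('a \<Rightarrow> ('a \<rightharpoonup> 'b) set) \<Rightarrow> 'a set \<Rightarrow> 'a \<Rightarrow> ('a \<rightharpoonup> 'b) \<Rightarrow> bool) \<Rightarrow> bool" where
  "local_pref Q \<longleftrightarrow> (\<forall>L L' c b. (\<forall>g<b. L g = L' g) \<longrightarrow> Q L c b = Q L' c b)"

lemma pick_cong: "L b = L' b \<Longrightarrow> pick L q b u = pick L' q b u"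
  unfolding pick_def by (erule ssubst) (rule refl)

text \<open>This turns coherence of \<open>C\<close> into coherence of branches: the branch through
  \<open>C b\<close> is an initial part of the one through \<open>C a\<close>.\<close>

lemma node_local:
  assumes Q: "local_pref Q" and "c \<inter> {..<b} = c' \<inter> {..<b}" "\<And>g. g \<le> b \<Longrightarrow> L g = L' g"
  shows "node Q L c x b = node Q L' c' x b"
  using assms(2,3)
proof (induct b rule: less_induct)
  case (less b)
  have "join (c \<inter> {..<b}) (node Q L c x) x = join (c \<inter> {..<b}) (node Q L' c' x) x"
  proof (rule join_cong)
    fix g assume "g \<in> c \<inter> {..<b}"
    then have gb: "g < b" by simp
    show "node Q L c x g = node Q L' c' x g"
    proof (rule less(1)[OF gb])
      have "c \<inter> {..<g} = c \<inter> {..<b} \<inter> {..<g}" "c' \<inter> {..<g} = c' \<inter> {..<b} \<inter> {..<g}" using gb by auto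
      then show "c \<inter> {..<g} = c' \<inter> {..<g}" using less(2) by simp
      fix h assume "h \<le> g"
      then show "L h = L' h" using gb less(3) by simp
    qed
  qed
  then have a1: "join (c \<inter> {..<b}) (node Q L c x) x = join (c' \<inter> {..<b}) (node Q L' c' x) x"
    unfolding less(2) .
  have "\<forall>g<b. L g = L' g" using less(3) by (simp add: less_imp_le)
  then have a2: "Q L (c \<inter> {..<b}) b = Q L' (c' \<inter> {..<b}) b"
    using Q unfolding local_pref_def less(2) by simp
  have a3: "L b = L' b" by (rule less(3)) simp
  have "node Q L c x b = pick L (Q L (c \<inter> {..<b}) b) b (join (c \<inter> {..<b}) (node Q L c x) x)" by (rule node_eq0)
  also have "\<dots> = pick L' (Q L' (c' \<inter> {..<b}) b) b (join (c' \<inter> {..<b}) (node Q L' c' x) x)"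
    unfolding a1 a2 by (rule pick_cong[where L = L and L' = L' and b = b]) (rule a3)
  also have "\<dots> = node Q L' c' x b" by (rule node_eq0[symmetric])
  finally show ?case .
qed

lemma branch_local:
  assumes Q: "local_pref Q" and c: "c \<subseteq> {..<a}" and L: "\<And>g. g < a \<Longrightarrow> L g = L' g"
  shows "branch Q L c x = branch Q L' c x"
  unfolding branch_def
proof (rule join_cong)
  fix g assume "g \<in> c"
  then have "g < a" using c by auto
  then show "node Q L c x g = node Q L' c x g"
    by (intro node_local[OF Q refl] L) (rule le_less_trans)
qed

lemma join_empty: "join {} nd x = x"
  unfolding join_def by (auto simp: domIff)

lemma join_upper:
  assumes dom: "\<And>g. g \<in> c \<Longrightarrow> dom (nd g) = {..<g}" and x: "\<And>g. g \<in> c \<Longrightarrow> x \<subseteq>\<^sub>m nd g"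
    and chain: "\<And>g h. g \<in> c \<Longrightarrow> h \<in> c \<Longrightarrow> h < g \<Longrightarrow> nd h \<subseteq>\<^sub>m nd g" and g: "g \<in> c"
  shows "nd g \<subseteq>\<^sub>m join c nd x"
  unfolding map_le_def
proof
  fix y assume y: "y \<in> dom (nd g)"
  then have yg: "y < g" using dom[OF g] by auto
  define l where "l = (LEAST g. g \<in> c \<and> y < g)"
  have l: "l \<in> c \<and> y < l" unfolding l_def by (rule LeastI[of _ g]) (use g yg in simp)
  have lg: "l \<le> g" unfolding l_def by (rule Least_le) (use g yg in simp)
  have "nd l y = nd g y"
  proof (cases "l = g")
    case False
    then have "nd l \<subseteq>\<^sub>m nd g" using chain g l lg by simp
    moreover have "y \<in> dom (nd l)" using dom l by auto
    ultimately show ?thesis unfolding map_le_def by simp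
  qed simp
  moreover have "x y = nd g y" if "y \<in> dom x" using x[OF g] that unfolding map_le_def by simp
  moreover have "\<exists>g\<in>c. y < g" using g yg by blast
  ultimately show "nd g y = join c nd x y" unfolding join_def l_def[symmetric] by simp
qed

lemma dom_join:
  assumes dom: "\<And>g. g \<in> c \<Longrightarrow> dom (nd g) = {..<g}" and x: "dom x = {..<xi}"
  shows "dom (join c nd x) = {..<xi} \<union> (\<Union>g\<in>c. {..<g})"
proof (rule set_eqI)
  fix y
  show "y \<in> dom (join c nd x) \<longleftrightarrow> y \<in> {..<xi} \<union> (\<Union>g\<in>c. {..<g})"
  proof (cases "y \<in> dom x")
    case True then show ?thesis unfolding join_def using x by (auto simp: domIff)
  next
    case nx: False
    show ?thesis
    proof (cases "\<exists>g\<in>c. y < g")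
      case True
      then have "\<exists>g. g \<in> c \<and> y < g" by blast
      from LeastI_ex[OF this] have "(LEAST g. g \<in> c \<and> y < g) \<in> c" "y < (LEAST g. g \<in> c \<and> y < g)" by auto
      then have "y \<in> dom (nd (LEAST g. g \<in> c \<and> y < g))" using dom by auto
      then show ?thesis unfolding join_def using nx True by (auto simp: domIff)
    next
      case False then show ?thesis unfolding join_def using nx x by (auto simp: domIff)
    qed
  qed
qed

lemma pick_in:
  assumes "u \<in> L e" "dom u = {..<e}" "e < b \<or> u \<in> L b" "e < b \<Longrightarrow> \<exists>y\<in>L b. u \<subseteq>\<^sub>m y"
    and seg: "\<And>a b. {..<a} = {..<b} \<Longrightarrow> a = b" and "u \<in> L b \<Longrightarrow> dom u = {..<b}"
  shows "pick L q b u \<in> L b" "u \<subseteq>\<^sub>m pick L q b u"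
    and "e < b \<Longrightarrow> \<exists>y\<in>L b. u \<subseteq>\<^sub>m y \<and> q y \<Longrightarrow> q (pick L q b u)"
proof -
  have main: "pick L q b u \<in> L b \<and> u \<subseteq>\<^sub>m pick L q b u \<and> (e < b \<longrightarrow> (\<exists>y\<in>L b. u \<subseteq>\<^sub>m y \<and> q y) \<longrightarrow> q (pick L q b u))"
  proof (cases "e < b")
    case False
    then have "u \<in> L b" using assms(3) by simp
    moreover have "dom u = {..<b}" using assms(6) calculation by simp
    ultimately show ?thesis unfolding pick_def using False by simp
  next
    case True
    then have nd: "dom u \<noteq> {..<b}" using assms(2) seg by fastforce
    show ?thesis
    proof (cases "\<exists>y\<in>L b. u \<subseteq>\<^sub>m y \<and> q y")
      case T: True
      then have ex: "\<exists>y. y \<in> L b \<and> u \<subseteq>\<^sub>m y \<and> q y" by blast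
      have "pick L q b u = (SOME y. y \<in> L b \<and> u \<subseteq>\<^sub>m y \<and> q y)" unfolding pick_def using nd T by simp
      then show ?thesis using someI_ex[OF ex] by simp
    next
      case F: False
      have ex: "\<exists>y. y \<in> L b \<and> u \<subseteq>\<^sub>m y" using assms(4)[OF True] by blast
      have "pick L q b u = (SOME y. y \<in> L b \<and> u \<subseteq>\<^sub>m y)" unfolding pick_def if_not_P[OF nd] if_not_P[OF F] ..
      then show ?thesis using someI_ex[OF ex] F by auto
    qed
  qed
  then show "pick L q b u \<in> L b" "u \<subseteq>\<^sub>m pick L q b u"
    "e < b \<Longrightarrow> \<exists>y\<in>L b. u \<subseteq>\<^sub>m y \<and> q y \<Longrightarrow> q (pick L q b u)" by auto
qed

text \<open>The last clause drives the sealing: between two consecutive points of \<open>c\<close>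
  the preference is met as soon as some extension meets it. The hypothesis on limits carries the
  induction past points where nothing can be chosen.\<close>

lemma branch_nodes:
  assumes Q: "local_pref Q"
    and ca: "c \<subseteq> {..<a}" "limpt c a" and cxi: "\<And>g. g \<in> c \<Longrightarrow> xi \<le> g"
    and x: "x \<in> L xi"
    and dom: "\<And>b s. b < a \<Longrightarrow> s \<in> L b \<Longrightarrow> dom s = {..<b}"
    and ext: "\<And>b e u. b < a \<Longrightarrow> e < b \<Longrightarrow> u \<in> L e \<Longrightarrow> \<exists>y\<in>L b. u \<subseteq>\<^sub>m y"
    and lim: "\<And>b. b < a \<Longrightarrow> limpt c b \<Longrightarrow> b \<in> c \<and> branch Q L (c \<inter> {..<b}) x \<in> L b"
  shows "(\<forall>b\<in>c. node Q L c x b \<in> L b \<and> node Q L c x b \<subseteq>\<^sub>m branch Q L c x) \<and>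
    x \<subseteq>\<^sub>m branch Q L c x \<and> dom (branch Q L c x) = {..<a} \<and>
    (\<forall>b\<in>c. \<forall>g\<in>c. g < b \<longrightarrow> \<not> limpt c b \<longrightarrow>
       (\<exists>e\<in>c. g \<le> e \<and> e < b \<and> node Q L c x e \<in> L e \<and>
         ((\<exists>y\<in>L b. node Q L c x e \<subseteq>\<^sub>m y \<and> Q L (c \<inter> {..<b}) b y) \<longrightarrow> Q L (c \<inter> {..<b}) b (node Q L c x b))))"
proof -
  define nd where "nd = node Q L c x"
  have xia: "xi < a"
  proof -
    obtain g where "g \<in> c" "g < a" using ca(2) unfolding limpt_def by blast
    then show ?thesis using cxi le_less_trans by blast
  qed
  have br: "branch Q L (c \<inter> {..<b}) x = join (c \<inter> {..<b}) nd x" for b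
    unfolding branch_def
  proof (rule join_cong)
    fix g assume "g \<in> c \<inter> {..<b}"
    then have "c \<inter> {..<b} \<inter> {..<g} = c \<inter> {..<g}" by auto
    then show "node Q L (c \<inter> {..<b}) x g = nd g" unfolding nd_def by (rule node_local[OF Q]) simp
  qed
  have nde: "nd b = pick L (Q L (c \<inter> {..<b}) b) b (join (c \<inter> {..<b}) nd x)" for b
    unfolding nd_def by (rule node_eq0)
  \<comment> \<open>The supremum of \<open>c\<close> below a successor point of \<open>c\<close>
    belongs to \<open>c\<close>; otherwise it would be a limit of \<open>c\<close> below
    \<open>a\<close>, and those are in \<open>c\<close>.\<close>
  have max_ex: "\<exists>e\<in>c. e < b \<and> (\<forall>g\<in>c. g < b \<longrightarrow> g \<le> e)" if b: "b \<in> c" "g0 \<in> c" "g0 < b" "\<not> limpt c b" for b g0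
  proof -
    obtain d where d: "d < b" "\<And>g. g \<in> c \<Longrightarrow> g < b \<Longrightarrow> g \<le> d" using b(3,4) unfolding limpt_def by (metis not_less)
    define e where "e = (LEAST e. \<forall>g\<in>c. g < b \<longrightarrow> g \<le> e)"
    have e1: "\<forall>g\<in>c. g < b \<longrightarrow> g \<le> e" unfolding e_def by (rule LeastI[of _ d]) (use d in simp)
    have "e \<le> d" unfolding e_def by (rule Least_le) (use d in simp)
    then have eb: "e < b" using d(1) by simp
    have "e \<in> c"
    proof (rule ccontr)
      assume ne: "e \<notin> c"
      have g0e: "g0 < e" using e1 b(2,3) ne by (metis le_less)
      have "limpt c e"
      proof (rule limptI[OF g0e])
        fix y assume "y < e"
        from not_less_Least[OF this[unfolded e_def]] obtain g where g: "g \<in> c" "g < b" "y < g" by (auto simp: not_le)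
        then have "g < e" using e1 ne by (metis le_less)
        then show "\<exists>g\<in>c. y < g \<and> g < e" using g by blast
      qed
      moreover have "e < a" using eb b(1) ca(1) by (auto intro: less_trans)
      ultimately show False using lim ne by blast
    qed
    then show ?thesis using eb e1 by blast
  qed
  have cb: "b < a" if "b \<in> c" for b using ca(1) that by auto
  have main: "nd b \<in> L b \<and> x \<subseteq>\<^sub>m nd b \<and> (\<forall>g\<in>c. g < b \<longrightarrow> nd g \<subseteq>\<^sub>m nd b) \<and>
      ((\<exists>g\<in>c. g < b) \<and> \<not> limpt c b \<longrightarrow> (\<exists>e\<in>c. e < b \<and> (\<forall>g\<in>c. g < b \<longrightarrow> g \<le> e) \<and> nd e \<in> L e \<and>
        ((\<exists>y\<in>L b. nd e \<subseteq>\<^sub>m y \<and> Q L (c \<inter> {..<b}) b y) \<longrightarrow> Q L (c \<inter> {..<b}) b (nd b))))" if "b \<in> c" for b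
    using that
  proof (induct b rule: less_induct)
    case (less b)
    define u where "u = join (c \<inter> {..<b}) nd x"
    have ba: "b < a" by (rule cb[OF less(2)])
    have domg: "dom (nd g) = {..<g}" if "g \<in> c" "g < b" for g using less(1)[OF that(2,1)] dom[OF cb[OF that(1)]] by blast
    have domu: "dom u = {..<xi} \<union> (\<Union>g\<in>c \<inter> {..<b}. {..<g})"
      unfolding u_def by (rule dom_join) (use domg dom[OF xia x] in auto)
    have upper: "nd g \<subseteq>\<^sub>m u" if "g \<in> c" "g < b" for g
      unfolding u_def by (rule join_upper) (use less(1) domg that in auto)
    have xu: "x \<subseteq>\<^sub>m u" unfolding u_def join_def map_le_def by simp
    have e: "\<exists>e. u \<in> L e \<and> (e < b \<or> e = b) \<and> ((\<exists>g\<in>c. g < b) \<and> \<not> limpt c b \<longrightarrow> e \<in> c \<and> e < b \<and> (\<forall>g\<in>c. g < b \<longrightarrow> g \<le> e) \<and> u = nd e)"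
    proof (cases "\<exists>g\<in>c. g < b")
      case False
      then have "c \<inter> {..<b} = {}" by auto
      then have "u = x" unfolding u_def by (simp add: join_empty)
      then show ?thesis using x cxi[OF less(2)] False by (intro exI[of _ xi]) (auto simp: le_less)
    next
      case True
      show ?thesis
      proof (cases "limpt c b")
        case l: True
        then have "u \<in> L b" using lim[OF ba l] unfolding br u_def by simp
        then show ?thesis using l by blast
      next
        case nl: False
        from True obtain g0 where "g0 \<in> c" "g0 < b" by blast
        from max_ex[OF less(2) this nl] obtain e where e: "e \<in> c" "e < b" "\<forall>g\<in>c. g < b \<longrightarrow> g \<le> e" by blast
        \<comment> \<open>All that has been built below \<open>b\<close> is already contained in the
          node at the predecessor \<open>e\<close>.\<close>
        have "dom u \<subseteq> {..<e}"
        proof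
          fix y assume "y \<in> dom u"
          then consider "y < xi" | g where "g \<in> c" "g < b" "y < g" unfolding domu by auto
          then show "y \<in> {..<e}"
          proof cases
            case 1 then show ?thesis using cxi[OF e(1)] by auto
          next
            case 2 then show ?thesis using e(3) by (auto intro: less_le_trans)
          qed
        qed
        then have "u \<subseteq>\<^sub>m nd e" using upper[OF e(1,2)] domg[OF e(1,2)] unfolding map_le_def by auto
        then have "u = nd e" using upper[OF e(1,2)] by (rule map_le_antisym)
        then show ?thesis using less(1)[OF e(2,1)] e by blast
      qed
    qed
    then obtain e where e: "u \<in> L e" "e < b \<or> e = b"
      "(\<exists>g\<in>c. g < b) \<and> \<not> limpt c b \<Longrightarrow> e \<in> c \<and> e < b \<and> (\<forall>g\<in>c. g < b \<longrightarrow> g \<le> e) \<and> u = nd e" by blast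
    have ea: "e < a" using e(2) ba less_trans by blast
    note p = pick_in[where u = u and L = L and e = e and b = b and q = "Q L (c \<inter> {..<b}) b",
      OF e(1) dom[OF ea e(1)] _ ext[OF ba _ e(1)] lessThan_inj dom[OF ba]]
    have eL: "e < b \<or> u \<in> L b" using e(1,2) by blast
    have ndb: "nd b = pick L (Q L (c \<inter> {..<b}) b) b u" unfolding u_def by (rule nde)
    have 1: "nd b \<in> L b" unfolding ndb by (rule p(1)[OF eL])
    have 2: "u \<subseteq>\<^sub>m nd b" unfolding ndb by (rule p(2)[OF eL])
    have 3: "Q L (c \<inter> {..<b}) b (nd b)" if "e < b" "\<exists>y\<in>L b. u \<subseteq>\<^sub>m y \<and> Q L (c \<inter> {..<b}) b y"
      unfolding ndb by (rule p(3)[OF eL]) (assumption | rule that)+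
    show ?case
    proof (intro conjI ballI impI)
      show "nd b \<in> L b" by (rule 1)
      show "x \<subseteq>\<^sub>m nd b" by (rule map_le_trans[OF xu 2])
      show "nd g \<subseteq>\<^sub>m nd b" if "g \<in> c" "g < b" for g by (rule map_le_trans[OF upper[OF that] 2])
      assume "(\<exists>g\<in>c. g < b) \<and> \<not> limpt c b"
      from e(3)[OF this] have ee: "e \<in> c" "e < b" "\<forall>g\<in>c. g < b \<longrightarrow> g \<le> e" "u = nd e" by auto
      show "\<exists>e\<in>c. e < b \<and> (\<forall>g\<in>c. g < b \<longrightarrow> g \<le> e) \<and> nd e \<in> L e \<and>
        ((\<exists>y\<in>L b. nd e \<subseteq>\<^sub>m y \<and> Q L (c \<inter> {..<b}) b y) \<longrightarrow> Q L (c \<inter> {..<b}) b (nd b))"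
        using ee e(1) 3[OF ee(2)] by (intro bexI[of _ e]) simp_all
    qed
  qed
  note m1 = main[THEN conjunct1] and m2 = main[THEN conjunct2, THEN conjunct1]
    and m3 = main[THEN conjunct2, THEN conjunct2, THEN conjunct1, THEN bspec, rule_format]
    and m4 = main[THEN conjunct2, THEN conjunct2, THEN conjunct2, THEN mp, OF _ conjI]
  have domn: "dom (nd b) = {..<b}" if "b \<in> c" for b by (rule dom[OF cb[OF that] m1[OF that]])
  have nb: "nd b \<subseteq>\<^sub>m branch Q L c x" if "b \<in> c" for b
    unfolding branch_def nd_def[symmetric] by (rule join_upper[OF domn m2 m3 that])
  have xb: "x \<subseteq>\<^sub>m branch Q L c x" unfolding branch_def join_def map_le_def by simp
  have "dom (branch Q L c x) = {..<xi} \<union> (\<Union>g\<in>c. {..<g})"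
    unfolding branch_def nd_def[symmetric] by (rule dom_join) (use domn dom[OF xia x] in auto)
  also have "\<dots> = {..<a}"
  proof
    show "{..<xi} \<union> (\<Union>g\<in>c. {..<g}) \<subseteq> {..<a}" using xia cb by (auto intro: less_trans)
    show "{..<a} \<subseteq> {..<xi} \<union> (\<Union>g\<in>c. {..<g})" using limptD[OF ca(2)] by auto
  qed
  finally have db: "dom (branch Q L c x) = {..<a}" .
  have pref: "\<exists>e\<in>c. g \<le> e \<and> e < b \<and> nd e \<in> L e \<and>
         ((\<exists>y\<in>L b. nd e \<subseteq>\<^sub>m y \<and> Q L (c \<inter> {..<b}) b y) \<longrightarrow> Q L (c \<inter> {..<b}) b (nd b))"
    if "b \<in> c" "g \<in> c" "g < b" "\<not> limpt c b" for b g
  proof -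
    have "\<exists>g\<in>c. g < b" using that(2,3) by (intro bexI[of _ g])
    from m4[OF that(1) this that(4)] obtain e where e: "e \<in> c" "e < b" "\<forall>g\<in>c. g < b \<longrightarrow> g \<le> e" "nd e \<in> L e"
      "(\<exists>y\<in>L b. nd e \<subseteq>\<^sub>m y \<and> Q L (c \<inter> {..<b}) b y) \<longrightarrow> Q L (c \<inter> {..<b}) b (nd b)"
      by (elim bexE conjE)
    have "g \<le> e" using e(3) that(2,3) by simp
    then show ?thesis using e(2,4,5) by (intro bexI[OF _ e(1)] conjI)
  qed
  show ?thesis unfolding nd_def[symmetric]
    by (intro conjI ballI impI m1 nb xb db pref)
qed

text \<open>The immediate predecessor; meaningless at limit points and at the least element.\<close>

definition preds :: "'a \<Rightarrow> 'a" where
  "preds a = (SOME d. d < a \<and> (\<forall>y<a. y \<le> d))"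

section \<open>Trees built by recursion on the levels\<close>

lemma cases_limit [case_names zero succ lim]:
  obtains "a = bt" | d where "d < a" "\<forall>y<a. y \<le> d" "preds a = d" "a \<noteq> bt" "\<not> limpt UNIV a" | "limpt UNIV a" "a \<noteq> bt"
proof (cases "a = bt")
  case False
  then have "bt < a" by (simp add: less_le)
  show ?thesis
  proof (cases "limpt UNIV a")
    case True then show ?thesis using that(3) False by blast
  next
    case nl: False
    then have ex: "\<exists>d. d < a \<and> (\<forall>y<a. y \<le> d)" using \<open>bt < a\<close> unfolding limpt_def by (metis UNIV_I not_less)
    from someI_ex[OF this] show ?thesis using that(2)[of "preds a"] False nl unfolding preds_def by blast
  qed
qed (use that in blast)

text \<open>\<open>B P a xi x\<close> is the node placed at the limit level \<open>a\<close> for the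
  node \<open>x\<close> of level \<open>xi\<close>, given the levels \<open>P\<close> below
  \<open>a\<close>. Appending both values at successor levels makes every node split.\<close>

definition levels :: "(('a \<Rightarrow> ('a \<rightharpoonup> 'b) set) \<Rightarrow> 'a \<Rightarrow> 'a \<Rightarrow> ('a \<rightharpoonup> 'b) \<Rightarrow> ('a \<rightharpoonup> 'b)) \<Rightarrow> 'b \<Rightarrow> 'b \<Rightarrow> 'a \<Rightarrow> ('a \<rightharpoonup> 'b) set" where
  "levels B v0 v1 = wfrec {(x, y). x < y} (\<lambda>P a. if a = bt then {Map.empty}
     else if limpt UNIV a then {B P a xi x | xi x. xi < a \<and> x \<in> P xi}
     else {s(preds a \<mapsto> v) | s v. s \<in> P (preds a) \<and> v \<in> {v0, v1}})"

text \<open>The third clause has to be part of the induction, because branches toward limit levels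
  need extensions at each step.\<close>

definition tree_inv :: "(('a \<Rightarrow> ('a \<rightharpoonup> 'b) set) \<Rightarrow> 'a \<Rightarrow> 'a \<Rightarrow> ('a \<rightharpoonup> 'b) \<Rightarrow> ('a \<rightharpoonup> 'b)) \<Rightarrow> 'b \<Rightarrow> 'b \<Rightarrow> 'a \<Rightarrow> bool" where
  "tree_inv B v0 v1 a \<longleftrightarrow> (\<forall>s\<in>levels B v0 v1 a. dom s = {..<a}) \<and>
     (\<forall>s\<in>levels B v0 v1 a. \<forall>b<a. s |` {..<b} \<in> levels B v0 v1 b) \<and>
     (\<forall>b<a. \<forall>u\<in>levels B v0 v1 b. \<exists>y\<in>levels B v0 v1 a. u \<subseteq>\<^sub>m y)"

lemma tree_invD:
  assumes "tree_inv B v0 v1 a"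
  shows "\<And>s. s \<in> levels B v0 v1 a \<Longrightarrow> dom s = {..<a}"
    "\<And>s b. s \<in> levels B v0 v1 a \<Longrightarrow> b < a \<Longrightarrow> s |` {..<b} \<in> levels B v0 v1 b"
    "\<And>b u. b < a \<Longrightarrow> u \<in> levels B v0 v1 b \<Longrightarrow> \<exists>y\<in>levels B v0 v1 a. u \<subseteq>\<^sub>m y"
  using assms unfolding tree_inv_def by simp_all

context
  fixes B :: "('a \<Rightarrow> ('a \<rightharpoonup> 'b) set) \<Rightarrow> 'a \<Rightarrow> 'a \<Rightarrow> ('a \<rightharpoonup> 'b) \<Rightarrow> ('a \<rightharpoonup> 'b)" and v0 v1 :: 'b
  assumes B_local: "\<And>P P' a xi x. limpt UNIV a \<Longrightarrow> (\<And>b. b < a \<Longrightarrow> P b = P' b) \<Longrightarrow> B P a xi x = B P' a xi x"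
begin

lemma levels_unfold:
  "levels B v0 v1 a = (if a = bt then {Map.empty}
     else if limpt UNIV a then {B (levels B v0 v1) a xi x | xi x. xi < a \<and> x \<in> levels B v0 v1 xi}
     else {s(preds a \<mapsto> v) | s v. s \<in> levels B v0 v1 (preds a) \<and> v \<in> {v0, v1}})"
proof -
  let ?L = "levels B v0 v1" and ?C = "cut (levels B v0 v1) {(x, y). x < y} a"
  have e: "?L a = (if a = bt then {Map.empty}
     else if limpt UNIV a then {B ?C a xi x | xi x. xi < a \<and> x \<in> ?C xi}
     else {s(preds a \<mapsto> v) | s v. s \<in> ?C (preds a) \<and> v \<in> {v0, v1}})"
    unfolding levels_def by (subst wfrec[OF wf_less]) simp
  have cutL: "?C b = ?L b" if "b < a" for b using that by (simp add: cut_apply)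
  show ?thesis
  proof (cases a rule: cases_limit)
    case zero then show ?thesis using e by simp
  next
    case (succ d)
    then show ?thesis using e cutL[of d] by simp
  next
    case lim
    have "B ?C a xi x = B ?L a xi x" for xi x by (rule B_local[OF lim(1) cutL])
    then have "{B ?C a xi x | xi x. xi < a \<and> x \<in> ?C xi} = {B ?L a xi x | xi x. xi < a \<and> x \<in> ?L xi}"
      using cutL by (intro Collect_cong) (metis (no_types))
    then show ?thesis using e lim by simp
  qed
qed

lemma levels_zero: "levels B v0 v1 bt = {Map.empty}"
  by (subst levels_unfold) simp

lemma levels_lim: "limpt UNIV a \<Longrightarrow> levels B v0 v1 a = {B (levels B v0 v1) a xi x | xi x. xi < a \<and> x \<in> levels B v0 v1 xi}"
proof -
  assume l: "limpt UNIV a"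
  then have "a \<noteq> bt" unfolding limpt_def using not_less_bt by metis
  then show ?thesis using l by (subst levels_unfold) simp
qed

lemma levels_succ: "\<not> limpt UNIV a \<Longrightarrow> a \<noteq> bt \<Longrightarrow>
    levels B v0 v1 a = {s(preds a \<mapsto> v) | s v. s \<in> levels B v0 v1 (preds a) \<and> v \<in> {v0, v1}}"
  by (subst levels_unfold) simp

text \<open>\<open>K\<close> is a further invariant for the same induction; closure under
  modifications is proved through it. At limits cofinally many restrictions suffice, the others
  being restrictions of these.\<close>

lemma tree_inv_all:
  assumes lim: "\<And>a xi x. limpt UNIV a \<Longrightarrow> (\<And>b. b < a \<Longrightarrow> tree_inv B v0 v1 b \<and> K b) \<Longrightarrow> xi < a \<Longrightarrow> x \<in> levels B v0 v1 xi \<Longrightarrow>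
      dom (B (levels B v0 v1) a xi x) = {..<a} \<and> x \<subseteq>\<^sub>m B (levels B v0 v1) a xi x \<and>
      (\<forall>g<a. \<exists>b. g < b \<and> b < a \<and> B (levels B v0 v1) a xi x |` {..<b} \<in> levels B v0 v1 b)"
    and K: "\<And>a. (\<And>b. b < a \<Longrightarrow> tree_inv B v0 v1 b \<and> K b) \<Longrightarrow> tree_inv B v0 v1 a \<Longrightarrow> K a"
  shows "tree_inv B v0 v1 a \<and> K a"
proof (induct a rule: less_induct)
  case (less a)
  let ?L = "levels B v0 v1"
  have dom: "dom s = {..<b}" if "b < a" "s \<in> ?L b" for s b
    using tree_invD(1)[OF less[OF that(1), THEN conjunct1] that(2)] .
  have down: "s |` {..<g} \<in> ?L g" if "b < a" "s \<in> ?L b" "g < b" for s b g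
    using tree_invD(2)[OF less[OF that(1), THEN conjunct1] that(2,3)] .
  have up: "\<exists>y\<in>?L b. u \<subseteq>\<^sub>m y" if "b < a" "g < b" "u \<in> ?L g" for b g u
    using tree_invD(3)[OF less[OF that(1), THEN conjunct1] that(2,3)] .
  have restr_restr: "s |` {..<b} |` {..<g} = s |` {..<g}" if "g \<le> b" for s :: "'a \<rightharpoonup> 'b" and b g
  proof -
    have "{..<b} \<inter> {..<g} = {..<g}" using that by auto
    then show ?thesis by (simp add: restrict_restrict)
  qed
  have full: "s |` {..<b} = s" if "dom s = {..<b}" for s :: "'a \<rightharpoonup> 'b" and b
  proof
    fix y
    show "(s |` {..<b}) y = s y" unfolding that[symmetric] by (cases "s y") (auto simp: restrict_map_def domIff)
  qed
  have inv: "tree_inv B v0 v1 a"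
  proof (cases a rule: cases_limit)
    case zero
    then show ?thesis unfolding tree_inv_def by (simp add: levels_zero) (metis not_less_bt lessThan_iff equals0I)
  next
    case (succ d)
    have e: "?L a = {s(d \<mapsto> v) | s v. s \<in> ?L d \<and> v \<in> {v0, v1}}" using levels_succ[OF succ(5,4)] unfolding succ(3) .
    have seg: "{..<a} = insert d {..<d}" using succ(1,2) by (auto simp: le_less intro: less_trans)
    have rd: "(s(d \<mapsto> v)) |` {..<d} = s" if "s \<in> ?L d" for s v
    proof -
      have "(s(d \<mapsto> v)) |` {..<d} = s |` {..<d}" by (auto simp: restrict_map_def fun_eq_iff)
      then show ?thesis using full[OF dom[OF succ(1) that]] by simp
    qed
    have r: "(s(d \<mapsto> v)) |` {..<b} \<in> ?L b" if "s \<in> ?L d" "b < a" for s v b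
    proof -
      have bd: "b \<le> d" using that(2) succ(2) by simp
      have e2: "(s(d \<mapsto> v)) |` {..<b} = s |` {..<b}"
        using restr_restr[OF bd, of "s(d \<mapsto> v)"] unfolding rd[OF that(1)] by (rule sym)
      show ?thesis
      proof (cases "b = d")
        case True then show ?thesis using rd[OF that(1)] that(1) by metis
      next
        case False
        then have "b < d" using bd by simp
        then show ?thesis unfolding e2 by (rule down[OF succ(1) that(1)])
      qed
    qed
    show ?thesis unfolding tree_inv_def
    proof (intro conjI ballI allI impI)
      fix s assume "s \<in> ?L a"
      then obtain s' v where s: "s = s'(d \<mapsto> v)" "s' \<in> ?L d" unfolding e by blast
      show "dom s = {..<a}" unfolding s(1) seg using dom[OF succ(1) s(2)] by simp
      show "s |` {..<b} \<in> ?L b" if "b < a" for b unfolding s(1) by (rule r[OF s(2) that])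
    next
      fix b u assume b: "b < a" "u \<in> ?L b"
      obtain y where y: "y \<in> ?L d" "u \<subseteq>\<^sub>m y"
      proof (cases "b = d")
        case True then show ?thesis using that b(2) map_le_refl by blast
      next
        case False
        then have "b < d" using b(1) succ(2) by (metis le_less)
        from up[OF succ(1) this b(2)] show ?thesis using that by blast
      qed
      have "d \<notin> dom u" using y(2) dom[OF succ(1) y(1)] map_le_implies_dom_le by (metis lessThan_iff less_irrefl subsetD)
      then have "u \<subseteq>\<^sub>m y(d \<mapsto> v0)" using y(2) unfolding map_le_def by auto
      moreover have "y(d \<mapsto> v0) \<in> ?L a" unfolding e using y(1) by blast
      ultimately show "\<exists>y\<in>?L a. u \<subseteq>\<^sub>m y" by blast
    qed
  next
    case lm: lim
    have e: "?L a = {B ?L a xi x | xi x. xi < a \<and> x \<in> ?L xi}" by (rule levels_lim[OF lm(1)])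
    show ?thesis unfolding tree_inv_def
    proof (intro conjI ballI allI impI)
      fix s assume "s \<in> ?L a"
      then obtain xi x where s: "s = B ?L a xi x" "xi < a" "x \<in> ?L xi" unfolding e by blast
      note p = lim[OF lm(1) less s(2,3), folded s(1)]
      show "dom s = {..<a}" using p by simp
      fix b assume "b < a"
      then obtain b' where b': "b < b'" "b' < a" "s |` {..<b'} \<in> ?L b'" using p by blast
      from down[OF b'(2,3,1)] show "s |` {..<b} \<in> ?L b" using restr_restr[of b b' s] b'(1) by (simp add: less_imp_le)
    next
      fix b u assume b: "b < a" "u \<in> ?L b"
      show "\<exists>y\<in>?L a. u \<subseteq>\<^sub>m y" using lim[OF lm(1) less b] b unfolding e by blast
    qed
  qed
  then show ?case using K[OF less] by blast
qed

end

end

context succ_cardinal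
begin

lemma small_levels:
  assumes B_local: "\<And>P P' a xi x. limpt UNIV a \<Longrightarrow> (\<And>b. b < a \<Longrightarrow> P b = P' b) \<Longrightarrow> B P a xi x = B P' a xi x"
  shows "small Lm (levels B v0 v1 a)"
proof (induct a rule: less_induct)
  case (less a)
  let ?L = "levels B v0 v1"
  show ?case
  proof (cases a rule: cases_limit)
    case zero
    then show ?thesis by (simp add: levels_zero[OF B_local] small_finite)
  next
    case (succ d)
    have "?L a = (\<lambda>(s, v). s(d \<mapsto> v)) ` (?L d \<times> {v0, v1})" using levels_succ[OF B_local succ(5,4)] unfolding succ(3) by auto
    moreover have "small Lm ((\<lambda>(s, v). s(d \<mapsto> v)) ` (?L d \<times> {v0, v1}))"
      by (intro small_image small_Times less succ(1) small_finite) simp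
    ultimately show ?thesis by simp
  next
    case lim
    have "?L a = (\<Union>xi\<in>{..<a}. B ?L a xi ` ?L xi)" using levels_lim[OF B_local lim(1)] by auto
    moreover have "small Lm (\<Union>xi\<in>{..<a}. B ?L a xi ` ?L xi)"
      by (intro small_UN small_image less small_seg) simp
    ultimately show ?thesis by simp
  qed
qed

end

lemma map_le_restrict: "s \<subseteq>\<^sub>m t \<Longrightarrow> t |` dom s = s"
  unfolding map_le_def by (rule ext) (auto simp: restrict_map_def domIff)

context wellorder
begin

section \<open>A Souslin tree\<close>

text \<open>The domain condition keeps decoding among functions with small domain, the only ones on
  which the code is required to be injective.\<close>

definition guessed :: "(('a \<rightharpoonup> 'b) \<Rightarrow> 'a) \<Rightarrow> ('a \<Rightarrow> 'a set) \<Rightarrow> 'a \<Rightarrow> ('a \<rightharpoonup> 'b) set" where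
  "guessed code Z b = {z. (\<exists>a. dom z = {..<a}) \<and> code z \<in> Z b}"

text \<open>The guess is predense below \<open>b\<close>, with witnesses below \<open>b\<close>.
  Only levels below \<open>b\<close> are involved, so a local preference may refer to it.\<close>

definition good :: "(('a \<rightharpoonup> 'b) \<Rightarrow> 'a) \<Rightarrow> ('a \<Rightarrow> 'a set) \<Rightarrow> ('a \<Rightarrow> ('a \<rightharpoonup> 'b) set) \<Rightarrow> 'a \<Rightarrow> bool" where
  "good code Z L b \<longleftrightarrow> (\<forall>e<b. \<forall>u\<in>L e. \<exists>z\<in>guessed code Z b. \<exists>d<b. z \<in> L d \<and> (u \<subseteq>\<^sub>m z \<or> z \<subseteq>\<^sub>m u))"

lemma goodD:
  assumes "good code Z L b" "e < b" "u \<in> L e"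
  obtains z d where "z \<in> guessed code Z b" "d < b" "z \<in> L d" "u \<subseteq>\<^sub>m z \<or> z \<subseteq>\<^sub>m u"
  using assms unfolding good_def by meson

end

context succ_cardinal
begin

text \<open>A function with small domain is a small set of pairs, and these are enumerated in type
  kappa.\<close>

lemma node_code:
  "\<exists>code :: ('a \<rightharpoonup> 'a) \<Rightarrow> 'a. \<forall>s t. small Lm (dom s) \<longrightarrow> small Lm (dom t) \<longrightarrow> code s = code t \<longrightarrow> s = t"
proof -
  have "|UNIV \<times> UNIV :: ('a \<times> 'a) set| \<le>o |UNIV :: 'a set|" by (intro UNIV_Times UNIV_le_UNIV)
  from enum_small[OF this] obtain w :: "'a \<Rightarrow> ('a \<times> 'a) set"
    where w: "\<forall>W\<subseteq>UNIV \<times> UNIV. small Lm W \<longrightarrow> (\<exists>i. w i = W)" ..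
  define gr where "gr s = (\<lambda>x. (x, the (s x))) ` dom s" for s :: "'a \<rightharpoonup> 'a"
  define code where "code s = (SOME i. w i = gr s)" for s
  have wc: "w (code s) = gr s" if "small Lm (dom s)" for s
  proof -
    have "small Lm (gr s)" unfolding gr_def by (rule small_image[OF that])
    then have "\<exists>i. w i = gr s" using w by simp
    then show ?thesis unfolding code_def by (rule someI_ex)
  qed
  have mem: "(x, y) \<in> gr s \<longleftrightarrow> s x = Some y" for x y s
    unfolding gr_def by (auto simp: image_iff dom_def)
  have "s = t" if "small Lm (dom s)" "small Lm (dom t)" "code s = code t" for s t
  proof
    fix x
    have "gr s = gr t" using wc[OF that(1)] wc[OF that(2)] that(3) by simp
    then have "s x = Some y \<longleftrightarrow> t x = Some y" for y using mem by metis
    then show "s x = t x" by (metis option.exhaust)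
  qed
  then show ?thesis by (intro exI[of _ code]) simp
qed

lemma guessed_eq:
  assumes code: "\<And>s t :: 'a \<rightharpoonup> 'a. small Lm (dom s) \<Longrightarrow> small Lm (dom t) \<Longrightarrow> code s = code t \<Longrightarrow> s = t"
    and P: "\<And>z. z \<in> P \<Longrightarrow> \<exists>a. dom z = {..<a}" and Z: "Z b = code ` P \<inter> {..<b}"
  shows "guessed code Z b = {z\<in>P. code z < b}"
proof
  have sm: "small Lm (dom z)" if "\<exists>a. dom z = {..<a}" for z :: "'a \<rightharpoonup> 'a" using that small_seg by metis
  show "guessed code Z b \<subseteq> {z\<in>P. code z < b}"
  proof
    fix z assume "z \<in> guessed code Z b"
    then have z: "\<exists>a. dom z = {..<a}" "code z \<in> code ` P" "code z < b" unfolding guessed_def Z by auto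
    then obtain z' where "z' \<in> P" "code z = code z'" by auto
    then have "z = z'" using code sm[OF z(1)] sm[OF P] by simp
    then show "z \<in> {z\<in>P. code z < b}" using \<open>z' \<in> P\<close> z(3) by simp
  qed
  show "{z\<in>P. code z < b} \<subseteq> guessed code Z b" unfolding guessed_def Z using P by auto
qed

text \<open>Points closed under a bound on the codes and levels of the witnesses reflect predensity,
  and diamond guesses correctly at one of them above any \<open>x0\<close>.\<close>

lemma unb_good:
  fixes L :: "'a \<Rightarrow> ('a \<rightharpoonup> 'a) set"
  assumes code: "\<And>s t :: 'a \<rightharpoonup> 'a. small Lm (dom s) \<Longrightarrow> small Lm (dom t) \<Longrightarrow> code s = code t \<Longrightarrow> s = t"
    and Z: "\<And>W D. clubset D \<Longrightarrow> \<exists>a\<in>D. cofw a \<and> Z a = W \<inter> {..<a}"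
    and dom: "\<And>a s. s \<in> L a \<Longrightarrow> dom s = {..<a}" and sm: "\<And>a. small Lm (L a)"
    and P: "P \<subseteq> (\<Union>a. L a)" "\<forall>s\<in>\<Union>a. L a. \<exists>z\<in>P. s \<subseteq>\<^sub>m z \<or> z \<subseteq>\<^sub>m s"
  shows "unb {b. Z b = code ` P \<inter> {..<b} \<and> good code Z L b}"
  unfolding unb_def
proof
  fix x0
  have "\<forall>u. \<exists>z. u \<in> (\<Union>a. L a) \<longrightarrow> z \<in> P \<and> (u \<subseteq>\<^sub>m z \<or> z \<subseteq>\<^sub>m u)" using P(2) by metis
  from choice[OF this] obtain zf where zf0: "\<forall>u. u \<in> (\<Union>a. L a) \<longrightarrow> zf u \<in> P \<and> (u \<subseteq>\<^sub>m zf u \<or> zf u \<subseteq>\<^sub>m u)" ..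
  have zf: "zf u \<in> P" "u \<subseteq>\<^sub>m zf u \<or> zf u \<subseteq>\<^sub>m u" if "u \<in> L a" for u a
  proof -
    have "u \<in> (\<Union>a. L a)" using that by (rule UN_I[OF UNIV_I])
    from zf0[THEN spec, THEN mp, OF this] show "zf u \<in> P" "u \<subseteq>\<^sub>m zf u \<or> zf u \<subseteq>\<^sub>m u" by simp_all
  qed
  have "\<forall>z. \<exists>d. z \<in> P \<longrightarrow> z \<in> L d" using P(1) by auto
  from choice[OF this] obtain df where df: "\<forall>z. z \<in> P \<longrightarrow> z \<in> L (df z)" ..
  have "\<exists>h. \<forall>x. \<forall>y\<in>(\<lambda>u. code (zf u)) ` L x \<union> (\<lambda>u. df (zf u)) ` L x. y < h x"
    by (rule bnd_fun) (intro small_Un small_image sm)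
  then obtain h where h0: "\<forall>x. \<forall>y\<in>(\<lambda>u. code (zf u)) ` L x \<union> (\<lambda>u. df (zf u)) ` L x. y < h x" ..
  have h: "code (zf u) < h x" "df (zf u) < h x" if "u \<in> L x" for u x
    by (rule h0[THEN spec, THEN bspec], use that in simp)+
  have "clubset ({b. limpt UNIV b \<and> (\<forall>x<b. h x < b)} \<inter> {x0<..})" by (intro club_Int club_closure club_tail)
  from Z[OF this, of "code ` P"] obtain b where b: "\<And>x. x < b \<Longrightarrow> h x < b" "x0 < b" "Z b = code ` P \<inter> {..<b}" by auto
  have Pdom: "\<exists>a. dom z = {..<a}" if "z \<in> P" for z using dom[OF df[THEN spec, THEN mp, OF that]] by (rule exI)
  have ge: "guessed code Z b = {z\<in>P. code z < b}"
    by (rule guessed_eq) (rule code, assumption+, rule Pdom, assumption, rule b(3))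
  have "good code Z L b" unfolding good_def
  proof (intro allI impI ballI)
    fix e u assume e: "e < b" "u \<in> L e"
    have "code (zf u) < b" "df (zf u) < b" using h[OF e(2)] b(1)[OF e(1)] by (auto intro: less_trans)
    then show "\<exists>z\<in>guessed code Z b. \<exists>d<b. z \<in> L d \<and> (u \<subseteq>\<^sub>m z \<or> z \<subseteq>\<^sub>m u)"
      unfolding ge using zf[OF e(2)] df by (intro bexI[of _ "zf u"]) auto
  qed
  then show "\<exists>y\<in>{b. Z b = code ` P \<inter> {..<b} \<and> good code Z L b}. x0 < y" using b by auto
qed

text \<open>The two trees differ only in \<open>B\<close>; the invariant and the sealing are all
  that must be checked separately.\<close>

lemma souslin_from_levels:
  fixes B :: "('a \<Rightarrow> ('a \<rightharpoonup> 'b) set) \<Rightarrow> 'a \<Rightarrow> 'a \<Rightarrow> ('a \<rightharpoonup> 'b) \<Rightarrow> ('a \<rightharpoonup> 'b)" and v0 v1 :: 'b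
  assumes B_local: "\<And>P P' a xi x. limpt UNIV a \<Longrightarrow> (\<And>b. b < a \<Longrightarrow> P b = P' b) \<Longrightarrow> B P a xi x = B P' a xi x"
    and inv: "\<And>a. tree_inv B v0 v1 a" and v: "v0 \<noteq> v1"
    and seal: "\<And>P. P \<subseteq> (\<Union>a. levels B v0 v1 a) \<Longrightarrow> (\<forall>s\<in>\<Union>a. levels B v0 v1 a. \<exists>z\<in>P. s \<subseteq>\<^sub>m z \<or> z \<subseteq>\<^sub>m s) \<Longrightarrow>
        \<exists>a. \<forall>s\<in>levels B v0 v1 a. \<exists>b<a. \<exists>z\<in>P \<inter> levels B v0 v1 b. z \<subseteq>\<^sub>m s"
  shows "souslin_tree ord_rel (\<Union>a. levels B v0 v1 a) map_lt"
proof (rule souslin_levels[OF _ _ _ _ _ seal])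
  note D = tree_invD[OF inv]
  show "dom s = {..<a}" if "s \<in> levels B v0 v1 a" for a s by (rule D(1)[OF that])
  show "s |` {..<b} \<in> levels B v0 v1 b" if "s \<in> levels B v0 v1 a" "b < a" for a b s by (rule D(2)[OF that])
  show "small Lm (levels B v0 v1 a)" for a by (rule small_levels[OF B_local])
  show "levels B v0 v1 a \<noteq> {}" for a
  proof (cases "a = bt")
    case True then show ?thesis using levels_zero[of B v0 v1, OF B_local] by simp
  next
    case False
    then have "bt < a" by (simp add: less_le)
    moreover have "Map.empty \<in> levels B v0 v1 bt" using levels_zero[of B v0 v1, OF B_local] by simp
    ultimately show ?thesis using D(3) by blast
  qed
  show "\<exists>b t t'. t \<in> levels B v0 v1 b \<and> t' \<in> levels B v0 v1 b \<and> t \<noteq> t' \<and> s \<subseteq>\<^sub>m t \<and> s \<subseteq>\<^sub>m t'" if s: "s \<in> levels B v0 v1 a" for a s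
  proof -
    define b where "b = (LEAST y. a < y)"
    have ab: "a < b" unfolding b_def by (rule LeastI_ex[OF no_max])
    have ba: "y \<le> a" if "y < b" for y using not_less_Least[OF that[unfolded b_def]] by simp
    have nl: "\<not> limpt UNIV b" using limptD[OF _ ab, of UNIV] ba by (metis not_le)
    have "b \<noteq> bt" using ab by (metis not_less_bt)
    have "preds b < b \<and> (\<forall>y<b. y \<le> preds b)" unfolding preds_def by (rule someI[of _ a]) (use ab ba in simp)
    then have "preds b = a" using ab ba by (metis order.antisym)
    then have L: "levels B v0 v1 b = {s(a \<mapsto> v) | s v. s \<in> levels B v0 v1 a \<and> v \<in> {v0, v1}}"
      using levels_succ[where B = B, OF B_local nl \<open>b \<noteq> bt\<close>] by simp
    have "a \<notin> dom s" using D(1)[OF s] by simp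
    then have le: "s \<subseteq>\<^sub>m s(a \<mapsto> v)" for v unfolding map_le_def by auto
    have "s(a \<mapsto> v0) \<in> levels B v0 v1 b" "s(a \<mapsto> v1) \<in> levels B v0 v1 b" unfolding L using s by blast+
    moreover have "s(a \<mapsto> v0) \<noteq> s(a \<mapsto> v1)" using v by (metis fun_upd_same option.inject)
    ultimately show ?thesis using le by blast
  qed
qed

definition hits :: "('a \<Rightarrow> 'a set) \<Rightarrow> bool" where
  "hits C \<longleftrightarrow> (\<forall>A D. unb A \<longrightarrow> clubset D \<longrightarrow>
      (\<exists>a\<in>D. cofw a \<and> (\<forall>x<a. \<exists>b\<in>C a \<inter> A. x < b \<and> \<not> limpt (C a) b)))"

lemma limpt_tail: assumes "limpt c a" "xi < a" shows "limpt (c \<inter> {xi..}) a"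
proof (rule limptI[OF assms(2)])
  fix y assume "y < a"
  then have "max xi y < a" using assms(2) by simp
  from limptD[OF assms(1) this] show "\<exists>g\<in>c \<inter> {xi..}. y < g \<and> g < a" by (auto intro: less_imp_le)
qed

lemma souslin_tree_exists:
  assumes C: "coh_seq C" and H: "hits C"
  shows "\<exists>T :: ('a \<rightharpoonup> 'a) set. souslin_tree ord_rel T map_lt \<and> (\<forall>s\<in>T. \<exists>a. dom s = {..<a})"
proof -
  obtain code :: "('a \<rightharpoonup> 'a) \<Rightarrow> 'a" where "\<forall>s t. small Lm (dom s) \<longrightarrow> small Lm (dom t) \<longrightarrow> code s = code t \<longrightarrow> s = t"
    using node_code ..
  then have code: "small Lm (dom s) \<Longrightarrow> small Lm (dom t) \<Longrightarrow> code s = code t \<Longrightarrow> s = t" for s t by simp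
  obtain Z :: "'a \<Rightarrow> 'a set" where "\<forall>W D. clubset D \<longrightarrow> (\<exists>a\<in>D. cofw a \<and> Z a = W \<inter> {..<a})"
    using diamond ..
  then have Z: "clubset D \<Longrightarrow> \<exists>a\<in>D. cofw a \<and> Z a = W \<inter> {..<a}" for W D by simp
  obtain v1 :: 'a where v1: "bt < v1" using no_max ..
  define Q where "Q = (\<lambda>(L :: 'a \<Rightarrow> ('a \<rightharpoonup> 'a) set) (c :: 'a set) b y. \<exists>z\<in>guessed code Z b. z \<subseteq>\<^sub>m y)"
  have Q: "local_pref Q" unfolding local_pref_def Q_def by simp
  \<comment> \<open>Starting at \<open>x\<close> above \<open>xi\<close> gives each lower node a
    branch of its own, so sealing every such branch treats the whole level \<open>a\<close>.\<close>
  define B where "B = (\<lambda>P a xi x. branch Q P (C a \<inter> {xi..}) x)"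
  have B_local: "B P a xi x = B P' a xi x" if "limpt UNIV a" "\<And>b. b < a \<Longrightarrow> P b = P' b" for P P' a xi x
    unfolding B_def by (rule branch_local[OF Q _ that(2)]) (use coh_seqD(1)[OF C that(1)] in auto)
  define L where "L = levels B bt v1"
  have Llim: "L a = {B L a xi x | xi x. xi < a \<and> x \<in> L xi}" if "limpt UNIV a" for a
    unfolding L_def by (rule levels_lim[OF B_local that])
  have nodes: "(\<forall>b\<in>C a \<inter> {xi..}. node Q L (C a \<inter> {xi..}) x b \<in> L b \<and> node Q L (C a \<inter> {xi..}) x b \<subseteq>\<^sub>m B L a xi x) \<and>
    x \<subseteq>\<^sub>m B L a xi x \<and> dom (B L a xi x) = {..<a} \<and>
    (\<forall>b\<in>C a \<inter> {xi..}. \<forall>g\<in>C a \<inter> {xi..}. g < b \<longrightarrow> \<not> limpt (C a \<inter> {xi..}) b \<longrightarrow>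
       (\<exists>e\<in>C a \<inter> {xi..}. g \<le> e \<and> e < b \<and> node Q L (C a \<inter> {xi..}) x e \<in> L e \<and>
         ((\<exists>y\<in>L b. node Q L (C a \<inter> {xi..}) x e \<subseteq>\<^sub>m y \<and> Q L (C a \<inter> {xi..} \<inter> {..<b}) b y) \<longrightarrow>
           Q L (C a \<inter> {xi..} \<inter> {..<b}) b (node Q L (C a \<inter> {xi..}) x b))))"
    if a: "limpt UNIV a" and inv: "\<And>b. b < a \<Longrightarrow> tree_inv B bt v1 b" and xi: "xi < a" "x \<in> L xi" for a xi x
    unfolding B_def
  proof (rule branch_nodes[OF Q])
    note ca = coh_seqD[OF C a]
    show "C a \<inter> {xi..} \<subseteq> {..<a}" using ca(1) by auto
    show "limpt (C a \<inter> {xi..}) a" by (rule limpt_tail[OF ca(2) xi(1)])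
    show "xi \<le> g" if "g \<in> C a \<inter> {xi..}" for g using that by simp
    show "x \<in> L xi" by (rule xi(2))
    show "dom s = {..<b}" if "b < a" "s \<in> L b" for b s
      by (rule tree_invD(1)[OF inv[OF that(1)] that(2)[unfolded L_def]])
    show "\<exists>y\<in>L b. u \<subseteq>\<^sub>m y" if "b < a" "e < b" "u \<in> L e" for b e u
      using tree_invD(3)[OF inv[OF that(1)] that(2) that(3)[unfolded L_def]] unfolding L_def .
    fix b assume b: "b < a" "limpt (C a \<inter> {xi..}) b"
    have l: "limpt (C a) b" by (rule limpt_mono[OF b(2)]) simp
    obtain g where "g \<in> C a \<inter> {xi..}" "g < b" using b(2) unfolding limpt_def by auto
    then have xb: "xi < b" by auto
    \<comment> \<open>Cutting at \<open>xi\<close> respects coherence, so this initial part of the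
      branch is the node already placed at level \<open>b\<close>.\<close>
    have e: "C a \<inter> {xi..} \<inter> {..<b} = C b \<inter> {xi..}" using ca(4)[OF b(1) l] by auto
    have "B L b xi x \<in> L b" using Llim[OF limpt_mono[OF l subset_UNIV]] xb xi(2) by blast
    then show "b \<in> C a \<inter> {xi..} \<and> branch Q L (C a \<inter> {xi..} \<inter> {..<b}) x \<in> L b"
      unfolding e B_def using ca(3)[OF b(1) l] xb by simp
  qed
  have inv: "tree_inv B bt v1 a \<and> True" for a
  proof (rule tree_inv_all[of B, OF B_local])
    fix a xi x assume a: "limpt UNIV a" "\<And>b. b < a \<Longrightarrow> tree_inv B bt v1 b \<and> True" "xi < a" "x \<in> levels B bt v1 xi"
    note n = nodes[OF a(1) a(2)[THEN conjunct1] a(3) a(4)[folded L_def]]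
    have "\<exists>b. g < b \<and> b < a \<and> B L a xi x |` {..<b} \<in> L b" if ga: "g < a" for g
    proof -
      obtain b where b: "b \<in> C a \<inter> {xi..}" "g < b" "b < a"
        using limptD[OF limpt_tail[OF coh_seqD(2)[OF C a(1)] a(3)] ga] by auto
      define s where "s = node Q L (C a \<inter> {xi..}) x b"
      have s: "s \<in> L b" "s \<subseteq>\<^sub>m B L a xi x" unfolding s_def using n b(1) by simp_all
      have "dom s = {..<b}" by (rule tree_invD(1)[OF a(2)[OF b(3), THEN conjunct1] s(1)[unfolded L_def]])
      then show ?thesis using map_le_restrict[OF s(2)] s(1) b by (intro exI[of _ b]) simp
    qed
    then show "dom (B (levels B bt v1) a xi x) = {..<a} \<and> x \<subseteq>\<^sub>m B (levels B bt v1) a xi x \<and>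
      (\<forall>g<a. \<exists>b. g < b \<and> b < a \<and> B (levels B bt v1) a xi x |` {..<b} \<in> levels B bt v1 b)"
      unfolding L_def[symmetric] using n by simp
  qed simp_all
  then have inv: "tree_inv B bt v1 a" for a by simp
  note D = tree_invD[OF inv, folded L_def]
  have smL: "small Lm (L a)" for a unfolding L_def by (rule small_levels[of B, OF B_local])
  have "souslin_tree ord_rel (\<Union>a. levels B bt v1 a) map_lt"
  proof (rule souslin_from_levels[of B, OF B_local inv])
    show "bt \<noteq> v1" using v1 by (metis less_irrefl)
    fix P assume P: "P \<subseteq> (\<Union>a. levels B bt v1 a)" "\<forall>s\<in>\<Union>a. levels B bt v1 a. \<exists>z\<in>P. s \<subseteq>\<^sub>m z \<or> z \<subseteq>\<^sub>m s"
    define A where "A = {b. Z b = code ` P \<inter> {..<b} \<and> good code Z L b}"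
    have "unb A" unfolding A_def
      by (rule unb_good[where code = code and Z = Z and L = L and P = P, OF code Z D(1) smL P[folded L_def]])
    then obtain a where a: "cofw a" "\<forall>x<a. \<exists>b\<in>C a \<inter> A. x < b \<and> \<not> limpt (C a) b"
      using H club_UNIV unfolding hits_def by (metis)
    have al: "limpt UNIV a" by (rule cofw_limpt[OF a(1)])
    have Pdom: "\<exists>a. dom z = {..<a}" if "z \<in> P" for z using P(1) that D(1) unfolding L_def by blast
    have "\<exists>b<a. \<exists>z\<in>P \<inter> L b. z \<subseteq>\<^sub>m s" if sa: "s \<in> L a" for s
    proof -
      obtain xi x where s: "s = B L a xi x" "xi < a" "x \<in> L xi" using sa unfolding Llim[OF al] by auto
      note n = nodes[OF al inv s(2,3), folded s(1)]
      let ?c = "C a \<inter> {xi..}"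
      obtain g where g: "g \<in> ?c" "g < a" using limptD[OF limpt_tail[OF coh_seqD(2)[OF C al] s(2)] s(2)] by auto
      obtain b where b: "b \<in> C a" "b \<in> A" "g < b" "\<not> limpt (C a) b" using a(2) g(2) by auto
      have bc: "b \<in> ?c" using b(1,3) g(1) by auto
      have nl: "\<not> limpt ?c b" using b(4) limpt_mono[of ?c b "C a"] by auto
      obtain e where e: "e < b" "node Q L ?c x e \<in> L e"
        "(\<exists>y\<in>L b. node Q L ?c x e \<subseteq>\<^sub>m y \<and> Q L (?c \<inter> {..<b}) b y) \<longrightarrow> Q L (?c \<inter> {..<b}) b (node Q L ?c x b)"
        using n[THEN conjunct2, THEN conjunct2, THEN conjunct2, THEN bspec, OF bc, THEN bspec, OF g(1), THEN mp, OF b(3), THEN mp, OF nl] by auto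
      have Zb: "Z b = code ` P \<inter> {..<b}" and gb: "good code Z L b" using b(2) unfolding A_def by simp_all
      obtain z d where z: "z \<in> guessed code Z b" "d < b" "z \<in> L d" "node Q L ?c x e \<subseteq>\<^sub>m z \<or> z \<subseteq>\<^sub>m node Q L ?c x e"
        using goodD[OF gb e(1,2)] .
      \<comment> \<open>The larger of the two comparable nodes extends to level \<open>b\<close>,
        which shows that the preference can be met.\<close>
      have "\<exists>y\<in>L b. node Q L ?c x e \<subseteq>\<^sub>m y \<and> z \<subseteq>\<^sub>m y"
        using z(4) D(3)[OF z(2,3)] D(3)[OF e(1,2)] map_le_trans by metis
      then have "Q L (?c \<inter> {..<b}) b (node Q L ?c x b)" using e(3) z(1) unfolding Q_def by blast
      then obtain z' where z': "z' \<in> guessed code Z b" "z' \<subseteq>\<^sub>m node Q L ?c x b" unfolding Q_def by auto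
      have nb: "node Q L ?c x b \<in> L b" "node Q L ?c x b \<subseteq>\<^sub>m s" using n[THEN conjunct1, THEN bspec, OF bc] by simp_all
      have "guessed code Z b = {z\<in>P. code z < b}"
        by (rule guessed_eq) (rule code, assumption+, rule Pdom, assumption, rule Zb)
      then have zP: "z' \<in> P" using z'(1) by simp
      then obtain d' where d': "z' \<in> L d'" using P(1) unfolding L_def by auto
      have "{..<d'} \<subseteq> {..<b}" using map_le_implies_dom_le[OF z'(2)] D(1)[OF d'] D(1)[OF nb(1)] by simp
      then have "d' \<le> b" by (metis lessThan_iff less_irrefl not_le subsetD)
      then have "d' < a" using coh_seqD(1)[OF C al b(1)] by simp
      then show ?thesis using zP d' map_le_trans[OF z'(2) nb(2)] by (intro exI[of _ d'] conjI bexI[of _ z']) simp_all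
    qed
    then have "\<forall>s\<in>L a. \<exists>b<a. \<exists>z\<in>P \<inter> L b. z \<subseteq>\<^sub>m s" by (rule ballI)
    then show "\<exists>a. \<forall>s\<in>levels B bt v1 a. \<exists>b<a. \<exists>z\<in>P \<inter> levels B bt v1 b. z \<subseteq>\<^sub>m s"
      unfolding L_def[symmetric] by (rule exI)
  qed
  moreover have "\<forall>s\<in>\<Union>a. levels B bt v1 a. \<exists>a. dom s = {..<a}" using D(1) unfolding L_def by blast
  ultimately show ?thesis by (intro exI[of _ "\<Union>a. levels B bt v1 a"] conjI)
qed

end

section \<open>A uniformly coherent Souslin tree\<close>

lemma map_add_le_mono: "s \<subseteq>\<^sub>m t \<Longrightarrow> s ++ x \<subseteq>\<^sub>m t ++ x"
  unfolding map_le_def by (auto simp: map_add_def split: option.splits)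

lemma map_add_absorb: "dom x \<subseteq> dom s \<Longrightarrow> x ++ s = s"
  by (rule ext) (auto simp: map_add_def dom_def split: option.splits)

text \<open>A demand on the modification \<open>u ++ x\<close> can thus be met on the branch through
  \<open>u\<close>: \<open>y ++ u\<close> extends \<open>u\<close>, and modifying it by
  \<open>x\<close> gives back \<open>y\<close>.\<close>

lemma map_add_restore: "u ++ x \<subseteq>\<^sub>m y \<Longrightarrow> (y ++ u) ++ x = y"
proof
  fix k
  assume le: "u ++ x \<subseteq>\<^sub>m y"
  show "((y ++ u) ++ x) k = y k"
  proof (cases "k \<in> dom (u ++ x)")
    case True
    have "(u ++ x) k = y k" by (rule le[unfolded map_le_def, THEN bspec, OF True])
    then show ?thesis unfolding map_add_assoc[symmetric] using map_add_dom_app_simps(1)[OF True, of y] by simp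
  next
    case False
    show ?thesis unfolding map_add_assoc[symmetric] by (rule map_add_dom_app_simps(3)[OF False])
  qed
qed

section \<open>Order types and reflection\<close>

context wellorder
begin

text \<open>The order type of S below b.\<close>

definition otp :: "'a set \<Rightarrow> 'a \<Rightarrow> 'a" where
  "otp S = wfrec {(x, y). x < y} (\<lambda>f b. LEAST e. \<forall>g\<in>S. g < b \<longrightarrow> f g < e)"

lemma otp_eq: "otp S b = (LEAST e. \<forall>g\<in>S. g < b \<longrightarrow> otp S g < e)"
proof -
  have "otp S b = (LEAST e. \<forall>g\<in>S. g < b \<longrightarrow> cut (otp S) {(x, y). x < y} b g < e)"
    unfolding otp_def by (subst wfrec[OF wf_less]) simp
  then show ?thesis by (simp add: cut_apply cong: imp_cong)
qed

lemma otp_le: "otp S b \<le> b"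
proof (induct b rule: less_induct)
  case (less b)
  have "\<forall>g\<in>S. g < b \<longrightarrow> otp S g < b" using less by (meson le_less_trans)
  then show ?case by (subst otp_eq) (rule Least_le)
qed

lemma otp_less: "g \<in> S \<Longrightarrow> g < b \<Longrightarrow> otp S g < otp S b"
proof -
  have "\<forall>g\<in>S. g < b \<longrightarrow> otp S g < b" using otp_le by (meson le_less_trans)
  from LeastI[of "\<lambda>e. \<forall>g\<in>S. g < b \<longrightarrow> otp S g < e", OF this] show "g \<in> S \<Longrightarrow> g < b \<Longrightarrow> otp S g < otp S b"
    unfolding otp_eq[of S b, symmetric] by simp
qed

lemma otp_mono: "a \<le> b \<Longrightarrow> otp S a \<le> otp S b"
proof -
  assume "a \<le> b"
  then have "\<forall>g\<in>S. g < a \<longrightarrow> otp S g < otp S b" using otp_less less_le_trans by meson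
  then show ?thesis by (subst otp_eq) (rule Least_le)
qed

lemma otp_surj: "xi < otp S b \<Longrightarrow> \<exists>g\<in>S. g < b \<and> otp S g = xi"
proof (induct b rule: less_induct)
  case (less b)
  have "xi < (LEAST e. \<forall>g\<in>S. g < b \<longrightarrow> otp S g < e)" using less(2) unfolding otp_eq[of S b] .
  from not_less_Least[OF this] obtain g where g: "g \<in> S" "g < b" "xi \<le> otp S g" by (auto simp: not_less)
  show ?case
  proof (cases "xi = otp S g")
    case True then show ?thesis using g by blast
  next
    case False
    then have "xi < otp S g" using g(3) by simp
    from less(1)[OF g(2) this] show ?thesis using g(2) less_trans by meson
  qed
qed

lemma otp_local: "S \<inter> {..<b} = S' \<inter> {..<b} \<Longrightarrow> otp S b = otp S' b"
proof (induct b rule: less_induct)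
  case (less b)
  have "otp S g = otp S' g" if "g < b" for g
  proof (rule less(1)[OF that])
    have "S \<inter> {..<g} = S \<inter> {..<b} \<inter> {..<g}" "S' \<inter> {..<g} = S' \<inter> {..<b} \<inter> {..<g}" using that by auto
    then show "S \<inter> {..<g} = S' \<inter> {..<g}" using less(2) by simp
  qed
  moreover have "g \<in> S \<longleftrightarrow> g \<in> S'" if "g < b" for g using less(2) that by blast
  ultimately have "(\<forall>g\<in>S. g < b \<longrightarrow> otp S g < e) \<longleftrightarrow> (\<forall>g\<in>S'. g < b \<longrightarrow> otp S' g < e)" for e by metis
  then show ?case unfolding otp_eq[of S b] otp_eq[of S' b] by simp
qed

definition nacc :: "'a set \<Rightarrow> 'a set" where
  "nacc c = {b \<in> c. \<not> limpt c b}"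

definition ucof :: "'a \<Rightarrow> bool" where
  "ucof g \<longleftrightarrow> limpt UNIV g \<and> (\<forall>f::nat \<Rightarrow> 'a. (\<forall>i. f i < g) \<longrightarrow> (\<exists>b<g. \<forall>i. f i < b))"

text \<open>The conditions on \<open>D\<close> spell out that it is a club in
  \<open>g\<close>.\<close>

definition reflecting :: "'a set \<Rightarrow> bool" where
  "reflecting S0 \<longleftrightarrow> (\<forall>S\<subseteq>S0. stat S \<longrightarrow>
     (\<exists>g. ucof g \<and> (\<forall>D\<subseteq>{..<g}. limpt D g \<longrightarrow> (\<forall>b<g. limpt D b \<longrightarrow> b \<in> D) \<longrightarrow> S \<inter> D \<noteq> {})))"

lemma limpt_ex: "limpt X b \<Longrightarrow> \<exists>y\<in>X. y < b"
  unfolding limpt_def by blast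

text \<open>The supremum of omega many points of \<open>c\<close> remains below \<open>g\<close>, as
  the cofinality of \<open>g\<close> is uncountable.\<close>

lemma ucof_acc:
  assumes g: "ucof g" and c: "limpt c g"
  shows "limpt {b. limpt c b} g"
proof -
  have "\<exists>x. x < g" using c unfolding limpt_def by simp
  then obtain x0 where x0: "x0 < g" ..
  show ?thesis
  proof (rule limptI[OF x0])
    fix x assume x: "x < g"
    define nx where "nx y = (SOME z. z \<in> c \<and> y < z \<and> z < g)" for y
    have nx: "nx y \<in> c \<and> y < nx y \<and> nx y < g" if "y < g" for y
      unfolding nx_def by (rule someI_ex) (use limptD[OF c that] in blast)
    define f where "f n = (nx ^^ n) (nx x)" for n :: nat
    have f: "f n < g \<and> x < f n" for n
    proof (induct n)
      case 0 then show ?case unfolding f_def using nx[OF x] by simp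
    next
      case (Suc n)
      then have "nx (f n) < g \<and> f n < nx (f n)" using nx by simp
      then show ?case using Suc unfolding f_def by (auto intro: less_trans)
    qed
    have fS: "f n < f (Suc n)" "f (Suc n) \<in> c" for n using nx f unfolding f_def by auto
    obtain b0 where b0: "b0 < g" "\<forall>i. f i < b0" using g f unfolding ucof_def by metis
    define b where "b = (LEAST b. \<forall>i. f i < b)"
    have b: "\<forall>i. f i < b" unfolding b_def by (rule LeastI[of _ b0]) (rule b0(2))
    have bb0: "b \<le> b0" unfolding b_def by (rule Least_le) (rule b0(2))
    have xb: "x < b" using f[of 0] b by (meson less_trans)
    have "limpt c b"
    proof (rule limptI[OF xb])
      fix y assume "y < b"
      from not_less_Least[OF this[unfolded b_def]] obtain i where "y \<le> f i" by (auto simp: not_less)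
      then have "y < f (Suc i)" using fS(1)[of i] by simp
      then show "\<exists>z\<in>c. y < z \<and> z < b" using fS(2) b by (intro bexI[of _ "f (Suc i)"]) auto
    qed
    then show "\<exists>y\<in>{b. limpt c b}. x < y \<and> y < g" using xb bb0 b0(1) by (intro bexI[of _ b]) auto
  qed
qed

lemma good_cong: "(\<And>g. g < b \<Longrightarrow> L g = L' g) \<Longrightarrow> good code Z L b = good code Z L' b"
  unfolding good_def by (simp cong: conj_cong)

end

context succ_cardinal
begin

text \<open>If all these order types were smaller, they would be constant on a stationary set, which
  reflects at some \<open>g\<close>. Two of its members \<open>a < a'\<close> are limit points of
  \<open>C g\<close>, so \<open>C a\<close> is an initial part of \<open>C a'\<close>; the hits in
  \<open>C a'\<close> above \<open>a\<close> make its order type larger.\<close>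

lemma long_hits:
  assumes C: "coh_seq C" and H: "hits C" and R: "reflecting {a. cofw a}" and A: "unb A" and D: "clubset D"
  shows "\<exists>a\<in>D. cofw a \<and> otp (nacc (C a) \<inter> A) a = a"
proof (rule ccontr)
  assume neg: "\<not> ?thesis"
  define G where "G = {a\<in>D. cofw a \<and> (\<forall>x<a. \<exists>b\<in>C a \<inter> A. x < b \<and> \<not> limpt (C a) b)}"
  have "stat G" unfolding stat_def
  proof (intro allI impI)
    fix E assume "clubset E"
    from club_Int[OF D this] obtain a where "a \<in> D \<inter> E" "cofw a" "\<forall>x<a. \<exists>b\<in>C a \<inter> A. x < b \<and> \<not> limpt (C a) b"
      using H A unfolding hits_def by metis
    then have "a \<in> G \<inter> E" unfolding G_def by simp
    then show "G \<inter> E \<noteq> {}" by (metis empty_iff)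
  qed
  moreover have "otp (nacc (C a) \<inter> A) a < a" if "a \<in> G" for a
  proof -
    have "otp (nacc (C a) \<inter> A) a \<noteq> a" using neg that unfolding G_def by auto
    then show ?thesis using otp_le[of "nacc (C a) \<inter> A" a] by (simp add: less_le)
  qed
  ultimately obtain eps where "stat {a\<in>G. otp (nacc (C a) \<inter> A) a = eps}" using fodor[of G "\<lambda>a. otp (nacc (C a) \<inter> A) a"] by auto
  define S where "S = {a\<in>G. otp (nacc (C a) \<inter> A) a = eps}"
  have "stat S" unfolding S_def by fact
  moreover have "S \<subseteq> {a. cofw a}" unfolding S_def G_def by auto
  ultimately obtain g where g: "ucof g" "\<And>D. D \<subseteq> {..<g} \<Longrightarrow> limpt D g \<Longrightarrow> \<forall>b<g. limpt D b \<longrightarrow> b \<in> D \<Longrightarrow> S \<inter> D \<noteq> {}"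
    using R unfolding reflecting_def by meson
  have gl: "limpt UNIV g" using g(1) unfolding ucof_def by simp
  note cg = coh_seqD[OF C gl]
  have lim1: "limpt {b. limpt (C g) b} g" by (rule ucof_acc[OF g(1) cg(2)])
  have club: "\<exists>a\<in>S. x < a \<and> a < g \<and> limpt (C g) a" if x: "x < g" for x
  proof -
    let ?D = "{b. limpt (C g) b} \<inter> {..<g} \<inter> {x<..}"
    have "S \<inter> ?D \<noteq> {}"
    proof (rule g(2))
      show "?D \<subseteq> {..<g}" by auto
      show "limpt ?D g"
      proof (rule limptI[OF x])
        fix y assume "y < g"
        then have "max x y < g" using x by simp
        from limptD[OF lim1 this] show "\<exists>z\<in>?D. y < z \<and> z < g" by auto
      qed
      show "\<forall>b<g. limpt ?D b \<longrightarrow> b \<in> ?D"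
      proof (intro allI impI)
        fix b assume b: "b < g" "limpt ?D b"
        obtain y where y: "y \<in> ?D" "y < b" using limpt_ex[OF b(2)] ..
        have "limpt (C g) b"
        proof (rule limptI[OF y(2)])
          fix z assume "z < b"
          from limptD[OF b(2) this] obtain d where d: "limpt (C g) d" "z < d" "d < b" by auto
          from limptD[OF d(1,2)] show "\<exists>y\<in>C g. z < y \<and> y < b" using d(3) less_trans by meson
        qed
        then show "b \<in> ?D" using b(1) y by (auto intro: less_trans)
      qed
    qed
    then show ?thesis by auto
  qed
  have "\<exists>x. x < g" using gl unfolding limpt_def by simp
  then obtain x0 where "x0 < g" ..
  from club[OF this] obtain a where a: "a \<in> S" "a < g" "limpt (C g) a" by auto
  from club[OF a(2)] obtain a' where a': "a' \<in> S" "a < a'" "a' < g" "limpt (C g) a'" by auto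
  have Ca: "C a = C g \<inter> {..<a}" by (rule cg(4)[OF a(2,3)])
  have Ca': "C a' = C g \<inter> {..<a'}" by (rule cg(4)[OF a'(3,4)])
  let ?S = "nacc (C a') \<inter> A"
  have lims: "limpt (C a) y \<longleftrightarrow> limpt (C a') y" if "y < a" for y
    by (rule limpt_cong) (use that a'(2) in \<open>auto simp: Ca Ca' dest: less_trans\<close>)
  have "nacc (C a) \<inter> A \<inter> {..<a} = ?S \<inter> {..<a}"
    unfolding nacc_def using lims a'(2) by (auto simp: Ca Ca' dest: less_trans)
  then have "otp (nacc (C a) \<inter> A) a = otp ?S a" by (rule otp_local)
  then have e1: "otp ?S a = eps" using a(1) unfolding S_def by simp
  have e2: "otp ?S a' = eps" using a'(1) unfolding S_def by simp
  have "\<forall>x<a'. \<exists>b\<in>C a' \<inter> A. x < b \<and> \<not> limpt (C a') b" using a'(1) unfolding S_def G_def by simp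
  then obtain b where b: "b \<in> C a'" "b \<in> A" "a < b" "\<not> limpt (C a') b" using a'(2) by (metis IntD1 IntD2)
  have "b < a'" using b(1) unfolding Ca' by simp
  then have "otp ?S b < otp ?S a'" using b unfolding nacc_def by (intro otp_less) auto
  moreover have "otp ?S a \<le> otp ?S b" by (rule otp_mono) (use b(3) in simp)
  ultimately show False using e1 e2 by simp
qed

text \<open>Pairing the code with an arbitrary second coordinate gives each node kappa many indices,
  hence unboundedly many.\<close>

lemma node_enum:
  fixes code :: "('a \<rightharpoonup> 'a) \<Rightarrow> 'a"
  assumes code: "\<And>s t :: 'a \<rightharpoonup> 'a. small Lm (dom s) \<Longrightarrow> small Lm (dom t) \<Longrightarrow> code s = code t \<Longrightarrow> s = t"
  shows "\<exists>hn :: 'a \<Rightarrow> ('a \<rightharpoonup> 'a). \<forall>x e0. small Lm (dom x) \<longrightarrow> (\<exists>e>e0. hn e = x)"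
proof -
  have "|UNIV \<times> UNIV :: ('a \<times> 'a) set| \<le>o |UNIV :: 'a set|" by (intro UNIV_Times UNIV_le_UNIV)
  then obtain p :: "'a \<times> 'a \<Rightarrow> 'a" where p: "inj p" by (auto simp: card_of_ordLeq[symmetric])
  define hn where "hn e = (SOME x. small Lm (dom x) \<and> code x = fst (inv p e))" for e
  have hn: "hn (p (code x, y)) = x" if "small Lm (dom x)" for x y
  proof -
    have "fst (inv p (p (code x, y))) = code x" using p by simp
    then show ?thesis unfolding hn_def using that code by (intro some_equality) auto
  qed
  have "\<exists>e>e0. hn e = x" if x: "small Lm (dom x)" for x e0
  proof -
    have "inj (\<lambda>y. p (code x, y))" by (rule injI) (drule injD[OF p], simp)
    then have le: "|UNIV :: 'a set| \<le>o |range (\<lambda>y. p (code x, y))|" by (rule card_of_ordLeqI) simp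
    have "\<not> small Lm (range (\<lambda>y. p (code x, y)))" using not_small_UNIV ordLeq_transitive[OF le] by (rule contrapos_nn)
    from not_small_unb[OF this] obtain y where "e0 < p (code x, y)" unfolding unb_def by auto
    then show ?thesis using hn[OF x] by auto
  qed
  then show ?thesis by (intro exI[of _ hn]) simp
qed

lemma unif_coherent_souslin_tree_exists:
  assumes C: "coh_seq C" and H: "hits C" and R: "reflecting {a. cofw a}"
  shows "\<exists>T :: ('a \<rightharpoonup> 'a) set. unif_coherent ord_rel T \<and> souslin_tree ord_rel T map_lt"
proof -
  obtain code :: "('a \<rightharpoonup> 'a) \<Rightarrow> 'a" where "\<forall>s t. small Lm (dom s) \<longrightarrow> small Lm (dom t) \<longrightarrow> code s = code t \<longrightarrow> s = t"
    using node_code ..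
  then have code: "small Lm (dom s) \<Longrightarrow> small Lm (dom t) \<Longrightarrow> code s = code t \<Longrightarrow> s = t" for s t by simp
  have "\<exists>hn :: 'a \<Rightarrow> ('a \<rightharpoonup> 'a). \<forall>x e0. small Lm (dom x) \<longrightarrow> (\<exists>e>e0. hn e = x)"
    by (rule node_enum) (rule code)
  then obtain hn :: "'a \<Rightarrow> ('a \<rightharpoonup> 'a)" where hn: "\<forall>x e0. small Lm (dom x) \<longrightarrow> (\<exists>e>e0. hn e = x)" ..
  obtain Z :: "'a \<Rightarrow> 'a set" where "\<forall>W D. clubset D \<longrightarrow> (\<exists>a\<in>D. cofw a \<and> Z a = W \<inter> {..<a})"
    using diamond ..
  then have Z: "clubset D \<Longrightarrow> \<exists>a\<in>D. cofw a \<and> Z a = W \<inter> {..<a}" for W D by simp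
  obtain v1 :: 'a where v1: "bt < v1" using no_max ..
  \<comment> \<open>At a level \<open>b\<close> with a correct guess this recovers the earlier such
    levels, although only \<open>Z\<close> up to \<open>b\<close> and the levels below
    \<open>b\<close> are visible there.\<close>
  define Ah where "Ah = (\<lambda>L b. {g. g < b \<and> Z g = Z b \<inter> {..<g} \<and> good code Z L g})"
  \<comment> \<open>The order type of the points of \<open>Ah L b\<close> met so far selects the
    modification \<open>hn\<close> served at \<open>b\<close>, and it is the modified node that
    should lie above a guessed one.\<close>
  define Q where "Q = (\<lambda>L c b y. \<exists>z\<in>guessed code Z b. z \<subseteq>\<^sub>m y ++ hn (otp (nacc c \<inter> Ah L b) b))"
  have Q: "local_pref Q" unfolding local_pref_def
  proof (intro allI impI)
    fix L L' :: "'a \<Rightarrow> ('a \<rightharpoonup> 'a) set" and c b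
    assume LL: "\<forall>g<b. L g = L' g"
    have "good code Z L g = good code Z L' g" if "g < b" for g
      by (rule good_cong) (use LL that less_trans in metis)
    then have "Ah L b = Ah L' b" unfolding Ah_def by auto
    then show "Q L c b = Q L' c b" unfolding Q_def by simp
  qed
  \<comment> \<open>Level \<open>a\<close> has one branch through \<open>C a\<close>, overwritten by
    lower nodes \<open>x\<close>; \<open>xi\<close> acts only through the choice of
    \<open>x\<close>.\<close>
  define B where "B = (\<lambda>P a (xi :: 'a) x. branch Q P (C a) Map.empty ++ x)"
  have B_local: "B P a xi x = B P' a xi x" if "limpt UNIV a" "\<And>b. b < a \<Longrightarrow> P b = P' b" for P P' a xi x
  proof -
    have "branch Q P (C a) Map.empty = branch Q P' (C a) Map.empty"
      by (rule branch_local[OF Q _ that(2)]) (use coh_seqD(1)[OF C that(1)] in auto)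
    then show ?thesis unfolding B_def by simp
  qed
  define L where "L = levels B bt v1"
  define br where "br a = branch Q L (C a) Map.empty" for a
  define nd where "nd a = node Q L (C a) Map.empty" for a
  have BL: "B L a xi x = br a ++ x" for a xi x unfolding B_def br_def ..
  have Llim: "L a = {br a ++ x | xi x. xi < a \<and> x \<in> L xi}" if "limpt UNIV a" for a
  proof -
    have "L a = {B L a xi x | xi x. xi < a \<and> x \<in> L xi}" unfolding L_def by (rule levels_lim[OF B_local that])
    then show ?thesis unfolding BL .
  qed
  have L0: "L bt = {Map.empty}" unfolding L_def by (rule levels_zero[of B, OF B_local])
  have nodes: "(\<forall>b\<in>C a. nd a b \<in> L b \<and> nd a b \<subseteq>\<^sub>m br a) \<and>
    Map.empty \<subseteq>\<^sub>m br a \<and> dom (br a) = {..<a} \<and>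
    (\<forall>b\<in>C a. \<forall>g\<in>C a. g < b \<longrightarrow> \<not> limpt (C a) b \<longrightarrow>
       (\<exists>e\<in>C a. g \<le> e \<and> e < b \<and> nd a e \<in> L e \<and>
         ((\<exists>y\<in>L b. nd a e \<subseteq>\<^sub>m y \<and> Q L (C a \<inter> {..<b}) b y) \<longrightarrow> Q L (C a \<inter> {..<b}) b (nd a b))))"
    if a: "limpt UNIV a" and inv: "\<And>b. b < a \<Longrightarrow> tree_inv B bt v1 b" for a
    unfolding br_def nd_def
  proof (rule branch_nodes[OF Q])
    note ca = coh_seqD[OF C a]
    show "C a \<subseteq> {..<a}" using ca(1) by auto
    show "limpt (C a) a" by (rule ca(2))
    show "bt \<le> g" for g by simp
    show "Map.empty \<in> L bt" using L0 by simp
    show "dom s = {..<b}" if "b < a" "s \<in> L b" for b s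
      by (rule tree_invD(1)[OF inv[OF that(1)] that(2)[unfolded L_def]])
    show "\<exists>y\<in>L b. u \<subseteq>\<^sub>m y" if "b < a" "e < b" "u \<in> L e" for b e u
      using tree_invD(3)[OF inv[OF that(1)] that(2) that(3)[unfolded L_def]] unfolding L_def .
    fix b assume b: "b < a" "limpt (C a) b"
    have bl: "limpt UNIV b" by (rule limpt_mono[OF b(2)]) simp
    then have "bt < b" unfolding limpt_def by (metis bt_le le_less_trans)
    then have "br b ++ Map.empty \<in> L b" unfolding Llim[OF bl] using L0 by blast
    then show "b \<in> C a \<and> branch Q L (C a \<inter> {..<b}) Map.empty \<in> L b"
      using ca(3,4)[OF b] unfolding br_def by simp
  qed
  \<comment> \<open>This closure is proved together with \<open>tree_inv\<close>: the restriction of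
    \<open>br a ++ x\<close> to \<open>b\<close> is \<open>nd a b ++ x\<close>, which is in the tree
    only by \<open>star b\<close>.\<close>
  define star where "star a \<longleftrightarrow> (\<forall>g\<le>a. \<forall>s\<in>L g. \<forall>t\<in>L a. t ++ s \<in> L a)" for a
  have starD: "t ++ s \<in> L a" if "star a" "g \<le> a" "s \<in> L g" "t \<in> L a" for a g s t
    using that unfolding star_def by simp
  have restrict_br: "(br a ++ x) |` {..<b} = nd a b ++ x" "nd a b ++ x \<subseteq>\<^sub>m br a ++ x"
    if "b \<in> C a" "dom x \<subseteq> {..<b}" "dom (nd a b) = {..<b}" "nd a b \<subseteq>\<^sub>m br a" for a b x
  proof -
    show le: "nd a b ++ x \<subseteq>\<^sub>m br a ++ x" by (rule map_add_le_mono[OF that(4)])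
    have "dom (nd a b ++ x) = {..<b}" using that(2,3) by auto
    then show "(br a ++ x) |` {..<b} = nd a b ++ x" using map_le_restrict[OF le] by simp
  qed
  have all: "tree_inv B bt v1 a \<and> star a" for a
  proof (rule tree_inv_all[of B, OF B_local])
    fix a xi x assume a: "limpt UNIV a" "\<And>b. b < a \<Longrightarrow> tree_inv B bt v1 b \<and> star b" "xi < a" "x \<in> levels B bt v1 xi"
    note n = nodes[OF a(1) a(2)[THEN conjunct1]]
    have dx: "dom x = {..<xi}" by (rule tree_invD(1)[OF a(2)[OF a(3), THEN conjunct1] a(4)])
    have "\<exists>b. g < b \<and> b < a \<and> B L a xi x |` {..<b} \<in> L b" if ga: "g < a" for g
    proof -
      have "max g xi < a" using ga a(3) by simp
      from limptD[OF coh_seqD(2)[OF C a(1)] this] obtain b where b: "b \<in> C a" "max g xi < b" "b < a" by auto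
      have nb: "nd a b \<in> L b" "nd a b \<subseteq>\<^sub>m br a" using n b(1) by simp_all
      have "dom (nd a b) = {..<b}" by (rule tree_invD(1)[OF a(2)[OF b(3), THEN conjunct1] nb(1)[unfolded L_def]])
      moreover have "dom x \<subseteq> {..<b}" unfolding dx using b(2) by auto
      ultimately have "B L a xi x |` {..<b} = nd a b ++ x" unfolding BL using restrict_br(1)[OF b(1) _ _ nb(2)] by simp
      moreover have "nd a b ++ x \<in> L b"
        by (rule starD[OF a(2)[OF b(3), THEN conjunct2] _ a(4)[folded L_def] nb(1)]) (use b(2) in \<open>simp add: less_imp_le\<close>)
      ultimately show ?thesis using b by (intro exI[of _ b]) simp
    qed
    moreover have "dom (B L a xi x) = {..<a}" unfolding BL using n dx a(3) by auto
    moreover have "x \<subseteq>\<^sub>m B L a xi x" unfolding BL by (rule map_le_map_add)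
    ultimately show "dom (B (levels B bt v1) a xi x) = {..<a} \<and> x \<subseteq>\<^sub>m B (levels B bt v1) a xi x \<and>
      (\<forall>g<a. \<exists>b. g < b \<and> b < a \<and> B (levels B bt v1) a xi x |` {..<b} \<in> levels B bt v1 b)"
      unfolding L_def[symmetric] by simp
  next
    fix a assume a: "\<And>b. b < a \<Longrightarrow> tree_inv B bt v1 b \<and> star b" "tree_inv B bt v1 a"
    have dom: "dom s = {..<b}" if "b \<le> a" "s \<in> L b" for b s
    proof (cases "b = a")
      case True then show ?thesis using tree_invD(1)[OF a(2)] that(2) unfolding L_def by simp
    next
      case False
      then have "b < a" using that(1) by simp
      from tree_invD(1)[OF a(1)[OF this, THEN conjunct1]] show ?thesis using that(2) unfolding L_def by simp
    qed
    show "star a" unfolding star_def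
    proof (intro allI impI ballI)
      fix g s t assume g: "g \<le> a" and s: "s \<in> L g" and t: "t \<in> L a"
      show "t ++ s \<in> L a"
      proof (cases "g = a")
        case True
        then have "t ++ s = s" using dom[OF order_refl t] dom[OF g s] by (intro map_add_absorb) simp
        then show ?thesis using s True by simp
      next
        case False
        then have ga: "g < a" using g by simp
        show ?thesis
        proof (cases a rule: cases_limit)
          case zero then show ?thesis using ga by simp
        next
          case (succ d)
          have e: "L a = {s(d \<mapsto> v) | s v. s \<in> L d \<and> v \<in> {bt, v1}}"
            using levels_succ[where B = B, OF B_local succ(5,4)] unfolding L_def succ(3) by simp
          then obtain t' v where t': "t = t'(d \<mapsto> v)" "t' \<in> L d" "v \<in> {bt, v1}" using t by auto
          have gd: "g \<le> d" using succ(2) ga by simp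
          have "d \<notin> dom s" using dom[OF g s] gd by simp
          then have "t ++ s = (t' ++ s)(d \<mapsto> v)" unfolding t'(1) by (rule map_add_upd_left)
          moreover have "t' ++ s \<in> L d" by (rule starD[OF a(1)[OF succ(1), THEN conjunct2] gd s t'(2)])
          ultimately show ?thesis unfolding e using t'(3) by blast
        next
          case lim
          obtain xi x where x: "t = br a ++ x" "xi < a" "x \<in> L xi" using t unfolding Llim[OF lim(1)] by auto
          \<comment> \<open>Overwriting is associative, so it remains to place \<open>x ++ s\<close>
            in a level below \<open>a\<close>: that of the longer of the two.\<close>
          have e: "t ++ s = br a ++ (x ++ s)" unfolding x(1) by simp
          show ?thesis
          proof (cases "xi \<le> g")
            case True
            have "dom x \<subseteq> dom s" using dom[OF g s] dom[OF less_imp_le[OF x(2)] x(3)] True by auto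
            then have "x ++ s = s" by (rule map_add_absorb)
            then show ?thesis unfolding e Llim[OF lim(1)] using ga s by auto
          next
            case False
            have "x ++ s \<in> L xi" by (rule starD[OF a(1)[OF x(2), THEN conjunct2] _ s x(3)]) (use False in \<open>simp add: less_imp_le not_le\<close>)
            then show ?thesis unfolding e Llim[OF lim(1)] using x(2) by blast
          qed
        qed
      qed
    qed
  qed
  then have inv: "tree_inv B bt v1 a" and st: "star a" for a by simp_all
  note D = tree_invD[OF inv, folded L_def]
  have smL: "small Lm (L a)" for a unfolding L_def by (rule small_levels[of B, OF B_local])
  have le_level: "d \<le> b" if "z \<in> L d" "dom z \<subseteq> {..<b}" for z d b
  proof (rule ccontr)
    assume "\<not> d \<le> b"
    then have "b \<in> dom z" using D(1)[OF that(1)] by simp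
    then show False using that(2) by auto
  qed
  have sou: "souslin_tree ord_rel (\<Union>a. levels B bt v1 a) map_lt"
  proof (rule souslin_from_levels[of B, OF B_local inv])
    show "bt \<noteq> v1" using v1 by (metis less_irrefl)
    fix P assume P: "P \<subseteq> (\<Union>a. levels B bt v1 a)" "\<forall>s\<in>\<Union>a. levels B bt v1 a. \<exists>z\<in>P. s \<subseteq>\<^sub>m z \<or> z \<subseteq>\<^sub>m s"
    define A where "A = {b. Z b = code ` P \<inter> {..<b} \<and> good code Z L b}"
    have A: "unb A" unfolding A_def
      by (rule unb_good[where code = code and Z = Z and L = L and P = P, OF code Z D(1) smL P[folded L_def]])
    have "\<forall>x. \<exists>nx. small Lm (dom x) \<longrightarrow> (\<forall>e0. e0 < nx e0 \<and> hn (nx e0) = x)"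
    proof
      fix x
      have "\<forall>e0. \<exists>e. small Lm (dom x) \<longrightarrow> e0 < e \<and> hn e = x" using hn by metis
      from choice[OF this] show "\<exists>nx. small Lm (dom x) \<longrightarrow> (\<forall>e0. e0 < nx e0 \<and> hn (nx e0) = x)" by auto
    qed
    from choice[OF this] obtain nx where nx0: "\<forall>x. small Lm (dom x) \<longrightarrow> (\<forall>e0. e0 < nx x e0 \<and> hn (nx x e0) = x)" ..
    have nx: "e0 < nx x e0" "hn (nx x e0) = x" if "x \<in> L a" for x a e0
      using nx0[THEN spec, of x] D(1)[OF that] small_seg by simp_all
    have "\<exists>h. \<forall>e. \<forall>y\<in>(\<lambda>x. nx x e) ` (\<Union>xi\<in>{..e}. L xi). y < h e"
      by (rule bnd_fun) (intro small_image small_UN small_atMost smL)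
    then obtain h where h0: "\<forall>e. \<forall>y\<in>(\<lambda>x. nx x e) ` (\<Union>xi\<in>{..e}. L xi). y < h e" ..
    have h: "nx x e < h e" if "x \<in> L xi" "xi \<le> e" for x xi e
      by (rule h0[THEN spec, THEN bspec]) (use that in auto)
    \<comment> \<open>Closure under \<open>h\<close> gives each lower node an index below
      \<open>a\<close>, and order type \<open>a\<close> ensures that the clock reaches it.\<close>
    from long_hits[OF C H R A club_closure[of h]] obtain a where
      a: "cofw a" "otp (nacc (C a) \<inter> A) a = a" "\<And>x. x < a \<Longrightarrow> h x < a" by auto
    have al: "limpt UNIV a" by (rule cofw_limpt[OF a(1)])
    note ca = coh_seqD[OF C al]
    note n = nodes[OF al inv]
    have Pdom: "\<exists>a. dom z = {..<a}" if "z \<in> P" for z using P(1) that D(1) unfolding L_def by blast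
    define S where "S = nacc (C a) \<inter> A"
    have "\<exists>b<a. \<exists>z\<in>P \<inter> L b. z \<subseteq>\<^sub>m s" if sa: "s \<in> L a" for s
    proof -
      obtain xi x where s: "s = br a ++ x" "xi < a" "x \<in> L xi" using sa unfolding Llim[OF al] by auto
      obtain g where g: "g \<in> C a" "xi < g" "g < a" using limptD[OF ca(2) s(2)] by auto
      \<comment> \<open>The clock shows \<open>e0\<close> at some \<open>b\<close>; as
        \<open>otp S b \<le> b\<close>, this \<open>b\<close> is above \<open>g\<close> and hence
        past the domain of \<open>x\<close>.\<close>
      define e0 where "e0 = nx x g"
      have e0: "g < e0" "hn e0 = x" unfolding e0_def using nx[OF s(3)] by simp_all
      have "e0 < h g" unfolding e0_def by (rule h[OF s(3)]) (use g(2) in \<open>simp add: less_imp_le\<close>)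
      then have "e0 < a" using a(3)[OF g(3)] by simp
      then have "e0 < otp S a" using a(2) unfolding S_def by simp
      then obtain b where b: "b \<in> S" "b < a" "otp S b = e0" using otp_surj by metis
      have gb: "g < b" using e0(1) otp_le[of S b] b(3) by simp
      have bC: "b \<in> C a" and nl: "\<not> limpt (C a) b" and bA: "b \<in> A" using b(1) unfolding S_def nacc_def by simp_all
      have Zb: "Z b = code ` P \<inter> {..<b}" and good: "good code Z L b" using bA unfolding A_def by simp_all
      have lims: "limpt (C a \<inter> {..<b}) y \<longleftrightarrow> limpt (C a) y" if "y < b" for y
        by (rule limpt_cong) (use that in \<open>auto dest: less_trans\<close>)
      have ZZ: "Z y = Z b \<inter> {..<y} \<longleftrightarrow> Z y = code ` P \<inter> {..<y}" if "y < b" for y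
      proof -
        have "Z b \<inter> {..<y} = code ` P \<inter> {..<y}" unfolding Zb using that by (auto dest: less_trans)
        then show ?thesis by simp
      qed
      \<comment> \<open>Since the guess at \<open>b\<close> is correct, \<open>Ah L b\<close> agrees
        with \<open>A\<close> below \<open>b\<close>. The clock seen at \<open>b\<close> therefore
        shows \<open>e0\<close>, and \<open>x\<close> is served.\<close>
      have "nacc (C a \<inter> {..<b}) \<inter> Ah L b \<inter> {..<b} = S \<inter> {..<b}"
        unfolding S_def nacc_def Ah_def A_def using lims ZZ by auto
      then have "otp (nacc (C a \<inter> {..<b}) \<inter> Ah L b) b = otp S b" by (rule otp_local)
      then have att: "hn (otp (nacc (C a \<inter> {..<b}) \<inter> Ah L b) b) = x" using b(3) e0(2) by simp
      obtain e where e: "g \<le> e" "e < b" "nd a e \<in> L e"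
        "(\<exists>y\<in>L b. nd a e \<subseteq>\<^sub>m y \<and> Q L (C a \<inter> {..<b}) b y) \<longrightarrow> Q L (C a \<inter> {..<b}) b (nd a b)"
        using n[THEN conjunct2, THEN conjunct2, THEN conjunct2, THEN bspec, OF bC, THEN bspec, OF g(1), THEN mp, OF gb, THEN mp, OF nl] by auto
      have xe: "xi \<le> e" using g(2) e(1) by (simp add: less_imp_le less_le_trans)
      have ux: "nd a e ++ x \<in> L e" by (rule starD[OF st xe s(3) e(3)])
      obtain z d where z: "z \<in> guessed code Z b" "d < b" "z \<in> L d" "nd a e ++ x \<subseteq>\<^sub>m z \<or> z \<subseteq>\<^sub>m nd a e ++ x"
        using goodD[OF good e(2) ux] .
      have "\<exists>y\<in>L b. nd a e ++ x \<subseteq>\<^sub>m y \<and> z \<subseteq>\<^sub>m y"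
        using z(4) D(3)[OF z(2,3)] D(3)[OF e(2) ux] map_le_trans by metis
      then obtain y where y: "y \<in> L b" "nd a e ++ x \<subseteq>\<^sub>m y" "z \<subseteq>\<^sub>m y" by auto
      \<comment> \<open>Overwriting \<open>y\<close> by the node at \<open>e\<close> yields an
        extension of that node; its modification by \<open>x\<close> is \<open>y\<close> again and
        lies above \<open>z\<close>.\<close>
      have "y ++ nd a e \<in> L b" by (rule starD[OF st less_imp_le[OF e(2)] e(3) y(1)])
      moreover have "nd a e \<subseteq>\<^sub>m y ++ nd a e" by (rule map_le_map_add)
      moreover have "Q L (C a \<inter> {..<b}) b (y ++ nd a e)"
        unfolding Q_def att map_add_restore[OF y(2)] by (rule bexI[of _ z]) (rule y(3), rule z(1))
      ultimately have "Q L (C a \<inter> {..<b}) b (nd a b)" using e(4) by blast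
      then obtain z' where z': "z' \<in> guessed code Z b" "z' \<subseteq>\<^sub>m nd a b ++ x" unfolding Q_def att by auto
      have nb: "nd a b \<in> L b" "nd a b \<subseteq>\<^sub>m br a" using n[THEN conjunct1, THEN bspec, OF bC] by simp_all
      have xb: "dom x \<subseteq> {..<b}" using D(1)[OF s(3)] g(2) gb by auto
      have "guessed code Z b = {z\<in>P. code z < b}"
        by (rule guessed_eq) (rule code, assumption+, rule Pdom, assumption, rule Zb)
      then have zP: "z' \<in> P" using z'(1) by simp
      then obtain d' where d': "z' \<in> L d'" using P(1) unfolding L_def by auto
      have "dom (nd a b ++ x) = {..<b}" using D(1)[OF nb(1)] xb by (simp add: Un_absorb2 Un_absorb1)
      then have "dom z' \<subseteq> {..<b}" using map_le_implies_dom_le[OF z'(2)] by simp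
      from le_level[OF d' this] have "d' < a" using b(2) by simp
      moreover have "z' \<subseteq>\<^sub>m s" unfolding s(1) by (rule map_le_trans[OF z'(2) restrict_br(2)[OF bC xb D(1)[OF nb(1)] nb(2)]])
      ultimately show ?thesis using zP d' by (intro exI[of _ d'] conjI bexI[of _ z']) simp_all
    qed
    then have "\<forall>s\<in>L a. \<exists>b<a. \<exists>z\<in>P \<inter> L b. z \<subseteq>\<^sub>m s" by (rule ballI)
    then show "\<exists>a. \<forall>s\<in>levels B bt v1 a. \<exists>b<a. \<exists>z\<in>P \<inter> levels B bt v1 b. z \<subseteq>\<^sub>m s"
      unfolding L_def[symmetric] by (rule exI)
  qed
  \<comment> \<open>At a limit level two nodes agree with \<open>br a\<close> beyond the domains of
    their modifying nodes; below, the induction hypothesis applies to their restrictions.\<close>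
  have fin: "\<forall>s\<in>L a. \<forall>t\<in>L a. finite {y. s y \<noteq> t y}" for a
  proof (induct a rule: less_induct)
    case (less a)
    show ?case
    proof (intro ballI)
      fix s t assume s: "s \<in> L a" and t: "t \<in> L a"
      show "finite {y. s y \<noteq> t y}"
      proof (cases a rule: cases_limit)
        case zero
        have "L a = {Map.empty}" using zero(1) L0 by simp
        then show ?thesis using s t by simp
      next
        case (succ d)
        have e: "L a = {s(d \<mapsto> v) | s v. s \<in> L d \<and> v \<in> {bt, v1}}"
          using levels_succ[where B = B, OF B_local succ(5,4)] unfolding L_def succ(3) by simp
        obtain s' v where s': "s = s'(d \<mapsto> v)" "s' \<in> L d" using s unfolding e by auto
        obtain t' w where t': "t = t'(d \<mapsto> w)" "t' \<in> L d" using t unfolding e by auto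
        have "{y. s y \<noteq> t y} \<subseteq> insert d {y. s' y \<noteq> t' y}" unfolding s' t' by auto
        moreover have "finite {y. s' y \<noteq> t' y}" using less(1)[OF succ(1)] s'(2) t'(2) by simp
        ultimately show ?thesis by (meson finite_insert finite_subset)
      next
        case lim
        obtain xi x where x: "s = br a ++ x" "xi < a" "x \<in> L xi" using s unfolding Llim[OF lim(1)] by auto
        obtain xi' x' where x': "t = br a ++ x'" "xi' < a" "x' \<in> L xi'" using t unfolding Llim[OF lim(1)] by auto
        define m where "m = max xi xi'"
        have m: "m < a" unfolding m_def using x(2) x'(2) by simp
        have "s |` {..<m} \<in> L m" "t |` {..<m} \<in> L m" using D(2)[OF s m] D(2)[OF t m] by simp_all
        then have "finite {y. (s |` {..<m}) y \<noteq> (t |` {..<m}) y}" using less(1)[OF m] by simp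
        moreover have "{y. s y \<noteq> t y} \<subseteq> {y. (s |` {..<m}) y \<noteq> (t |` {..<m}) y}"
        proof
          fix y assume y: "y \<in> {y. s y \<noteq> t y}"
          have "y < m"
          proof (rule ccontr)
            assume "\<not> y < m"
            then have "y \<notin> dom x" "y \<notin> dom x'" using D(1)[OF x(3)] D(1)[OF x'(3)] unfolding m_def by (auto simp: less_max_iff_disj)
            then have "s y = t y" unfolding x(1) x'(1) by (simp add: map_add_dom_app_simps(3))
            then show False using y by simp
          qed
          then show "y \<in> {y. (s |` {..<m}) y \<noteq> (t |` {..<m}) y}" using y by simp
        qed
        ultimately show ?thesis by (rule finite_subset[rotated])
      qed
    qed
  qed
  define T where "T = (\<Union>a. L a)"
  have LT: "s \<in> T" if "s \<in> L a" for s a using that unfolding T_def by (rule UN_I[OF UNIV_I])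
  have TL: "\<exists>a. s \<in> L a" if "s \<in> T" for s using that unfolding T_def by simp
  have fin2: "finite {y \<in> dom s \<inter> dom t. s y \<noteq> t y}" if s: "s \<in> L a" and t: "t \<in> L b" and ab: "a \<le> b" for s t a b
  proof (cases "a = b")
    case True
    then have "finite {y. s y \<noteq> t y}" using fin s t by simp
    then show ?thesis by (rule rev_finite_subset) auto
  next
    case False
    then have "a < b" using ab by simp
    from D(2)[OF t this] have "finite {y. s y \<noteq> (t |` {..<a}) y}" using fin s by simp
    moreover have "{y \<in> dom s \<inter> dom t. s y \<noteq> t y} \<subseteq> {y. s y \<noteq> (t |` {..<a}) y}"
      using D(1)[OF s] by auto
    ultimately show ?thesis by (rule finite_subset[rotated])
  qed
  have "unif_coherent ord_rel T" unfolding unif_coherent_def underS_ord_rel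
  proof (intro conjI ballI allI impI)
    fix s assume "s \<in> T"
    from TL[OF this] obtain a where s: "s \<in> L a" ..
    show "\<exists>a. dom s = {..<a}" using D(1)[OF s] by (rule exI)
    fix b assume "{..<b} \<subseteq> dom s"
    then have "b \<le> a" using D(1)[OF s] by (metis lessThan_iff less_irrefl not_le subsetD)
    show "s |` {..<b} \<in> T"
    proof (cases "b = a")
      case True
      then show ?thesis using map_le_restrict[OF map_le_refl[of s]] D(1)[OF s] LT[OF s] by simp
    next
      case False
      then have "b < a" using \<open>b \<le> a\<close> by simp
      from LT[OF D(2)[OF s this]] show ?thesis .
    qed
  next
    fix s t assume "s \<in> T" "t \<in> T"
    then obtain a b where s: "s \<in> L a" and t: "t \<in> L b" using TL by metis
    show "finite {\<xi> \<in> dom s \<inter> dom t. s \<xi> \<noteq> t \<xi>}"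
    proof (cases "a \<le> b")
      case True then show ?thesis by (rule fin2[OF s t])
    next
      case False
      then have "b \<le> a" by simp
      from fin2[OF t s this] show ?thesis by (rule rev_finite_subset) auto
    qed
    assume "dom s \<subseteq> dom t"
    then have "a \<le> b" using le_level[OF s, of b] D(1)[OF t] by simp
    from starD[OF st this s t] have "t ++ s \<in> T" by (rule LT)
    moreover have "(t |` (dom t - dom s)) ++ s = t ++ s"
    proof
      fix k show "((t |` (dom t - dom s)) ++ s) k = (t ++ s) k"
        by (cases "s k"; cases "t k") (auto simp: map_add_def restrict_map_def)
    qed
    ultimately show "(t |` (dom t - dom s)) ++ s \<in> T" by simp
  qed
  then show ?thesis using sou unfolding T_def L_def by (intro exI[of _ "\<Union>a. levels B bt v1 a"] conjI)
qed

end

section \<open>The notions of the theorem\<close>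

text \<open>The bound at \<open>m\<close> takes the maximum of the functions with index up to
  \<open>m\<close>. The lemma serves to exclude a countable lam.\<close>

lemma countable_family_dominated:
  assumes "countable F" shows "\<not> unbounded_family F"
proof (cases "F = {}")
  case True then show ?thesis unfolding unbounded_family_def by simp
next
  case False
  define f where "f = from_nat_into F"
  have r: "range f = F" unfolding f_def using range_from_nat_into[OF False assms] .
  define g where "g m = Max ((\<lambda>i. f i m) ` {..m})" for m
  have "dominated_by (f i) g" for i
    unfolding dominated_by_def
  proof (intro exI[of _ i] allI impI)
    fix m assume "i \<le> m"
    then show "f i m \<le> g m" unfolding g_def by (intro Max_ge) auto
  qed
  then have "\<forall>h\<in>F. dominated_by h g" unfolding r[symmetric] by blast
  then show ?thesis unfolding unbounded_family_def by blast
qed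

context wellorder
begin

lemma lim_pts_ord_rel: "b \<in> lim_pts ord_rel X \<longleftrightarrow> limpt X b"
proof -
  have "is_sup ord_rel (X \<inter> {..<b}) b \<longleftrightarrow> (\<forall>d<b. \<exists>x\<in>X. d < x \<and> x < b)"
  proof
    assume s: "is_sup ord_rel (X \<inter> {..<b}) b"
    show "\<forall>d<b. \<exists>x\<in>X. d < x \<and> x < b"
    proof (intro allI impI)
      fix d assume "d < b"
      have "(\<forall>x\<in>X \<inter> {..<b}. x \<le> d) \<longrightarrow> b \<le> d" using s unfolding is_sup_def by simp
      then have "\<not> (\<forall>x\<in>X \<inter> {..<b}. x \<le> d)" using \<open>d < b\<close> by (metis not_le)
      then obtain x where "x \<in> X" "x < b" "d < x" by (auto simp: not_le)
      then show "\<exists>x\<in>X. d < x \<and> x < b" by auto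
    qed
  next
    assume s: "\<forall>d<b. \<exists>x\<in>X. d < x \<and> x < b"
    have "b \<le> d" if d: "\<forall>x\<in>X \<inter> {..<b}. x \<le> d" for d
    proof (rule ccontr)
      assume "\<not> b \<le> d"
      then have "d < b" by simp
      then obtain x where x: "x \<in> X" "d < x" "x < b" using s by auto
      then have "x \<in> X \<inter> {..<b}" by simp
      from d[THEN bspec, OF this] show False using x(2) by simp
    qed
    then show "is_sup ord_rel (X \<inter> {..<b}) b" unfolding is_sup_def by (auto simp: less_imp_le)
  qed
  moreover have "\<not> ozero ord_rel b \<longleftrightarrow> (\<exists>x. x < b)" unfolding ozero_def by (auto simp: not_le)
  ultimately show ?thesis unfolding lim_pts_def limpt_def underS_ord_rel by simp
qed

lemma club_ord_rel: "clubset D \<Longrightarrow> club ord_rel D"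
  unfolding club_def clubset_def unb_def by (auto simp: lim_pts_ord_rel) (meson less_imp_le)

text \<open>\<open>club\<close> asks only for weakly larger members; without a greatest point this
  gives strictly larger ones.\<close>

lemma clubset_ord_rel:
  assumes nm: "\<And>x. \<exists>y. x < y" and D: "club ord_rel D"
  shows "clubset D"
  unfolding clubset_def unb_def
proof (intro conjI allI impI)
  fix x
  obtain y where "x < y" using nm ..
  moreover obtain z where "z \<in> D" "y \<le> z" using D unfolding club_def by auto
  ultimately show "\<exists>y\<in>D. x < y" by (meson less_le_trans)
next
  fix b assume "limpt D b"
  then show "b \<in> D" using D lim_pts_ord_rel[of b D] unfolding club_def by blast
qed

lemma square_ord_rel:
  assumes "square ord_rel"
  shows "\<exists>C. coh_seq C \<and> (\<forall>D. clubset D \<longrightarrow> (\<exists>a. limpt D a \<and> D \<inter> {..<a} \<noteq> C a))"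
proof -
  obtain C where C: "C_sequence ord_rel C" "coherent ord_rel C"
    "\<not> (\<exists>D. club ord_rel D \<and> (\<forall>a\<in>acc ord_rel D. D \<inter> underS ord_rel a = C a))"
    using assms unfolding square_def by blast
  have "coh_seq C" unfolding coh_seq_def
  proof (intro allI impI conjI)
    fix a assume a: "limpt UNIV a"
    have cl: "closed_in_ord ord_rel a (C a)" and su: "is_sup ord_rel (C a) a \<longleftrightarrow> is_sup ord_rel (underS ord_rel a) a"
      using C(1) unfolding C_sequence_def by blast+
    show sub: "C a \<subseteq> {..<a}" using cl unfolding closed_in_ord_def underS_ord_rel by simp
    have "a \<in> lim_pts ord_rel UNIV" using a by (simp add: lim_pts_ord_rel)
    then have nz: "\<not> ozero ord_rel a" "is_sup ord_rel (underS ord_rel a) a" unfolding lim_pts_def by simp_all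
    have "C a \<inter> underS ord_rel a = C a" using sub unfolding underS_ord_rel by auto
    then have "a \<in> lim_pts ord_rel (C a)" using nz su unfolding lim_pts_def by simp
    then show "limpt (C a) a" by (simp add: lim_pts_ord_rel)
    fix b assume b: "b < a" "limpt (C a) b"
    then have "b \<in> lim_pts ord_rel (C a) \<inter> underS ord_rel a" by (simp add: lim_pts_ord_rel underS_ord_rel)
    then show bC: "b \<in> C a" using cl unfolding closed_in_ord_def by blast
    then have "b \<in> acc ord_rel (C a)" using b(2) unfolding acc_def by (simp add: lim_pts_ord_rel)
    then show "C b = C a \<inter> {..<b}" using C(2) unfolding coherent_def underS_ord_rel by blast
  qed
  moreover have "\<exists>a. limpt D a \<and> D \<inter> {..<a} \<noteq> C a" if D: "clubset D" for D
  proof -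
    obtain a where "a \<in> acc ord_rel D" "D \<inter> {..<a} \<noteq> C a"
      using C(3) club_ord_rel[OF D] unfolding underS_ord_rel by blast
    then show ?thesis unfolding acc_def by (auto simp: lim_pts_ord_rel)
  qed
  ultimately show ?thesis by (intro exI[of _ C]) simp
qed

lemma cf_omega_ord_rel: assumes "cofw a" shows "cf_omega ord_rel a"
proof -
  note al = cofw_limpt[OF assms]
  have "\<forall>x<a. \<exists>y. x < y \<and> y < a \<and> True" using limptD[OF al] by auto
  from cofw_seq[OF assms this] obtain g :: "nat \<Rightarrow> 'a" where
    g0: "(\<forall>i. g i < a \<and> True) \<and> (\<forall>i j. i < j \<longrightarrow> g i < g j) \<and> (\<forall>x<a. \<exists>i. x < g i)" ..
  then have g: "\<And>i. g i < a" "\<And>i j. i < j \<Longrightarrow> g i < g j" "\<And>x. x < a \<Longrightarrow> \<exists>i. x < g i" by auto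
  have "inj g"
  proof (rule injI)
    fix i j assume "g i = g j"
    then show "i = j" using g(2)[of i j] g(2)[of j i] nat_neq_iff[of i j] by auto
  qed
  then have "bij_betw g UNIV (range g)" unfolding bij_betw_def by simp
  then have "|UNIV :: nat set| =o |range g|" using card_of_ordIso by blast
  then have "|range g| =o |UNIV :: nat set|" by (rule ordIso_symmetric)
  moreover have "cofinal_in ord_rel a (range g)" unfolding cofinal_in_def underS_ord_rel
  proof (intro conjI ballI)
    show "range g \<subseteq> {..<a}" using g(1) by auto
    fix x assume "x \<in> {..<a}"
    then obtain i where "x < g i" using g(3) by auto
    then show "\<exists>y\<in>range g. (x, y) \<in> ord_rel" by (intro bexI[of _ "g i"]) (simp_all add: less_imp_le)
  qed
  moreover have "infinite X" if X: "cofinal_in ord_rel a X" for X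
  proof
    assume fin: "finite X"
    have sub: "X \<subseteq> {..<a}" and cf: "\<And>x. x < a \<Longrightarrow> \<exists>y\<in>X. x \<le> y"
      using X unfolding cofinal_in_def underS_ord_rel by auto
    have "X \<noteq> {}" using cf[OF g(1)] by auto
    then have M: "Max X \<in> X" using fin by simp
    then have "Max X < a" using sub by auto
    then obtain y where y: "Max X < y" "y < a" using limptD[OF al] by auto
    obtain z where z: "z \<in> X" "y \<le> z" using cf[OF y(2)] by auto
    have "z \<le> Max X" using fin z(1) by (rule Max_ge)
    then show False using y(1) z(2) by simp
  qed
  ultimately show ?thesis unfolding cf_omega_def by blast
qed

lemma ucof_ord_rel: assumes "cf_uncountable ord_rel a" shows "ucof a"
proof -
  have nc: "\<not> cofinal_in ord_rel a X" if "countable X" for X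
    using assms that unfolding cf_uncountable_def by blast
  have bd: "\<exists>b<a. \<forall>i. f i < b" if f: "\<forall>i::nat. f i < a" for f
  proof -
    have "\<not> cofinal_in ord_rel a (range f)" by (rule nc) simp
    moreover have "range f \<subseteq> {..<a}" using f by auto
    ultimately obtain x where "x < a" "\<forall>i. \<not> x \<le> f i" unfolding cofinal_in_def underS_ord_rel by auto
    then show ?thesis by (intro exI[of _ x]) (simp add: not_le)
  qed
  have "\<not> cofinal_in ord_rel a {}" by (rule nc) simp
  then obtain x0 where x0: "x0 < a" unfolding cofinal_in_def underS_ord_rel by auto
  have "limpt UNIV a"
  proof (rule limptI[OF x0])
    fix x assume "x < a"
    then obtain b where "b < a" "x < b" using bd[of "\<lambda>_. x"] by auto
    then show "\<exists>y\<in>UNIV. x < y \<and> y < a" by auto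
  qed
  then show ?thesis unfolding ucof_def using bd by simp
qed

lemma reflecting_ord_rel:
  assumes nm: "\<And>x. \<exists>y. x < y" and R: "stat_refl ord_rel"
  shows "reflecting {a. cofw a}"
  unfolding reflecting_def
proof (intro allI impI)
  fix S assume S: "S \<subseteq> {a. cofw a}" "stat S"
  have "S \<subseteq> S_omega ord_rel" unfolding S_omega_def using S(1) cf_omega_ord_rel by auto
  moreover have "stationary ord_rel S" unfolding stationary_def
    using S(2) clubset_ord_rel[OF nm] unfolding stat_def by simp
  ultimately have "reflects ord_rel S" using R unfolding stat_refl_def by simp
  then obtain g where g: "cf_uncountable ord_rel g" "stationary_in ord_rel g (S \<inter> underS ord_rel g)"
    unfolding reflects_def by auto
  have "S \<inter> D \<noteq> {}" if D: "D \<subseteq> {..<g}" "limpt D g" "\<forall>b<g. limpt D b \<longrightarrow> b \<in> D" for D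
  proof -
    have "club_in ord_rel g D" unfolding club_in_def closed_in_ord_def cofinal_in_def underS_ord_rel
    proof (intro conjI ballI D(1))
      show "lim_pts ord_rel D \<inter> {..<g} \<subseteq> D" using D(3) by (auto simp: lim_pts_ord_rel)
      fix x assume "x \<in> {..<g}"
      then show "\<exists>y\<in>D. (x, y) \<in> ord_rel" using limptD[OF D(2), of x] by (auto intro: less_imp_le)
    qed
    then show ?thesis using g(2) unfolding stationary_in_def by blast
  qed
  then show "\<exists>g. ucof g \<and> (\<forall>D\<subseteq>{..<g}. limpt D g \<longrightarrow> (\<forall>b<g. limpt D b \<longrightarrow> b \<in> D) \<longrightarrow> S \<inter> D \<noteq> {})"
    using ucof_ord_rel[OF g(1)] by (intro exI[of _ g]) simp
qed

section \<open>The infinite cardinals below kappa\<close>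

definition inits :: "'a set" where
  "inits = {a. infinite {..<a} \<and> (\<forall>b<a. |{..<b}| <o |{..<a}| )}"

lemma inf_cards_ord_rel: "inf_cards ord_rel = inits"
  unfolding inf_cards_def inits_def underS_ord_rel by auto

lemma init_below:
  assumes "infinite {..<a}"
  obtains c where "c \<in> inits" "c \<le> a" "|{..<a}| \<le>o |{..<c}|"
proof -
  define c where "c = (LEAST c. |{..<a}| \<le>o |{..<c}| )"
  have ac: "|{..<a}| \<le>o |{..<c}|" unfolding c_def by (rule LeastI[of _ a]) (simp add: card_of_mono1)
  have ca: "c \<le> a" unfolding c_def by (rule Least_le) (simp add: card_of_mono1)
  have "infinite {..<c}" using ac assms card_of_ordLeq_infinite by blast
  moreover have "|{..<b}| <o |{..<c}|" if "b < c" for b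
  proof -
    have "\<not> |{..<a}| \<le>o |{..<b}|" using not_less_Least[OF that[unfolded c_def]] .
    then have "|{..<b}| <o |{..<a}|" using not_ordLeq_iff_ordLess[OF card_of_Well_order card_of_Well_order] by blast
    then show ?thesis using ac by (rule ordLess_ordLeq_trans)
  qed
  ultimately have "c \<in> inits" unfolding inits_def by simp
  then show ?thesis using that ca ac by blast
qed

lemma card_seg_mono: "a \<le> b \<Longrightarrow> |{..<a}| \<le>o |{..<b}|"
  by (rule card_of_mono1) (auto intro: less_le_trans)

lemma finite_ordLeq_infinite: "finite X \<Longrightarrow> infinite Y \<Longrightarrow> |X| \<le>o |Y|"
  using finite_ordLess_infinite[OF card_of_Well_order card_of_Well_order, of X Y]
  by (simp add: Field_card_of ordLess_imp_ordLeq)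

lemma least_init_countable:
  assumes "c \<in> inits" "inits \<inter> {..<c} = {}"
  shows "countable {..<c}"
proof -
  have fin: "finite {..<b}" if "b < c" for b
  proof (rule ccontr)
    assume "infinite {..<b}"
    then obtain d where "d \<in> inits" "d \<le> b" by (rule init_below)
    then show False using assms(2) that by auto
  qed
  have "inj_on (\<lambda>b. card {..<b}) {..<c}"
  proof (rule inj_onI)
    have *: "card {..<a} < card {..<b}" if "a < b" "b < c" for a b
    proof (rule psubset_card_mono[OF fin[OF that(2)]])
      show "{..<a} \<subset> {..<b}" using that(1) by (auto intro: less_trans)
    qed
    fix a b assume "a \<in> {..<c}" "b \<in> {..<c}" "card {..<a} = card {..<b}"
    then show "a = b" using *[of a b] *[of b a] by (cases a b rule: linorder_cases) auto
  qed
  then show ?thesis by (rule countableI')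
qed

text \<open>As there are finitely many infinite cardinals below kappa, each of them except the first
  is the successor of another.\<close>

lemma init_pred:
  assumes fin: "finite inits" and c: "c \<in> inits" and ne: "inits \<inter> {..<c} \<noteq> {}"
  obtains p where "p \<in> inits" "p < c" "\<And>a. a < c \<Longrightarrow> |{..<a}| \<le>o |{..<p}|"
proof -
  define p where "p = Max (inits \<inter> {..<c})"
  have p: "p \<in> inits \<inter> {..<c}" unfolding p_def using fin ne by (intro Max_in) simp_all
  have q: "|{..<a}| \<le>o |{..<p}|" if "a < c" for a
  proof (cases "finite {..<a}")
    case True
    have "infinite {..<p}" using p unfolding inits_def by simp
    with True show ?thesis by (rule finite_ordLeq_infinite)
  next
    case False
    then obtain d where d: "d \<in> inits" "d \<le> a" "|{..<a}| \<le>o |{..<d}|" by (rule init_below)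
    have "d \<in> inits \<inter> {..<c}" using d(1,2) that by (auto intro: le_less_trans)
    then have "d \<le> p" unfolding p_def using fin by (intro Max_ge) simp_all
    then show ?thesis using card_seg_mono d(3) ordLeq_transitive by blast
  qed
  show ?thesis by (rule that[of p]) (use p q in simp_all)
qed

text \<open>A successor cardinal is not the union of omega many sets whose size is at most that of
  its predecessor.\<close>

lemma init_cofinality:
  assumes fin: "finite inits" and c: "c \<in> inits" and ne: "inits \<inter> {..<c} \<noteq> {}" and f: "\<And>i::nat. f i < c"
  shows "\<exists>b<c. \<forall>i. f i < b"
proof (rule ccontr)
  assume neg: "\<not> ?thesis"
  obtain p where p: "p \<in> inits" "p < c" "\<And>a. a < c \<Longrightarrow> |{..<a}| \<le>o |{..<p}|" using fin c ne by (rule init_pred) blast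
  have pinf: "infinite {..<p}" using p(1) unfolding inits_def by simp
  have ub: "\<exists>i. b \<le> f i" if "b < c" for b using neg that by (metis not_le)
  have "{..<c} = (\<Union>i\<in>(UNIV::nat set). insert (f i) {..<f i})"
  proof
    show "{..<c} \<subseteq> (\<Union>i\<in>(UNIV::nat set). insert (f i) {..<f i})" using ub by (auto simp: le_less)
    show "(\<Union>i\<in>(UNIV::nat set). insert (f i) {..<f i}) \<subseteq> {..<c}" using f by (auto intro: less_trans)
  qed
  moreover have "|\<Union>i\<in>(UNIV::nat set). insert (f i) {..<f i}| \<le>o |{..<p}|"
  proof (rule card_of_UNION_ordLeq_infinite[OF pinf])
    show "|UNIV :: nat set| \<le>o |{..<p}|" using pinf infinite_iff_card_of_nat by blast
    show "\<forall>i\<in>(UNIV::nat set). |insert (f i) {..<f i}| \<le>o |{..<p}|"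
    proof
      fix i :: nat
      have "|{f i} \<union> {..<f i}| \<le>o |{..<p}|"
        using pinf p(3)[OF f] finite_ordLeq_infinite[of "{f i}", OF _ pinf]
        by (intro card_of_Un_ordLeq_infinite_Field card_of_Card_order) (simp_all add: Field_card_of)
      then show "|insert (f i) {..<f i}| \<le>o |{..<p}|" by simp
    qed
  qed
  ultimately have "|{..<c}| \<le>o |{..<p}|" by simp
  moreover have "|{..<p}| <o |{..<c}|" using c p(2) unfolding inits_def by simp
  ultimately show False using not_ordLess_ordLeq by blast
qed

text \<open>Induction on \<open>c\<close>. The first infinite cardinal covers itself. Later, a
  countable subset of \<open>c\<close> is bounded, and the family for the predecessor
  \<open>p\<close> is pulled back along injections of the segments below \<open>c\<close> into
  \<open>p\<close>.\<close>

lemma init_cover: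
  assumes fin: "finite inits"
  shows "c \<in> inits \<Longrightarrow> \<exists>X :: 'a set set. |X| \<le>o |{..<c}| \<and> (\<forall>x\<in>X. countable x) \<and>
        (\<forall>s. s \<subseteq> {..<c} \<and> countable s \<longrightarrow> (\<exists>x\<in>X. s \<subseteq> x))"
proof (induct c rule: less_induct)
  case (less c)
  have cinf: "infinite {..<c}" using less(2) unfolding inits_def by simp
  show ?case
  proof (cases "inits \<inter> {..<c} = {}")
    case True
    have "|{{..<c}}| \<le>o |{..<c}|" by (rule finite_ordLeq_infinite[OF _ cinf]) simp
    then show ?thesis using least_init_countable[OF less(2) True] by (intro exI[of _ "{{..<c}}"]) simp
  next
    case False
    obtain p where p: "p \<in> inits" "p < c" "\<And>a. a < c \<Longrightarrow> |{..<a}| \<le>o |{..<p}|" using fin less(2) False by (rule init_pred) blast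
    from less(1)[OF p(2,1)] obtain Y :: "'a set set" where
      Y0: "|Y| \<le>o |{..<p}| \<and> (\<forall>x\<in>Y. countable x) \<and> (\<forall>s. s \<subseteq> {..<p} \<and> countable s \<longrightarrow> (\<exists>x\<in>Y. s \<subseteq> x))" ..
    then have Y: "|Y| \<le>o |{..<p}|" "\<And>x. x \<in> Y \<Longrightarrow> countable x"
      "\<And>s. s \<subseteq> {..<p} \<Longrightarrow> countable s \<Longrightarrow> \<exists>x\<in>Y. s \<subseteq> x" by simp_all
    have "\<forall>a. \<exists>j. a < c \<longrightarrow> inj_on j {..<a} \<and> j ` {..<a} \<subseteq> {..<p}"
      using p(3) by (simp add: card_of_ordLeq)
    from choice[OF this] obtain j where j: "\<forall>a. a < c \<longrightarrow> inj_on (j a) {..<a} \<and> j a ` {..<a} \<subseteq> {..<p}" ..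
    define X where "X = (\<Union>a\<in>{..<c}. (\<lambda>x. {y\<in>{..<a}. j a y \<in> x}) ` Y)"
    have "|X| \<le>o |{..<c}|" unfolding X_def
    proof (rule card_of_UNION_ordLeq_infinite[OF cinf])
      show "|{..<c}| \<le>o |{..<c}|" by (rule card_of_mono1) simp
      have "|Y| \<le>o |{..<c}|" using Y(1) card_seg_mono[OF less_imp_le[OF p(2)]] by (rule ordLeq_transitive)
      then show "\<forall>a\<in>{..<c}. |(\<lambda>x. {y\<in>{..<a}. j a y \<in> x}) ` Y| \<le>o |{..<c}|"
        using card_of_image ordLeq_transitive by blast
    qed
    moreover have "countable z" if z: "z \<in> X" for z
    proof -
      obtain a x where a: "a < c" "x \<in> Y" "z = {y\<in>{..<a}. j a y \<in> x}" using z unfolding X_def by auto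
      have "inj_on (j a) z" using j a(1,3) by (auto intro: inj_on_subset)
      moreover have "countable (j a ` z)" by (rule countable_subset[OF _ Y(2)[OF a(2)]]) (use a(3) in auto)
      ultimately show ?thesis using countable_image_inj_on by blast
    qed
    moreover have "\<exists>x\<in>X. s \<subseteq> x" if s: "s \<subseteq> {..<c}" "countable s" for s
    proof -
      have "\<exists>a<c. s \<subseteq> {..<a}"
      proof (cases "s = {}")
        case True
        then show ?thesis using p(2) by auto
      next
        case ne: False
        have "from_nat_into s i < c" for i using from_nat_into[OF ne, of i] s(1) by auto
        with init_cofinality[OF fin less(2) False, of "from_nat_into s"]
        obtain a where a: "a < c" "\<forall>i. from_nat_into s i < a" by auto
        have "range (from_nat_into s) \<subseteq> {..<a}" using a(2) by auto
        then have "s \<subseteq> {..<a}" unfolding range_from_nat_into[OF ne s(2)] .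
        then show ?thesis using a(1) by auto
      qed
      then obtain a where a: "a < c" "s \<subseteq> {..<a}" by auto
      have ja: "j a ` {..<a} \<subseteq> {..<p}" using j a(1) by simp
      have "j a ` s \<subseteq> {..<p}" using ja image_mono[OF a(2), of "j a"] by (rule subset_trans[rotated])
      moreover have "countable (j a ` s)" using s(2) by simp
      ultimately obtain x where x: "x \<in> Y" "j a ` s \<subseteq> x" using Y(3) by blast
      have "{y\<in>{..<a}. j a y \<in> x} \<in> X" unfolding X_def using a(1) x(1) by auto
      moreover have "s \<subseteq> {y\<in>{..<a}. j a y \<in> x}" using a(2) x(2) by auto
      ultimately show ?thesis by (rule bexI[rotated])
    qed
    ultimately show ?thesis by (intro exI[of _ X]) simp
  qed
qed

lemma succ_cardinal_aleph:
  assumes CO: "Card_order ord_rel" and al: "is_aleph_Suc ord_rel n"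
    and bn: "bnum_less (Pow (aleph_set ord_rel n))"
    and pw: "|Pow (aleph_set ord_rel n)| =o |UNIV :: 'a set|"
  shows "\<exists>lam F. class.succ_cardinal (\<le>) (<) lam \<and> unbounded_family F \<and> |F| \<le>o |{..<lam}|"
proof -
  have fin: "finite inits" and crd: "card inits = Suc n"
    using al unfolding is_aleph_Suc_def inf_cards_ord_rel by simp_all
  define lam where "lam = Max inits"
  have "inits \<noteq> {}" using crd by auto
  then have lamI: "lam \<in> inits" unfolding lam_def using fin by (intro Max_in)
  have le_lam: "c \<le> lam" if "c \<in> inits" for c unfolding lam_def using fin that by (rule Max_ge)
  have below: "inits \<inter> {..<lam} = inits - {lam}" using le_lam by (auto simp: le_less)
  have cb: "card (inits \<inter> {..<lam}) = n" unfolding below using fin lamI crd by simp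
  have the: "(THE a. a \<in> inits \<and> card (inits \<inter> {..<a}) = n) = lam"
  proof (rule the_equality)
    show "lam \<in> inits \<and> card (inits \<inter> {..<lam}) = n" using lamI cb by simp
    fix a assume a: "a \<in> inits \<and> card (inits \<inter> {..<a}) = n"
    show "a = lam"
    proof (rule ccontr)
      assume "a \<noteq> lam"
      then have "a < lam" using le_lam a by (metis le_less)
      then have "inits \<inter> {..<a} \<subset> inits \<inter> {..<lam}" using a by (auto intro: less_trans)
      then have "card (inits \<inter> {..<a}) < card (inits \<inter> {..<lam})" using fin by (intro psubset_card_mono) simp_all
      then show False using a cb by simp
    qed
  qed
  have as: "aleph_set ord_rel n = {..<lam}" unfolding aleph_set_def inf_cards_ord_rel underS_ord_rel the ..
  have linf: "infinite {..<lam}" using lamI unfolding inits_def by simp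
  have seg: "|{..<a}| \<le>o |{..<lam}|" for a
  proof (cases "finite {..<a}")
    case True then show ?thesis using linf by (rule finite_ordLeq_infinite)
  next
    case False
    then obtain d where d: "d \<in> inits" "d \<le> a" "|{..<a}| \<le>o |{..<d}|" by (rule init_below)
    show ?thesis using d(3) card_seg_mono[OF le_lam[OF d(1)]] by (rule ordLeq_transitive)
  qed
  have UO: "|UNIV :: 'a set| =o ord_rel" using card_of_Field_ordIso[OF CO] unfolding Field_ord_rel .
  have ll: "|{..<lam}| <o |UNIV :: 'a set|"
  proof -
    have "|underS ord_rel lam| <o ord_rel" by (rule card_of_underS[OF CO]) (simp add: Field_ord_rel)
    then show ?thesis unfolding underS_ord_rel using ordIso_symmetric[OF UO] ordLess_ordIso_trans by blast
  qed
  obtain F where F: "unbounded_family F" "|F| <o |Pow {..<lam}|" using bn unfolding bnum_less_def as by blast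
  \<comment> \<open>A set of size below kappa has at most the size of some segment, hence at most
    that of lam.\<close>
  have "|F| <o ord_rel" by (rule ordLess_ordIso_trans[OF ordLess_ordIso_trans[OF F(2) pw[unfolded as]] UO])
  moreover have "Well_order ord_rel" using CO unfolding card_order_on_def by blast
  ultimately obtain a where a: "|F| =o Restr ord_rel (underS ord_rel a)"
    using ordLess_iff_ordIso_Restr[of ord_rel "|F|"] card_of_Well_order by blast
  have "|Field |F| | =o |Field (Restr ord_rel (underS ord_rel a))|" using a by (rule card_of_cong)
  moreover have "|Field (Restr ord_rel (underS ord_rel a))| \<le>o |{..<a}|"
    by (rule card_of_mono1) (auto simp: Field_def underS_ord_rel)
  ultimately have Fa: "|F| \<le>o |{..<a}|" unfolding Field_card_of using ordIso_ordLeq_trans by blast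
  have Fl: "|F| \<le>o |{..<lam}|" using Fa seg by (rule ordLeq_transitive)
  \<comment> \<open>Unboundedness of \<open>F\<close> is used here: a countable lam would make
    \<open>F\<close> countable and hence dominated. So lam is a successor cardinal and has
    uncountable cofinality.\<close>
  have ne: "inits \<inter> {..<lam} \<noteq> {}"
  proof
    assume "inits \<inter> {..<lam} = {}"
    then have "countable {..<lam}" by (rule least_init_countable[OF lamI])
    moreover obtain k where k: "inj_on k F" "k ` F \<subseteq> {..<lam}" using Fl card_of_ordLeq[of F "{..<lam}"] by blast
    ultimately have "countable F" using countable_image_inj_on[OF countable_subset[OF k(2)] k(1)] by blast
    then show False using countable_family_dominated F(1) by blast
  qed
  have pw': "|Pow {..<lam}| =o |UNIV :: 'a set|" using pw unfolding as .
  have "class.succ_cardinal (\<le>) (<) lam"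
  proof (intro class.succ_cardinal.intro class.succ_cardinal_axioms.intro)
    show "class.wellorder (\<le>) (<)" by (rule wellorder_axioms)
    show "infinite {..<lam}" by (rule linf)
    show "|{..<a}| \<le>o |{..<lam}|" for a by (rule seg)
    show "|{..<lam}| <o |UNIV :: 'a set|" by (rule ll)
    show "|{..<b}| <o |{..<lam}|" if "b < lam" for b using lamI that unfolding inits_def by simp
    show "\<exists>b<lam. \<forall>i. f i < b" if "\<forall>i. f (i::nat) < lam" for f
      by (rule init_cofinality[OF fin lamI ne]) (use that in simp)
    show "|Pow {..<lam}| \<le>o |UNIV :: 'a set|" using pw' by (rule ordIso_imp_ordLeq)
    show "|UNIV :: 'a set| \<le>o |Pow {..<lam}|" using ordIso_symmetric[OF pw'] by (rule ordIso_imp_ordLeq)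
    show "\<exists>X :: 'a set set. |X| \<le>o |{..<lam}| \<and> (\<forall>x\<in>X. countable x) \<and>
        (\<forall>c. c \<subseteq> {..<lam} \<and> countable c \<longrightarrow> (\<exists>x\<in>X. c \<subseteq> x))" by (rule init_cover[OF fin lamI])
  qed
  then show ?thesis using F(1) Fl by blast
qed

end

context succ_cardinal
begin

lemma souslin_trees:
  assumes sq: "square ord_rel" and F: "unbounded_family F" "small Lm F"
  shows "(\<exists>(A :: 'a set) lt. souslin_tree ord_rel A lt) \<and>
    (stat_refl ord_rel \<longrightarrow> (\<exists>T :: ('a \<rightharpoonup> 'a) set. unif_coherent ord_rel T \<and> souslin_tree ord_rel T map_lt))"
proof -
  from square_ord_rel[OF sq] obtain C where
    "coh_seq C \<and> (\<forall>D. clubset D \<longrightarrow> (\<exists>a. limpt D a \<and> D \<inter> {..<a} \<noteq> C a))" ..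
  then have C: "coh_seq C" "\<And>D. clubset D \<Longrightarrow> \<exists>a. limpt D a \<and> D \<inter> {..<a} \<noteq> C a" by simp_all
  have "\<exists>C'. coh_seq C' \<and> (\<forall>E. clubset E \<longrightarrow> (\<exists>a. cofw a \<and> (\<forall>x<a. \<exists>b\<in>C' a \<inter> E. x < b \<and> \<not> limpt (C' a) b)))"
    by (rule club_hitting[OF C(1)]) (rule C(2))
  then obtain C1 where
    "coh_seq C1 \<and> (\<forall>E. clubset E \<longrightarrow> (\<exists>a. cofw a \<and> (\<forall>x<a. \<exists>b\<in>C1 a \<inter> E. x < b \<and> \<not> limpt (C1 a) b)))" ..
  then have C1: "coh_seq C1" "\<And>E. clubset E \<Longrightarrow> \<exists>a. cofw a \<and> (\<forall>x<a. \<exists>b\<in>C1 a \<inter> E. x < b \<and> \<not> limpt (C1 a) b)"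
    by simp_all
  have "\<exists>C'. coh_seq C' \<and> hits C'" unfolding hits_def
    by (rule hitting[OF C1(1) _ F]) (rule C1(2))
  then obtain C2 where "coh_seq C2 \<and> hits C2" ..
  then have C2: "coh_seq C2" "hits C2" by simp_all
  from souslin_tree_exists[OF C2] obtain T :: "('a \<rightharpoonup> 'a) set" where
    "souslin_tree ord_rel T map_lt \<and> (\<forall>s\<in>T. \<exists>a. dom s = {..<a})" ..
  then have T: "souslin_tree ord_rel T map_lt" "\<forall>s\<in>T. \<exists>a. dom s = {..<a}" by simp_all
  obtain code :: "('a \<rightharpoonup> 'a) \<Rightarrow> 'a" where
    code: "\<forall>s t. small Lm (dom s) \<longrightarrow> small Lm (dom t) \<longrightarrow> code s = code t \<longrightarrow> s = t" using node_code ..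
  have "inj_on code T"
  proof (rule inj_onI)
    fix s t assume "s \<in> T" "t \<in> T" and e: "code s = code t"
    then obtain a b where "dom s = {..<a}" "dom t = {..<b}" using T(2) by meson
    then show "s = t" using code e small_seg by simp
  qed
  from souslin_tree_rename[OF T(1) this] have "\<exists>(A :: 'a set) lt. souslin_tree ord_rel A lt" by blast
  moreover have "\<exists>T :: ('a \<rightharpoonup> 'a) set. unif_coherent ord_rel T \<and> souslin_tree ord_rel T map_lt" if "stat_refl ord_rel"
    by (rule unif_coherent_souslin_tree_exists[OF C2 reflecting_ord_rel[OF no_max that]])
  ultimately show ?thesis by blast
qed

end

theorem theoremA:
  fixes r :: "'k rel" and n :: nat
  assumes "Card_order r" and "Field r = UNIV"
    and "is_aleph_Suc r n"
    and "bnum_less (Pow (aleph_set r n))"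
    and "(card_of (Pow (aleph_set r n)), card_of (UNIV :: 'k set)) \<in> ordIso"
    and "square r"
  shows "(\<exists>(A :: 'k set) lt. souslin_tree r A lt)
         \<and> (stat_refl r \<longrightarrow> (\<exists>T :: ('k \<rightharpoonup> 'k) set. unif_coherent r T \<and> souslin_tree r T map_lt))"
proof -
  have W: "Well_order r" using assms(1) unfolding card_order_on_def by blast
  then have lin: "Linear_order r" and wf: "wf (r - Id)" unfolding well_order_on_def by auto
  have rf: "(x, x) \<in> r" and tr: "(x, y) \<in> r \<Longrightarrow> (y, z) \<in> r \<Longrightarrow> (x, z) \<in> r"
    and an: "(x, y) \<in> r \<Longrightarrow> (y, x) \<in> r \<Longrightarrow> x = y" for x y z
    using lin assms(2) unfolding linear_order_on_def partial_order_on_def preorder_on_def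
    by (auto simp: refl_on_def dest: transD antisymD)
  have tot: "(x, y) \<in> r \<or> (y, x) \<in> r" for x y
    using lin assms(2) rf unfolding linear_order_on_def total_on_def by (metis UNIV_I)
  \<comment> \<open>The relation \<open>r\<close> itself serves as the order of a well-ordered type,
    so no transfer along an isomorphism takes place.\<close>
  have cw: "class.wellorder (\<lambda>x y. (x, y) \<in> r) (olt r)"
  proof
    show "olt r x y = ((x, y) \<in> r \<and> (y, x) \<notin> r)" for x y unfolding olt_def using an rf by blast
    show "(x, x) \<in> r" for x by (rule rf)
    show "(x, z) \<in> r" if "(x, y) \<in> r" "(y, z) \<in> r" for x y z using that by (rule tr)
    show "x = y" if "(x, y) \<in> r" "(y, x) \<in> r" for x y using that by (rule an)
    show "(x, y) \<in> r \<or> (y, x) \<in> r" for x y by (rule tot)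
    show "P a" if "\<And>x. (\<And>y. olt r y x \<Longrightarrow> P y) \<Longrightarrow> P x" for P a
      using wf by (rule wf_induct_rule) (rule that, simp add: olt_def)
  qed
  have eq: "{(x, y). (x, y) \<in> r} = r" by simp
  obtain lam and F :: "(nat \<Rightarrow> nat) set" where L: "class.succ_cardinal (\<lambda>x y. (x, y) \<in> r) (olt r) lam"
    "unbounded_family F" "|F| \<le>o |ord.lessThan (olt r) lam|"
    using wellorder.succ_cardinal_aleph[OF cw, unfolded eq, OF assms(1,3,4,5)] by blast
  show ?thesis
    by (rule succ_cardinal.souslin_trees[OF L(1), unfolded eq, OF assms(6) L(2,3)])
qed

end
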